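(* Let $(L,\mathcal{D})$ be a purely kinetic Chaplygin nonholonomic system on $Q$. If the nonholonomic vector field $\Gamma_{(L,\mathcal{D})}$ has linear first integrals $\mu_i=\mu_{ai}v^a$ (with $\mu_{ai}$ functions on $Q$) that satisfy, on $\mathcal{C}$, $$\mu_kB^k_{ac}v^a=G_{bk}B^k_{ac}v^bv^a\qquad\text{for all } c,$$ then there exists a geodesic extension of $(L,\mathcal{D})$ by a Riemannian metric $\hat g$.
   Context: All objects are smooth and repeated indices are summed. A purely kinetic Chaplygin nonholonomic system consists of: a manifold $Q$ with an action $G\times Q\to Q$ of a Lie group $G$ such that $\pi:Q\to Q/G$ is a principal fibre bundle; a $G$-invariant Riemannian metric $g$ on $Q$, with Lagrangian $L(v)=\frac12g(v,v)$ on $TQ$; and a $G$-invariant distribution $\mathcal{D}$ which is the horizontal distribution of a principal connection $\omega$ on $\pi$. Let $(x^a)$, $a=1,\dots,m$, be coordinates on $Q/G$ (assumed to be defined on all of $Q/G$, so that the frame below is globally defined), and let $X_a$ be the horizontal lift by $\omega$ of $\partial/\partial x^a$; the $X_a$ are $G$-invariant and span $\mathcal{D}$. Let $\{E_i\}$ be a basis of the Lie algebra of $G$ and $(E_i)_Q$ the corresponding infinitesimal generators. Then $\{X_a,(E_i)_Q\}$ is a frame on $Q$, and $[X_a,(E_i)_Q]=0$, $[X_a,X_b]=B^j_{ab}(E_j)_Q$, which defines the functions $B^j_{ab}$ on $Q$. Put $G_{ai}=g(X_a,(E_i)_Q)$. $\mathcal{C}$ denotes $\mathcal{D}$ viewed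 as a submanifold of $TQ$; the functions $v^a$ on $\mathcal{C}$ are defined by $v_q=v^aX_a(q)$ for $v_q\in\mathcal{D}_q$. $X^C$, $X^V$ are the complete and vertical lifts to $TQ$ of a vector field $X$ on $Q$. The nonholonomic vector field $\Gamma_{(L,\mathcal{D})}$ is the unique vector field on $\mathcal{C}$ of the form $v^aX_a^C+f^aX_a^V$ satisfying $\Gamma_{(L,\mathcal{D})}(X^V(L))-X^C(L)=0$ on $\mathcal{C}$ for all $X\in\mathrm{Sec}(\mathcal{D})$. A first integral of $\Gamma_{(L,\mathcal{D})}$ is a function $\mu$ on $\mathcal{C}$ with $\Gamma_{(L,\mathcal{D})}(\mu)=0$. A geodesic extension of $(L,\mathcal{D})$ is a Riemannian metric $\hat g$ on $Q$ whose geodesic spray $\Gamma_{\hat g}$ satisfies $\Gamma_{\hat g}|_{\mathcal{C}}=\Gamma_{(L,\mathcal{D})}$ (equivalently, every base integral curve of $\Gamma_{(L,\mathcal{D})}$ is a geodesic of $\hat g$). *)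

theory Defs
  imports "HOL-Analysis.Analysis" "HOL-Algebra.Group_Action"
begin

section \<open>Smooth manifolds\<close>

abbreviation dderiv :: "('a::real_normed_vector \<Rightarrow> 'b::real_normed_vector) \<Rightarrow> 'a \<Rightarrow> 'a \<Rightarrow> 'b"
  where "dderiv f x v \<equiv> frechet_derivative f (at x) v"

text \<open>The sets \<open>S\<close> below are always open subsets of Euclidean spaces.\<close>

primrec Ck_on ::
  "nat \<Rightarrow> ('a::real_normed_vector \<Rightarrow> 'b::real_normed_vector) \<Rightarrow> 'a set \<Rightarrow> bool" where
  "Ck_on 0 f S \<longleftrightarrow> continuous_on S f"
| "Ck_on (Suc k) f S \<longleftrightarrow>
     (\<forall>x\<in>S. f differentiable (at x)) \<and> (\<forall>v. Ck_on k (\<lambda>x. dderiv f x v) S)"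

definition smooth_on ::
  "'a::real_normed_vector set \<Rightarrow> ('a \<Rightarrow> 'b::real_normed_vector) \<Rightarrow> bool"
  where "smooth_on S f \<longleftrightarrow> (\<forall>k. Ck_on k f S)"

text \<open>A chart is a domain together with a coordinate map, whose values outside the domain are
  irrelevant. A manifold is given by an atlas (not necessarily maximal); its underlying set is the
  union of the chart domains, and its topology is the one induced by the atlas.\<close>

type_synonym ('a, 'e) chart = "'a set \<times> ('a \<Rightarrow> 'e)"
type_synonym ('a, 'e) atlas = "('a, 'e) chart set"

definition points :: "('a, 'e) atlas \<Rightarrow> 'a set"
  where "points A = \<Union> (fst ` A)"

definition chart_img :: "('a, 'e) chart \<Rightarrow> 'e set"
  where "chart_img c = snd c ` fst c"

definition chart_inv :: "('a, 'e) chart \<Rightarrow> 'e \<Rightarrow> 'a"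
  where "chart_inv c = inv_into (fst c) (snd c)"

definition manifold_top :: "('a, 'e::euclidean_space) atlas \<Rightarrow> 'a topology"
  where "manifold_top A =
    topology (\<lambda>U. U \<subseteq> points A \<and> (\<forall>c\<in>A. open (snd c ` (fst c \<inter> U))))"

definition smooth_manifold :: "('a, 'e::euclidean_space) atlas \<Rightarrow> bool"
  where "smooth_manifold A \<longleftrightarrow>
    (\<forall>c\<in>A. inj_on (snd c) (fst c) \<and> open (chart_img c)) \<and>
    (\<forall>c\<in>A. \<forall>d\<in>A. open (snd c ` (fst c \<inter> fst d)) \<and>
        smooth_on (snd c ` (fst c \<inter> fst d)) (snd d \<circ> chart_inv c)) \<and>
    Hausdorff_space (manifold_top A) \<and> second_countable (manifold_top A)"

lemma openin_manifold_top:
  assumes inj: "\<And>c. c \<in> A \<Longrightarrow> inj_on (snd c) (fst c)"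
  shows "openin (manifold_top A) U \<longleftrightarrow>
    U \<subseteq> points A \<and> (\<forall>c\<in>A. open (snd c ` (fst c \<inter> U)))"
proof -
  have "istopology (\<lambda>U. U \<subseteq> points A \<and> (\<forall>c\<in>A. open (snd c ` (fst c \<inter> U))))"
    unfolding istopology_def
  proof (intro conjI allI impI ballI)
    fix S T c
    assume S: "S \<subseteq> points A \<and> (\<forall>c\<in>A. open (snd c ` (fst c \<inter> S)))"
      and T: "T \<subseteq> points A \<and> (\<forall>c\<in>A. open (snd c ` (fst c \<inter> T)))"
      and c: "c \<in> A"
    have "snd c ` (fst c \<inter> (S \<inter> T)) = snd c ` (fst c \<inter> S) \<inter> snd c ` (fst c \<inter> T)"
      using inj[OF c] by (auto simp: inj_on_def)
    then show "open (snd c ` (fst c \<inter> (S \<inter> T)))"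
      using S T c by auto
  next
    fix \<K> c
    assume K: "\<forall>K\<in>\<K>. K \<subseteq> points A \<and> (\<forall>c\<in>A. open (snd c ` (fst c \<inter> K)))"
      and c: "c \<in> A"
    have "snd c ` (fst c \<inter> \<Union>\<K>) = (\<Union>K\<in>\<K>. snd c ` (fst c \<inter> K))"
      by auto
    then show "open (snd c ` (fst c \<inter> \<Union>\<K>))"
      using K c by auto
  qed auto
  then show ?thesis
    by (simp add: manifold_top_def)
qed

definition restrict_atlas :: "('a, 'e) atlas \<Rightarrow> 'a set \<Rightarrow> ('a, 'e) atlas"
  where "restrict_atlas A U = (\<lambda>c. (fst c \<inter> U, snd c)) ` A"

definition prod_atlas :: "('a, 'e) atlas \<Rightarrow> ('b, 'f) atlas \<Rightarrow> ('a \<times> 'b, 'e \<times> 'f) atlas"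
  where "prod_atlas A B = (\<lambda>(c, d). (fst c \<times> fst d, map_prod (snd c) (snd d))) ` (A \<times> B)"

definition smooth_map ::
  "('a, 'e::euclidean_space) atlas \<Rightarrow> ('b, 'f::euclidean_space) atlas \<Rightarrow> ('a \<Rightarrow> 'b) \<Rightarrow> bool"
  where "smooth_map A B f \<longleftrightarrow>
    f ` points A \<subseteq> points B \<and>
    (\<forall>c\<in>A. \<forall>d\<in>B. open (snd c ` (fst c \<inter> f -` fst d)) \<and>
        smooth_on (snd c ` (fst c \<inter> f -` fst d)) (snd d \<circ> f \<circ> chart_inv c))"

definition smooth_fun ::
  "('a, 'e::euclidean_space) atlas \<Rightarrow> ('a \<Rightarrow> 'b::real_normed_vector) \<Rightarrow> bool"
  where "smooth_fun A f \<longleftrightarrow> (\<forall>c\<in>A. smooth_on (chart_img c) (f \<circ> chart_inv c))"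

definition diffeomorphism ::
  "('a, 'e::euclidean_space) atlas \<Rightarrow> ('b, 'f::euclidean_space) atlas \<Rightarrow> ('a \<Rightarrow> 'b) \<Rightarrow> bool"
  where "diffeomorphism A B f \<longleftrightarrow>
    bij_betw f (points A) (points B) \<and> smooth_map A B f \<and>
    smooth_map B A (inv_into (points A) f)"

section \<open>Tangent vectors\<close>

text \<open>A tangent vector at \<open>p\<close> is the family of its coordinate representations in all charts of the
  atlas around \<open>p\<close>, related by the derivatives of the coordinate changes (and set to 0 at all
  other arguments). The vector space operations are pointwise.\<close>

type_synonym ('a, 'e) tvec = "('a, 'e) chart \<Rightarrow> 'e"

definition tangent_space :: "('a, 'e::euclidean_space) atlas \<Rightarrow> 'a \<Rightarrow> ('a, 'e) tvec set"
  where "tangent_space A p =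
    {v. (\<forall>c\<in>A. \<forall>d\<in>A. p \<in> fst c \<longrightarrow> p \<in> fst d \<longrightarrow>
            v d = dderiv (snd d \<circ> chart_inv c) (snd c p) (v c)) \<and>
        (\<forall>c. c \<notin> A \<or> p \<notin> fst c \<longrightarrow> v c = 0)}"

definition tcomb :: "('i::finite \<Rightarrow> real) \<Rightarrow> ('i \<Rightarrow> ('a, 'e::real_vector) tvec) \<Rightarrow> ('a, 'e) tvec"
  where "tcomb y V = (\<lambda>c. \<Sum>i\<in>UNIV. y i *\<^sub>R V i c)"

definition tlin :: "real \<Rightarrow> ('a, 'e::real_vector) tvec \<Rightarrow> real \<Rightarrow> ('a, 'e) tvec \<Rightarrow> ('a, 'e) tvec"
  where "tlin r v s w = (\<lambda>c. r *\<^sub>R v c + s *\<^sub>R w c)"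

text \<open>The tangent vector at \<open>p\<close> whose coordinates in the chart \<open>c\<close> are \<open>u\<close>.\<close>

definition coord_vec ::
  "('a, 'e::euclidean_space) atlas \<Rightarrow> ('a, 'e) chart \<Rightarrow> 'a \<Rightarrow> 'e \<Rightarrow> ('a, 'e) tvec"
  where "coord_vec A c p u =
    (\<lambda>d. if d \<in> A \<and> p \<in> fst d then dderiv (snd d \<circ> chart_inv c) (snd c p) u else 0)"

text \<open>The constructions below that are given by a coordinate formula use some chart around the
  point; their values do not depend on that choice.\<close>

definition chart_at :: "('a, 'e) atlas \<Rightarrow> 'a \<Rightarrow> ('a, 'e) chart"
  where "chart_at A p = (SOME c. c \<in> A \<and> p \<in> fst c)"

definition differential ::
  "('a, 'e::euclidean_space) atlas \<Rightarrow> ('b, 'f::euclidean_space) atlas \<Rightarrow> ('a \<Rightarrow> 'b) \<Rightarrow>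
   'a \<Rightarrow> ('a, 'e) tvec \<Rightarrow> ('b, 'f) tvec"
  where "differential A B f p v =
    (let c = chart_at A p; d = chart_at B (f p)
     in coord_vec B d (f p) (dderiv (snd d \<circ> f \<circ> chart_inv c) (snd c p) (v c)))"

definition deriv_at ::
  "('a, 'e::euclidean_space) atlas \<Rightarrow> ('a \<Rightarrow> real) \<Rightarrow> 'a \<Rightarrow> ('a, 'e) tvec \<Rightarrow> real"
  where "deriv_at A f p v =
    (let c = chart_at A p in dderiv (f \<circ> chart_inv c) (snd c p) (v c))"

definition vector_field ::
  "('a, 'e::euclidean_space) atlas \<Rightarrow> ('a \<Rightarrow> ('a, 'e) tvec) \<Rightarrow> bool"
  where "vector_field A X \<longleftrightarrow>
    (\<forall>p\<in>points A. X p \<in> tangent_space A p) \<and>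
    (\<forall>c\<in>A. smooth_on (chart_img c) (\<lambda>x. X (chart_inv c x) c))"

definition lie_bracket ::
  "('a, 'e::euclidean_space) atlas \<Rightarrow> ('a \<Rightarrow> ('a, 'e) tvec) \<Rightarrow> ('a \<Rightarrow> ('a, 'e) tvec) \<Rightarrow>
   'a \<Rightarrow> ('a, 'e) tvec"
  where "lie_bracket A X Y p =
    (let c = chart_at A p
     in coord_vec A c p
          (dderiv (\<lambda>x. Y (chart_inv c x) c) (snd c p) (X p c) -
           dderiv (\<lambda>x. X (chart_inv c x) c) (snd c p) (Y p c)))"

text \<open>Smooth functions on a submanifold \<open>S\<close> are those that locally extend to smooth functions on the
  ambient manifold. The derivative of such a function along a vector \<open>w\<close> tangent to \<open>S\<close> is the
  derivative of any local extension.\<close>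

definition local_extension ::
  "('a, 'e::euclidean_space) atlas \<Rightarrow> 'a set \<Rightarrow> ('a \<Rightarrow> real) \<Rightarrow> 'a \<Rightarrow> ('a \<Rightarrow> real) \<Rightarrow> bool"
  where "local_extension A S f p F \<longleftrightarrow>
    (\<exists>U. openin (manifold_top A) U \<and> p \<in> U \<and>
         smooth_fun (restrict_atlas A U) F \<and> (\<forall>z\<in>U \<inter> S. F z = f z))"

definition smooth_fun_on ::
  "('a, 'e::euclidean_space) atlas \<Rightarrow> 'a set \<Rightarrow> ('a \<Rightarrow> real) \<Rightarrow> bool"
  where "smooth_fun_on A S f \<longleftrightarrow> (\<forall>p\<in>S. \<exists>F. local_extension A S f p F)"

definition deriv_on ::
  "('a, 'e::euclidean_space) atlas \<Rightarrow> 'a set \<Rightarrow> ('a \<Rightarrow> real) \<Rightarrow> 'a \<Rightarrow> ('a, 'e) tvec \<Rightarrow> real"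
  where "deriv_on A S f p w =
    (THE r. \<exists>F. local_extension A S f p F \<and> deriv_at A F p w = r)"

section \<open>The tangent bundle\<close>

definition lift_chart ::
  "('a, 'e::euclidean_space) atlas \<Rightarrow> ('a, 'e) chart \<Rightarrow> ('a \<times> ('a, 'e) tvec, 'e \<times> 'e) chart"
  where "lift_chart A c =
    ({(q, v). q \<in> fst c \<and> v \<in> tangent_space A q}, (\<lambda>(q, v). (snd c q, v c)))"

definition tangent_atlas ::
  "('a, 'e::euclidean_space) atlas \<Rightarrow> ('a \<times> ('a, 'e) tvec, 'e \<times> 'e) atlas"
  where "tangent_atlas A = lift_chart A ` A"

type_synonym ('a, 'e) ttvec = "('a \<times> ('a, 'e) tvec, 'e \<times> 'e) tvec"

text \<open>In induced coordinates \<open>(q, v)\<close>: \<open>X\<^sup>V = X\<^sup>i \<partial>/\<partial>v\<^sup>i\<close> and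
  \<open>X\<^sup>C = X\<^sup>i \<partial>/\<partial>q\<^sup>i + v\<^sup>j (\<partial>X\<^sup>i/\<partial>q\<^sup>j) \<partial>/\<partial>v\<^sup>i\<close>.\<close>

definition vertical_lift ::
  "('a, 'e::euclidean_space) atlas \<Rightarrow> ('a \<Rightarrow> ('a, 'e) tvec) \<Rightarrow>
   'a \<times> ('a, 'e) tvec \<Rightarrow> ('a, 'e) ttvec"
  where "vertical_lift A X = (\<lambda>(q, v). let c = chart_at A q
    in coord_vec (tangent_atlas A) (lift_chart A c) (q, v) (0, X q c))"

definition complete_lift ::
  "('a, 'e::euclidean_space) atlas \<Rightarrow> ('a \<Rightarrow> ('a, 'e) tvec) \<Rightarrow>
   'a \<times> ('a, 'e) tvec \<Rightarrow> ('a, 'e) ttvec"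
  where "complete_lift A X = (\<lambda>(q, v). let c = chart_at A q
    in coord_vec (tangent_atlas A) (lift_chart A c) (q, v)
         (X q c, dderiv (\<lambda>x. X (chart_inv c x) c) (snd c q) (v c)))"

section \<open>Riemannian metrics and geodesic sprays\<close>

type_synonym ('a, 'e) metric = "'a \<Rightarrow> ('a, 'e) tvec \<Rightarrow> ('a, 'e) tvec \<Rightarrow> real"

definition metric_mat ::
  "('a, real^'n::finite) atlas \<Rightarrow> ('a, real^'n) metric \<Rightarrow> ('a, real^'n) chart \<Rightarrow>
   real^'n \<Rightarrow> real^'n^'n"
  where "metric_mat A g c x = (\<chi> i j. let p = chart_inv c x
    in g p (coord_vec A c p (axis i 1)) (coord_vec A c p (axis j 1)))"

definition riemannian_metric ::
  "('a, real^'n::finite) atlas \<Rightarrow> ('a, real^'n) metric \<Rightarrow> bool"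
  where "riemannian_metric A g \<longleftrightarrow>
    (\<forall>p\<in>points A. \<forall>u\<in>tangent_space A p. \<forall>v\<in>tangent_space A p.
        g p u v = g p v u \<and>
        (u \<noteq> (\<lambda>_. 0) \<longrightarrow> g p u u > 0) \<and>
        (\<forall>w\<in>tangent_space A p. \<forall>r s. g p (tlin r u s v) w = r * g p u w + s * g p v w)) \<and>
    (\<forall>c\<in>A. smooth_on (chart_img c) (metric_mat A g c))"

text \<open>\<open>\<Gamma>\<^sup>k\<^sub>i\<^sub>j = 1/2 g\<^sup>k\<^sup>l (\<partial>\<^sub>i g\<^sub>j\<^sub>l + \<partial>\<^sub>j g\<^sub>i\<^sub>l - \<partial>\<^sub>l g\<^sub>i\<^sub>j)\<close>\<close>

definition christoffel ::
  "('a, real^'n::finite) atlas \<Rightarrow> ('a, real^'n) metric \<Rightarrow> ('a, real^'n) chart \<Rightarrow> real^'n \<Rightarrow>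
   'n \<Rightarrow> 'n \<Rightarrow> 'n \<Rightarrow> real"
  where "christoffel A g c x k i j =
    (let h = metric_mat A g c; dh = (\<lambda>i j l. dderiv (\<lambda>y. h y $ j $ l) x (axis i 1))
     in 1 / 2 * (\<Sum>l\<in>UNIV. matrix_inv (h x) $ k $ l * (dh i j l + dh j i l - dh l i j)))"

definition geodesic_spray ::
  "('a, real^'n::finite) atlas \<Rightarrow> ('a, real^'n) metric \<Rightarrow>
   'a \<times> ('a, real^'n) tvec \<Rightarrow> ('a, real^'n) ttvec"
  where "geodesic_spray A g = (\<lambda>(q, v). let c = chart_at A q
    in coord_vec (tangent_atlas A) (lift_chart A c) (q, v)
         (v c, - (\<chi> k. \<Sum>i\<in>UNIV. \<Sum>j\<in>UNIV.
                    christoffel A g c (snd c q) k i j * (v c $ i) * (v c $ j))))"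

section \<open>Lie groups, principal bundles and principal connections\<close>

definition lie_group ::
  "('g, 'z) monoid_scheme \<Rightarrow> ('g, 'e::euclidean_space) atlas \<Rightarrow> bool"
  where "lie_group G AG \<longleftrightarrow>
    group G \<and> smooth_manifold AG \<and> points AG = carrier G \<and>
    smooth_map (prod_atlas AG AG) AG (\<lambda>(s, t). s \<otimes>\<^bsub>G\<^esub> t) \<and>
    smooth_map AG AG (\<lambda>s. inv\<^bsub>G\<^esub> s)"

text \<open>The base is the set \<open>Q/G\<close> of orbits, with an atlas \<open>AB\<close>. Left actions are used throughout.\<close>

definition principal_bundle ::
  "('g, 'z) monoid_scheme \<Rightarrow> ('g, 'h::euclidean_space) atlas \<Rightarrow>
   ('q, 'e::euclidean_space) atlas \<Rightarrow> ('q set, 'b::euclidean_space) atlas \<Rightarrow>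
   ('g \<Rightarrow> 'q \<Rightarrow> 'q) \<Rightarrow> bool"
  where "principal_bundle G AG AQ AB \<psi> \<longleftrightarrow>
    lie_group G AG \<and> smooth_manifold AQ \<and> smooth_manifold AB \<and>
    group_action G (points AQ) \<psi> \<and>
    smooth_map (prod_atlas AG AQ) AQ (\<lambda>(s, q). \<psi> s q) \<and>
    points AB = orbits G (points AQ) \<psi> \<and>
    smooth_map AQ AB (orbit G \<psi>) \<and>
    (\<forall>b\<in>points AB. \<exists>U \<tau>. openin (manifold_top AB) U \<and> b \<in> U \<and>
        diffeomorphism (restrict_atlas AQ {q \<in> points AQ. orbit G \<psi> q \<in> U})
          (prod_atlas (restrict_atlas AB U) AG) \<tau> \<and>
        (\<forall>q\<in>points AQ. orbit G \<psi> q \<in> U \<longrightarrow>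
            fst (\<tau> q) = orbit G \<psi> q \<and>
            (\<forall>s\<in>carrier G. snd (\<tau> (\<psi> s q)) = s \<otimes>\<^bsub>G\<^esub> snd (\<tau> q))))"

abbreviation lie_algebra ::
  "('g, 'z) monoid_scheme \<Rightarrow> ('g, 'h::euclidean_space) atlas \<Rightarrow> ('g, 'h) tvec set"
  where "lie_algebra G AG \<equiv> tangent_space AG \<one>\<^bsub>G\<^esub>"

definition lie_algebra_basis ::
  "('g, 'z) monoid_scheme \<Rightarrow> ('g, 'h::euclidean_space) atlas \<Rightarrow>
   ('i::finite \<Rightarrow> ('g, 'h) tvec) \<Rightarrow> bool"
  where "lie_algebra_basis G AG E \<longleftrightarrow>
    (\<forall>i. E i \<in> lie_algebra G AG) \<and> (\<forall>\<xi>\<in>lie_algebra G AG. \<exists>!y. \<xi> = tcomb y E)"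

text \<open>The generator \<open>\<xi>\<^sub>Q(q) = d/dt exp(t\<xi>)q\<close> at \<open>t = 0\<close> is the image of \<open>\<xi>\<close> under the differential of
  the orbit map \<open>s \<mapsto> sq\<close> at the identity.\<close>

definition inf_generator ::
  "('g, 'z) monoid_scheme \<Rightarrow> ('g, 'h::euclidean_space) atlas \<Rightarrow>
   ('q, 'e::euclidean_space) atlas \<Rightarrow> ('g \<Rightarrow> 'q \<Rightarrow> 'q) \<Rightarrow>
   ('g, 'h) tvec \<Rightarrow> 'q \<Rightarrow> ('q, 'e) tvec"
  where "inf_generator G AG AQ \<psi> \<xi> q = differential AG AQ (\<lambda>s. \<psi> s q) \<one>\<^bsub>G\<^esub> \<xi>"

definition Ad ::
  "('g, 'z) monoid_scheme \<Rightarrow> ('g, 'h::euclidean_space) atlas \<Rightarrow> 'g \<Rightarrow>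
   ('g, 'h) tvec \<Rightarrow> ('g, 'h) tvec"
  where "Ad G AG s \<xi> = differential AG AG (\<lambda>t. s \<otimes>\<^bsub>G\<^esub> t \<otimes>\<^bsub>G\<^esub> inv\<^bsub>G\<^esub> s) \<one>\<^bsub>G\<^esub> \<xi>"

definition principal_connection ::
  "('g, 'z) monoid_scheme \<Rightarrow> ('g, 'h::euclidean_space) atlas \<Rightarrow>
   ('q, 'e::euclidean_space) atlas \<Rightarrow> ('g \<Rightarrow> 'q \<Rightarrow> 'q) \<Rightarrow>
   ('q \<Rightarrow> ('q, 'e) tvec \<Rightarrow> ('g, 'h) tvec) \<Rightarrow> bool"
  where "principal_connection G AG AQ \<psi> \<omega> \<longleftrightarrow>
    (\<forall>q\<in>points AQ. \<forall>v\<in>tangent_space AQ q.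
        \<omega> q v \<in> lie_algebra G AG \<and>
        (\<forall>w\<in>tangent_space AQ q. \<forall>r s.
            \<omega> q (tlin r v s w) = tlin r (\<omega> q v) s (\<omega> q w)) \<and>
        (\<forall>s\<in>carrier G.
            \<omega> (\<psi> s q) (differential AQ AQ (\<psi> s) q v) = Ad G AG s (\<omega> q v))) \<and>
    (\<forall>q\<in>points AQ. \<forall>\<xi>\<in>lie_algebra G AG. \<omega> q (inf_generator G AG AQ \<psi> \<xi> q) = \<xi>) \<and>
    (\<forall>c\<in>AQ. \<forall>d\<in>AG. \<one>\<^bsub>G\<^esub> \<in> fst d \<longrightarrow> (\<forall>u.
        smooth_on (chart_img c)
          (\<lambda>x. \<omega> (chart_inv c x) (coord_vec AQ c (chart_inv c x) u) d)))"

definition horizontal ::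
  "('q, 'e::euclidean_space) atlas \<Rightarrow> ('q \<Rightarrow> ('q, 'e) tvec \<Rightarrow> ('g, 'h::euclidean_space) tvec) \<Rightarrow>
   'q \<Rightarrow> ('q, 'e) tvec set"
  where "horizontal AQ \<omega> q = {v \<in> tangent_space AQ q. \<omega> q v = (\<lambda>_. 0)}"

definition sections ::
  "('q, 'e::euclidean_space) atlas \<Rightarrow> ('q \<Rightarrow> ('q, 'e) tvec set) \<Rightarrow> ('q \<Rightarrow> ('q, 'e) tvec) set"
  where "sections AQ \<D> = {X. vector_field AQ X \<and> (\<forall>q\<in>points AQ. X q \<in> \<D> q)}"

definition horizontal_lift ::
  "('g, 'z) monoid_scheme \<Rightarrow> ('q, 'e::euclidean_space) atlas \<Rightarrow>
   ('q set, 'b::euclidean_space) atlas \<Rightarrow> ('g \<Rightarrow> 'q \<Rightarrow> 'q) \<Rightarrow>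
   ('q \<Rightarrow> ('q, 'e) tvec \<Rightarrow> ('g, 'h::euclidean_space) tvec) \<Rightarrow>
   ('q set \<Rightarrow> ('q set, 'b) tvec) \<Rightarrow> ('q \<Rightarrow> ('q, 'e) tvec) \<Rightarrow> bool"
  where "horizontal_lift G AQ AB \<psi> \<omega> Z X \<longleftrightarrow>
    X \<in> sections AQ (horizontal AQ \<omega>) \<and>
    (\<forall>q\<in>points AQ. differential AQ AB (orbit G \<psi>) q (X q) = Z (orbit G \<psi> q))"

definition invariant_metric ::
  "('g, 'z) monoid_scheme \<Rightarrow> ('q, 'e::euclidean_space) atlas \<Rightarrow> ('g \<Rightarrow> 'q \<Rightarrow> 'q) \<Rightarrow>
   ('q, 'e) metric \<Rightarrow> bool"
  where "invariant_metric G AQ \<psi> g \<longleftrightarrow>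
    (\<forall>s\<in>carrier G. \<forall>q\<in>points AQ. \<forall>v\<in>tangent_space AQ q. \<forall>w\<in>tangent_space AQ q.
        g (\<psi> s q) (differential AQ AQ (\<psi> s) q v) (differential AQ AQ (\<psi> s) q w) = g q v w)"

section \<open>Purely kinetic Chaplygin nonholonomic systems\<close>

text \<open>The distribution of the system is \<open>horizontal AQ \<omega>\<close>.\<close>

definition chaplygin_system ::
  "('g, 'z) monoid_scheme \<Rightarrow> ('g, 'h::euclidean_space) atlas \<Rightarrow>
   ('q, real^'n::finite) atlas \<Rightarrow> ('q set, 'b::euclidean_space) atlas \<Rightarrow>
   ('g \<Rightarrow> 'q \<Rightarrow> 'q) \<Rightarrow> ('q, real^'n) metric \<Rightarrow>
   ('q \<Rightarrow> ('q, real^'n) tvec \<Rightarrow> ('g, 'h) tvec) \<Rightarrow> bool"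
  where "chaplygin_system G AG AQ AB \<psi> g \<omega> \<longleftrightarrow>
    principal_bundle G AG AQ AB \<psi> \<and>
    riemannian_metric AQ g \<and> invariant_metric G AQ \<psi> g \<and>
    principal_connection G AG AQ \<psi> \<omega>"

definition lagrangian :: "('q, 'e) metric \<Rightarrow> 'q \<times> ('q, 'e) tvec \<Rightarrow> real"
  where "lagrangian g = (\<lambda>(q, v). g q v v / 2)"

definition constraint_set ::
  "('q, 'e::euclidean_space) atlas \<Rightarrow> ('q \<Rightarrow> ('q, 'e) tvec set) \<Rightarrow> ('q \<times> ('q, 'e) tvec) set"
  where "constraint_set AQ \<D> = {(q, v). q \<in> points AQ \<and> v \<in> \<D> q}"

text \<open>The functions \<open>v\<^sup>a\<close> on the constraint set: the components of \<open>v\<close> in the frame \<open>X\<close>.\<close>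

definition velocity_coeff ::
  "('a::finite \<Rightarrow> 'q \<Rightarrow> ('q, 'e::real_vector) tvec) \<Rightarrow> 'q \<times> ('q, 'e) tvec \<Rightarrow> 'a \<Rightarrow> real"
  where "velocity_coeff X = (\<lambda>(q, v). THE y. v = tcomb y (\<lambda>a. X a q))"

definition nonholonomic_field ::
  "('q, 'e::euclidean_space) atlas \<Rightarrow> ('q \<times> ('q, 'e) tvec \<Rightarrow> real) \<Rightarrow>
   ('q \<Rightarrow> ('q, 'e) tvec set) \<Rightarrow> ('a::finite \<Rightarrow> 'q \<Rightarrow> ('q, 'e) tvec) \<Rightarrow>
   ('q \<times> ('q, 'e) tvec \<Rightarrow> ('q, 'e) ttvec) \<Rightarrow> bool"
  where "nonholonomic_field AQ L \<D> X \<Gamma> \<longleftrightarrow>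
    (let TQ = tangent_atlas AQ; \<C> = constraint_set AQ \<D> in
     (\<exists>f. (\<forall>a. smooth_fun_on TQ \<C> (\<lambda>p. f p a)) \<and>
          (\<forall>p\<in>\<C>. \<Gamma> p = tlin 1 (tcomb (velocity_coeff X p) (\<lambda>a. complete_lift AQ (X a) p))
                            1 (tcomb (f p) (\<lambda>a. vertical_lift AQ (X a) p)))) \<and>
     (\<forall>Y\<in>sections AQ \<D>. \<forall>p\<in>\<C>.
        deriv_on TQ \<C> (\<lambda>z. deriv_at TQ L z (vertical_lift AQ Y z)) p (\<Gamma> p)
        - deriv_at TQ L p (complete_lift AQ Y p) = 0))"

definition first_integral ::
  "('q, 'e::euclidean_space) atlas \<Rightarrow> ('q \<Rightarrow> ('q, 'e) tvec set) \<Rightarrow>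
   ('q \<times> ('q, 'e) tvec \<Rightarrow> ('q, 'e) ttvec) \<Rightarrow> ('q \<times> ('q, 'e) tvec \<Rightarrow> real) \<Rightarrow> bool"
  where "first_integral AQ \<D> \<Gamma> \<mu> \<longleftrightarrow>
    (let TQ = tangent_atlas AQ; \<C> = constraint_set AQ \<D> in
     smooth_fun_on TQ \<C> \<mu> \<and> (\<forall>p\<in>\<C>. deriv_on TQ \<C> \<mu> p (\<Gamma> p) = 0))"

definition geodesic_extension ::
  "('q, real^'n::finite) atlas \<Rightarrow> ('q \<Rightarrow> ('q, real^'n) tvec set) \<Rightarrow>
   ('q \<times> ('q, real^'n) tvec \<Rightarrow> ('q, real^'n) ttvec) \<Rightarrow> ('q, real^'n) metric \<Rightarrow> bool"
  where "geodesic_extension AQ \<D> \<Gamma> \<gamma> \<longleftrightarrow>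
    riemannian_metric AQ \<gamma> \<and> (\<forall>p\<in>constraint_set AQ \<D>. geodesic_spray AQ \<gamma> p = \<Gamma> p)"

end

theory Submission
  imports Defs
begin

text \<open>The horizontal lifts \<open>X\<^sub>a\<close> and the generators \<open>(E\<^sub>i)\<^sub>Q\<close> form a frame of \<open>Q\<close>. Its dual coframe
  consists of \<open>\<alpha>\<close>, the \<open>x\<close>-components of the differential of the bundle projection, and \<open>\<beta>\<close>, the
  components of the connection form. The idea is to keep the metric on the distribution and to let
  the coefficients of the linear first integrals be the mixed components: with
  \<open>G\<^sub>a\<^sub>b = g(X\<^sub>a, X\<^sub>b)\<close> and \<open>\<theta> = \<alpha> + G\<^sup>-\<^sup>1\<mu> \<beta>\<close>, the metric
  \<open>\<gamma> = G\<^sub>a\<^sub>b \<theta>\<^sup>a \<theta>\<^sup>b + \<delta>\<^sub>i\<^sub>j \<beta>\<^sup>i \<beta>\<^sup>j\<close> satisfies \<open>\<gamma>(X\<^sub>a, X\<^sub>b) = G\<^sub>a\<^sub>b\<close> and \<open>\<gamma>(X\<^sub>a, (E\<^sub>i)\<^sub>Q) = \<mu>\<^sub>a\<^sub>i\<close>, and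
  because the square is completed it is positive definite for every \<open>\<mu>\<close>.

  Let \<open>v\<close> be horizontal and let \<open>F\<close> be the acceleration that \<open>\<Gamma>\<close> assigns to \<open>v\<close> in a chart. The spray of
  \<open>\<gamma>\<close> at \<open>v\<close> is \<open>\<Gamma>\<close> as soon as the Euler-Lagrange expression of \<open>\<gamma>\<close> at \<open>(v, F)\<close> vanishes
  (lemma \<open>spray_of_euler_lagrange\<close>). That expression is linear in the test vector, so it
  is enough to test it on the frame. Extend \<open>v\<close> to the field \<open>Y = v\<^sup>aX\<^sub>a\<close> with constant \<open>v\<^sup>a\<close>. By
  lemma \<open>euler_lagrange_along_fields\<close>, the expression tested on a field \<open>W\<close> is
  determined by the functions \<open>\<gamma>(Y, W)\<close> and \<open>\<gamma>(Y, Y)\<close>, by \<open>\<gamma>(F - DY v, W)\<close> with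
  \<open>F - DY v\<close> horizontal, and by \<open>\<gamma>(v, [W, Y])\<close>.

  For \<open>W = X\<^sub>c\<close> all these terms except the last are the same for \<open>\<gamma>\<close> and for \<open>g\<close>, and for \<open>g\<close> the expression
  vanishes by the nonholonomic equations. What remains is \<open>\<gamma>(v, [X\<^sub>c, Y]) - g(v, [X\<^sub>c, Y])\<close>,
  that is \<open>v\<^sup>a B\<^sup>k\<^sub>c\<^sub>a (\<mu>\<^sub>k - G\<^sub>b\<^sub>k v\<^sup>b)\<close>, which is zero by hypothesis. For \<open>W = (E\<^sub>i)\<^sub>Q\<close> the bracket \<open>[W, Y]\<close> and
  the derivative of \<open>G\<^sub>a\<^sub>b\<close> along \<open>W\<close> vanish by \<open>G\<close>-invariance, and what remains is \<open>\<Gamma>(\<mu>\<^sub>i) = 0\<close>.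

  The rest of the work is to justify these computations in charts: that the \<open>X\<^sub>a\<close> and \<open>(E\<^sub>i)\<^sub>Q\<close> span
  (lemma \<open>coframe_inj\<close>), that \<open>[(E\<^sub>i)\<^sub>Q, X\<^sub>a] = 0\<close>
  (lemma \<open>equivariant_field_commutes\<close>), and that derivatives of functions defined only on the
  constraint submanifold can be computed in the parametrisation of that submanifold by base
  point and velocities \<open>v\<^sup>a\<close> (lemma \<open>deriv_on_constraint\<close>).\<close>

section \<open>Smooth functions on open sets\<close>

lemma dderiv_eq: "(f has_derivative f') (at x) \<Longrightarrow> dderiv f x v = f' v"
  by (metis frechet_derivative_at)

lemma dderiv_cong:
  assumes "open S" "x \<in> S" "f differentiable at x" "\<And>y. y \<in> S \<Longrightarrow> f y = g y"
  shows "dderiv f x v = dderiv g x v"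
  by (metis assms frechet_derivative_transform_within_open)

lemma has_derivative_dderiv: "f differentiable at x \<Longrightarrow> (f has_derivative dderiv f x) (at x)"
  by (simp add: frechet_derivative_works)

lemma dderiv_linear: "f differentiable at x \<Longrightarrow> linear (dderiv f x)"
  using has_derivative_dderiv has_derivative_linear by blast

lemma differentiable_cong_open:
  assumes "open S" "x \<in> S" "f differentiable at x" "\<And>y. y \<in> S \<Longrightarrow> f y = g y"
  shows "g differentiable at x"
  using assms has_derivative_transform_within_open unfolding differentiable_def by blast

text \<open>Openness of the set is essential: it makes the derivatives of the two functions agree as well.\<close>
lemma Ck_on_cong:
  assumes "open S" "Ck_on k f S" "\<And>x. x \<in> S \<Longrightarrow> f x = g x"
  shows "Ck_on k g S"
  using assms(2,3)
proof (induction k arbitrary: f g)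
  case 0
  then show ?case by (simp cong: continuous_on_cong)
next
  case (Suc k)
  have d: "f differentiable (at x)" if "x \<in> S" for x using Suc.prems that by simp
  have "g differentiable (at x)" if "x \<in> S" for x
    using differentiable_cong_open[OF assms(1) that d[OF that]] Suc.prems by blast
  moreover have "Ck_on k (\<lambda>x. dderiv g x v) S" for v
  proof (rule Suc.IH)
    show "Ck_on k (\<lambda>x. dderiv f x v) S" using Suc.prems by simp
    show "dderiv f x v = dderiv g x v" if "x \<in> S" for x
      using dderiv_cong[OF assms(1) that d[OF that]] Suc.prems by blast
  qed
  ultimately show ?case by simp
qed

text \<open>The definition of \<open>C\<^sup>k\<^sup>+\<^sup>1\<close> speaks of the derivatives only; that it implies \<open>C\<^sup>k\<close> is what lets the
  product rule and the rule for reciprocals go through by induction on \<open>k\<close>.\<close>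
lemma Ck_on_SucD: "Ck_on (Suc k) f S \<Longrightarrow> Ck_on k f S"
proof (induction k arbitrary: f)
  case 0
  then show ?case
    by (auto intro!: continuous_at_imp_continuous_on differentiable_imp_continuous_within)
next
  case (Suc k)
  then have "\<forall>v. Ck_on (Suc k) (\<lambda>x. dderiv f x v) S" "\<forall>x\<in>S. f differentiable at x"
    using Ck_on.simps(2) by blast+
  then show ?case using Suc.IH by simp
qed

lemma Ck_on_const: "Ck_on k (\<lambda>_. c) S"
  by (induction k arbitrary: c) auto

lemma Ck_on_bounded_linear:
  assumes S: "open S" and L: "bounded_linear L"
  shows "Ck_on k f S \<Longrightarrow> Ck_on k (\<lambda>x. L (f x)) S"
proof (induction k arbitrary: f)
  case 0
  then show ?case using bounded_linear.continuous_on[OF L] by auto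
next
  case (Suc k)
  have hd: "((\<lambda>x. L (f x)) has_derivative (\<lambda>v. L (dderiv f x v))) (at x)" if "x \<in> S" for x
    using bounded_linear.has_derivative[OF L has_derivative_dderiv] Suc.prems that by auto
  have "Ck_on k (\<lambda>x. dderiv (\<lambda>x. L (f x)) x v) S" for v
    by (rule Ck_on_cong[OF S Suc.IH[of "\<lambda>x. dderiv f x v"]])
      (use Suc.prems dderiv_eq[OF hd] in auto)
  then show ?case using hd by (auto simp: differentiable_def)
qed

lemma Ck_on_add:
  assumes S: "open S"
  shows "Ck_on k f S \<Longrightarrow> Ck_on k g S \<Longrightarrow> Ck_on k (\<lambda>x. f x + g x) S"
proof (induction k arbitrary: f g)
  case 0
  then show ?case by (auto intro: continuous_intros)
next
  case (Suc k)
  have hd: "((\<lambda>x. f x + g x) has_derivative (\<lambda>v. dderiv f x v + dderiv g x v)) (at x)"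
    if "x \<in> S" for x
    using Suc.prems that by (auto intro!: has_derivative_add has_derivative_dderiv)
  have "Ck_on k (\<lambda>x. dderiv (\<lambda>x. f x + g x) x v) S" for v
    by (rule Ck_on_cong[OF S Suc.IH[of "\<lambda>x. dderiv f x v" "\<lambda>x. dderiv g x v"]])
      (use Suc.prems dderiv_eq[OF hd] in auto)
  then show ?case using hd by (auto simp: differentiable_def)
qed

lemma Ck_on_bilinear:
  assumes S: "open S" and P: "bounded_bilinear P"
  shows "Ck_on k f S \<Longrightarrow> Ck_on k g S \<Longrightarrow> Ck_on k (\<lambda>x. P (f x) (g x)) S"
proof (induction k arbitrary: f g)
  case 0
  then show ?case using bounded_bilinear.continuous_on[OF P] by auto
next
  case (Suc k)
  have fg: "Ck_on k f S" "Ck_on k g S" using Suc.prems Ck_on_SucD by blast+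
  have hd: "((\<lambda>x. P (f x) (g x)) has_derivative (\<lambda>v. P (f x) (dderiv g x v) + P (dderiv f x v) (g x))) (at x)"
    if "x \<in> S" for x
    using Suc.prems that by (intro bounded_bilinear.FDERIV[OF P] has_derivative_dderiv) auto
  have "Ck_on k (\<lambda>x. dderiv (\<lambda>x. P (f x) (g x)) x v) S" for v
    by (rule Ck_on_cong[OF S Ck_on_add[OF S Suc.IH[of f "\<lambda>x. dderiv g x v"] 
          Suc.IH[of "\<lambda>x. dderiv f x v" g]]])
      (use Suc.prems dderiv_eq[OF hd] fg in auto)
  then show ?case using hd by (auto simp: differentiable_def)
qed

text \<open>The derivative of \<open>1/f\<close> is a product of \<open>1/f\<close>, \<open>f'\<close> and \<open>1/f\<close>, so regularity is gained one order at
  a time from the product rule.\<close>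
lemma Ck_on_inverse:
  fixes f :: "'a::real_normed_vector \<Rightarrow> real"
  assumes S: "open S" and nz: "\<And>x. x \<in> S \<Longrightarrow> f x \<noteq> 0"
  shows "Ck_on k f S \<Longrightarrow> Ck_on k (\<lambda>x. inverse (f x)) S"
proof (induction k)
  case 0
  then show ?case using nz by (auto intro!: continuous_intros)
next
  case (Suc k)
  have hd: "((\<lambda>x. inverse (f x)) has_derivative (\<lambda>v. - (inverse (f x) * dderiv f x v * inverse (f x)))) (at x)"
    if "x \<in> S" for x
    using Suc.prems that nz by (intro Deriv.has_derivative_inverse has_derivative_dderiv) auto
  have I: "Ck_on k (\<lambda>x. inverse (f x)) S" using Suc.IH Ck_on_SucD[OF Suc.prems] by simp
  note M = Ck_on_bilinear[OF S bounded_bilinear_mult]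
  have "Ck_on k (\<lambda>x. dderiv (\<lambda>x. inverse (f x)) x v) S" for v
    by (rule Ck_on_cong[OF S Ck_on_bounded_linear[OF S bounded_linear_minus[OF bounded_linear_ident] M[OF M[OF I, of "\<lambda>x. dderiv f x v"] I]]])
      (use Suc.prems dderiv_eq[OF hd] in auto)
  then show ?case using hd by (auto simp: differentiable_def)
qed

text \<open>Affine maps are the only inner functions needed: they cover slices of a product and
  projections, and their derivative is constant, so the chain rule does not leave the class.\<close>
lemma Ck_on_compose_affine:
  assumes T: "open T" and L: "bounded_linear L" and sub: "\<And>x. x \<in> T \<Longrightarrow> a + L x \<in> S"
  shows "Ck_on k f S \<Longrightarrow> Ck_on k (\<lambda>x. f (a + L x)) T"
proof (induction k arbitrary: f)
  case 0
  then have "continuous_on S f" by simp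
  moreover have "continuous_on T (\<lambda>x. a + L x)"
    by (intro continuous_intros bounded_linear.continuous_on[OF L])
  ultimately show ?case
    using continuous_on_compose2[of S f T "\<lambda>x. a + L x"] sub by auto
next
  case (Suc k)
  have hd: "((\<lambda>x. f (a + L x)) has_derivative (\<lambda>v. dderiv f (a + L x) (L v))) (at x)" if "x \<in> T" for x
  proof -
    have "((\<lambda>x. a + L x) has_derivative L) (at x)"
      using has_derivative_add[OF has_derivative_const bounded_linear.has_derivative[OF L has_derivative_ident]]
      by simp
    moreover have "(f has_derivative dderiv f (a + L x)) (at (a + L x))"
      using Suc.prems sub[OF that] by (auto intro: has_derivative_dderiv)
    ultimately show ?thesis using has_derivative_compose by blast
  qed
  have "Ck_on k (\<lambda>x. dderiv (\<lambda>x. f (a + L x)) x v) T" for v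
    by (rule Ck_on_cong[OF T Suc.IH[of "\<lambda>x. dderiv f x (L v)"]])
      (use Suc.prems dderiv_eq[OF hd] in auto)
  then show ?case using hd by (auto simp: differentiable_def)
qed

lemma smooth_on_cong:
  "open S \<Longrightarrow> smooth_on S f \<Longrightarrow> (\<And>x. x \<in> S \<Longrightarrow> f x = g x) \<Longrightarrow> smooth_on S g"
  unfolding smooth_on_def using Ck_on_cong by blast

lemma smooth_on_const: "smooth_on S (\<lambda>_. c)"
  unfolding smooth_on_def using Ck_on_const by blast

lemma smooth_on_add: "open S \<Longrightarrow> smooth_on S f \<Longrightarrow> smooth_on S g \<Longrightarrow> smooth_on S (\<lambda>x. f x + g x)"
  unfolding smooth_on_def using Ck_on_add by blast

lemma smooth_on_bounded_linear:
  "open S \<Longrightarrow> bounded_linear L \<Longrightarrow> smooth_on S f \<Longrightarrow> smooth_on S (\<lambda>x. L (f x))"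
  unfolding smooth_on_def using Ck_on_bounded_linear by blast

lemma smooth_on_linear:
  fixes L :: "'b::euclidean_space \<Rightarrow> 'c::real_normed_vector"
  shows "open S \<Longrightarrow> linear L \<Longrightarrow> smooth_on S f \<Longrightarrow> smooth_on S (\<lambda>x. L (f x))"
  using smooth_on_bounded_linear linear_conv_bounded_linear by blast

lemma smooth_on_mult:
  fixes f g :: "'a::real_normed_vector \<Rightarrow> real"
  shows "open S \<Longrightarrow> smooth_on S f \<Longrightarrow> smooth_on S g \<Longrightarrow> smooth_on S (\<lambda>x. f x * g x)"
  unfolding smooth_on_def using Ck_on_bilinear[OF _ bounded_bilinear_mult] by blast

lemma smooth_on_scaleR:
  fixes f :: "'a::real_normed_vector \<Rightarrow> real"
  shows "open S \<Longrightarrow> smooth_on S f \<Longrightarrow> smooth_on S g \<Longrightarrow> smooth_on S (\<lambda>x. f x *\<^sub>R g x)"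
  unfolding smooth_on_def using Ck_on_bilinear[OF _ bounded_bilinear_scaleR] by blast

lemma smooth_on_divide:
  fixes f g :: "'a::real_normed_vector \<Rightarrow> real"
  assumes "open S" "smooth_on S f" "smooth_on S g" "\<And>x. x \<in> S \<Longrightarrow> g x \<noteq> 0"
  shows "smooth_on S (\<lambda>x. f x / g x)"
proof -
  have "smooth_on S (\<lambda>x. inverse (g x))"
    using assms Ck_on_inverse unfolding smooth_on_def by blast
  then show ?thesis
    using smooth_on_mult[OF assms(1,2)] by (simp add: divide_inverse)
qed

lemma smooth_on_compose_affine:
  assumes "open T" "bounded_linear L" "\<And>x. x \<in> T \<Longrightarrow> a + L x \<in> S" "smooth_on S f"
  shows "smooth_on T (\<lambda>x. f (a + L x))"
  using assms Ck_on_compose_affine unfolding smooth_on_def by blast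

lemma smooth_on_compose_fst:
  assumes "open T" "\<And>z. z \<in> T \<Longrightarrow> fst z \<in> S" "smooth_on S f"
  shows "smooth_on T (\<lambda>z. f (fst z))"
  using smooth_on_compose_affine[OF assms(1) bounded_linear_fst, of 0 S f] assms by simp

lemma smooth_on_sum:
  assumes "open S" "\<And>i. i \<in> I \<Longrightarrow> smooth_on S (f i)"
  shows "smooth_on S (\<lambda>x. \<Sum>i\<in>I. f i x)"
proof (cases "finite I")
  case True
  then show ?thesis using assms(2)
    by (induction I) (auto intro: smooth_on_const smooth_on_add[OF assms(1)])
qed (simp add: smooth_on_const)

lemma smooth_on_prod:
  fixes f :: "'i \<Rightarrow> 'a::real_normed_vector \<Rightarrow> real"
  assumes "open S" "\<And>i. i \<in> I \<Longrightarrow> smooth_on S (f i)"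
  shows "smooth_on S (\<lambda>x. \<Prod>i\<in>I. f i x)"
proof (cases "finite I")
  case True
  then show ?thesis using assms(2)
    by (induction I) (auto intro: smooth_on_const smooth_on_mult[OF assms(1)])
qed (simp add: smooth_on_const)

lemma smooth_on_dderiv: "smooth_on S f \<Longrightarrow> smooth_on S (\<lambda>x. dderiv f x v)"
  unfolding smooth_on_def by (metis Ck_on.simps(2))

lemma smooth_on_differentiable: "smooth_on S f \<Longrightarrow> x \<in> S \<Longrightarrow> f differentiable at x"
  unfolding smooth_on_def by (metis Ck_on.simps(2))

lemma smooth_on_ident: "smooth_on S (\<lambda>x. x)"
  unfolding smooth_on_def
proof
  fix k show "Ck_on k (\<lambda>x. x) S"
    by (cases k) (auto simp: Ck_on_const)
qed

lemma smooth_on_nth: "open S \<Longrightarrow> smooth_on S f \<Longrightarrow> smooth_on S (\<lambda>x. f x $ i)"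
  by (rule smooth_on_bounded_linear[OF _ bounded_linear_vec_nth])

lemma smooth_on_vec_lambda:
  fixes f :: "'i::finite \<Rightarrow> 'a::real_normed_vector \<Rightarrow> 'b::euclidean_space"
  assumes "open S" "\<And>i. smooth_on S (f i)"
  shows "smooth_on S (\<lambda>x. \<chi> i. f i x)"
proof -
  have "linear (axis i :: 'b \<Rightarrow> 'b^'i)" for i
    by (rule linearI) (auto simp: axis_def vec_eq_iff)
  then have "smooth_on S (\<lambda>x. axis i (f i x))" for i
    using smooth_on_linear[OF assms(1)] assms(2) by blast
  then have "smooth_on S (\<lambda>x. \<Sum>i\<in>UNIV. axis i (f i x))"
    by (intro smooth_on_sum assms)
  moreover have "(\<Sum>i\<in>UNIV. axis i (f i x)) = (\<chi> i. f i x)" for x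
    by (simp add: vec_eq_iff axis_def if_distrib sum.delta cong: if_cong)
  ultimately show ?thesis by simp
qed

lemma smooth_on_inner:
  fixes f :: "'a::real_normed_vector \<Rightarrow> 'b::euclidean_space"
  shows "open S \<Longrightarrow> smooth_on S f \<Longrightarrow> smooth_on S g \<Longrightarrow> smooth_on S (\<lambda>x. f x \<bullet> g x)"
  unfolding smooth_on_def using Ck_on_bilinear[OF _ bounded_bilinear_inner] by blast

lemma smooth_on_matrix_vector_mult:
  fixes A :: "'a::real_normed_vector \<Rightarrow> real^'n^'m" 
  assumes "open S" "smooth_on S A" "smooth_on S f"
  shows "smooth_on S (\<lambda>x. A x *v f x)"
  unfolding matrix_vector_mult_def
  by (intro smooth_on_vec_lambda smooth_on_sum smooth_on_mult smooth_on_nth assms)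

lemma smooth_on_det:
  fixes A :: "'a::real_normed_vector \<Rightarrow> real^'n^'n" 
  assumes "open S" "smooth_on S A"
  shows "smooth_on S (\<lambda>x. det (A x))"
  unfolding det_def
  by (intro smooth_on_sum smooth_on_mult smooth_on_prod smooth_on_nth smooth_on_const assms)

lemma matrix_inv_mult_vector:
  fixes A :: "real^'n^'n"
  assumes "invertible A"
  shows "A *v (matrix_inv A *v b) = b"
proof -
  have "A ** matrix_inv A = mat 1"
    using assms unfolding matrix_inv_def invertible_def by (rule someI2_ex) simp
  then show ?thesis by (simp add: matrix_vector_mul_assoc)
qed

text \<open>Cramer's rule expresses the solution of a linear system by quotients of determinants, which are
  polynomials in the entries.\<close>
lemma smooth_on_matrix_inv_mult:
  fixes A :: "'a::real_normed_vector \<Rightarrow> real^'n^'n" 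
  assumes S: "open S" and A: "smooth_on S A" and b: "smooth_on S b"
    and inv: "\<And>x. x \<in> S \<Longrightarrow> invertible (A x)"
  shows "smooth_on S (\<lambda>x. matrix_inv (A x) *v b x)"
proof -
  have nz: "det (A x) \<noteq> 0" if "x \<in> S" for x
    using inv[OF that] by (simp add: invertible_det_nz)
  define C where "C k x = (\<chi> i j. if j = k then b x $ i else A x $ i $ j)" for k x
  have C: "smooth_on S (C k)" for k
  proof -
    have "smooth_on S (\<lambda>x. if j = k then b x $ i else A x $ i $ j)" for i j
      by (cases "j = k") (simp_all add: smooth_on_nth S A b)
    then show ?thesis
      unfolding C_def by (intro smooth_on_vec_lambda S)
  qed
  have "smooth_on S (\<lambda>x. \<chi> k. det (C k x) / det (A x))"
    by (intro smooth_on_vec_lambda smooth_on_divide smooth_on_det S A C nz)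
  then show ?thesis
  proof (rule smooth_on_cong[OF S])
    fix x assume "x \<in> S"
    then show "(\<chi> k. det (C k x) / det (A x)) = matrix_inv (A x) *v b x"
      unfolding C_def
      using cramer[OF nz[OF \<open>x \<in> S\<close>], of "matrix_inv (A x) *v b x" "b x"] 
        matrix_inv_mult_vector[OF inv] by metis
  qed
qed



lemma has_derivative_compose_fst:
  assumes "f differentiable at y"
  shows "((\<lambda>r. f (fst r)) has_derivative (\<lambda>d. dderiv f y (fst d))) (at (y, z))"
proof (rule has_derivative_compose[of fst fst])
  show "(fst has_derivative fst) (at (y, z))"
    by (rule bounded_linear_imp_has_derivative[OF bounded_linear_fst])
  show "(f has_derivative dderiv f y) (at (fst (y, z)))"
    using has_derivative_dderiv[OF assms] by simp
qed

text \<open>Functions on the constraint submanifold that are linear in the velocities have this form: \<open>y\<close> is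
  the base point and \<open>z\<close> the vector of velocity components.\<close>
lemma has_derivative_linear_combination:
  fixes z :: "'m::finite \<Rightarrow> real" and f :: "'m \<Rightarrow> 'a::real_normed_vector \<Rightarrow> real"
  assumes f: "\<And>a. f a differentiable at y" and N: "open N" "y \<in> N"
    and eq: "\<And>y' z'. y' \<in> N \<Longrightarrow> \<phi> (y', z') = (\<Sum>a\<in>UNIV. z' $ a * f a y')"
  shows "(\<phi> has_derivative (\<lambda>(dy, dz :: real^'m). \<Sum>a\<in>UNIV. z a * dderiv (f a) y dy + dz $ a * f a y)) (at (y, \<chi> a. z a))"
proof -
  have X': "((\<lambda>r. f a (fst r)) has_derivative (\<lambda>d. dderiv (f a) y (fst d))) (at (y, \<chi> a. z a))" for a
    by (rule has_derivative_compose_fst[OF f])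
  have Z': "((\<lambda>r. snd r $ a) has_derivative (\<lambda>d. snd d $ a)) (at (y, \<chi> a. z a))" for a
    by (rule bounded_linear_imp_has_derivative) (rule bounded_linear_compose[OF bounded_linear_vec_nth bounded_linear_snd])
  have "((\<lambda>r. \<Sum>a\<in>UNIV. snd r $ a * f a (fst r)) has_derivative
     (\<lambda>d. \<Sum>a\<in>UNIV. snd (y, \<chi> a. z a) $ a * dderiv (f a) y (fst d) + snd d $ a * f a (fst (y, \<chi> a. z a))))
     (at (y, \<chi> a. z a))"
    by (intro has_derivative_sum has_derivative_mult X' Z')
  then have "((\<lambda>r. \<Sum>a\<in>UNIV. snd r $ a * f a (fst r)) has_derivative
     (\<lambda>(dy, dz :: real^'m). \<Sum>a\<in>UNIV. z a * dderiv (f a) y dy + dz $ a * f a y)) (at (y, \<chi> a. z a))"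
    by (simp add: case_prod_beta')
  then show ?thesis
  proof (rule has_derivative_transform_within_open)
    show "open (N \<times> (UNIV :: (real^'m) set))" using N by (intro open_Times) auto
  qed (use N eq in auto)
qed

section \<open>Symmetry of second derivatives\<close>

text \<open>The mean value theorem, first in the direction \<open>u\<close> and then in the direction \<open>w\<close>, writes the second
  difference as one value of the mixed derivative.\<close>
lemma second_difference_mean_value:
  fixes f :: "'a::real_normed_vector \<Rightarrow> real"
  assumes h: "h > 0"
    and S: "\<And>s t. 0 \<le> s \<Longrightarrow> s \<le> h \<Longrightarrow> 0 \<le> t \<Longrightarrow> t \<le> h \<Longrightarrow> z + s *\<^sub>R u + t *\<^sub>R w \<in> S"
    and f: "Ck_on 2 f S"
  obtains s t where "0 < s" "s < h" "0 < t" "t < h"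
    "f (z + h *\<^sub>R u + h *\<^sub>R w) - f (z + h *\<^sub>R u) - f (z + h *\<^sub>R w) + f z
      = h\<^sup>2 * dderiv (\<lambda>x. dderiv f x u) (z + s *\<^sub>R u + t *\<^sub>R w) w"
proof -
  have d1: "(f has_derivative dderiv f x) (at x)" if "x \<in> S" for x
    using f that by (auto simp: numeral_2_eq_2 intro: has_derivative_dderiv)
  have d2: "((\<lambda>x. dderiv f x u) has_derivative dderiv (\<lambda>x. dderiv f x u) x) (at x)" if "x \<in> S" for x
    using f that by (auto simp: numeral_2_eq_2 intro: has_derivative_dderiv)
  have lin1: "dderiv f x (c *\<^sub>R y) = c * dderiv f x y" if "x \<in> S" for x c y
    using linear_cmul[OF has_derivative_linear[OF d1[OF that]]] by simp
  have lin2: "dderiv (\<lambda>x. dderiv f x u) x (c *\<^sub>R y) = c * dderiv (\<lambda>x. dderiv f x u) x y" if "x \<in> S" for x c y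
    using linear_cmul[OF has_derivative_linear[OF d2[OF that]]] by simp
  define G where "G s = f (z + s *\<^sub>R u + h *\<^sub>R w) - f (z + s *\<^sub>R u)" for s :: real
  define G' where "G' s = dderiv f (z + s *\<^sub>R u + h *\<^sub>R w) u - dderiv f (z + s *\<^sub>R u) u" for s :: real
  have G: "(G has_real_derivative G' s) (at s)" if "0 \<le> s" "s \<le> h" for s
  proof -
    have a: "z + s *\<^sub>R u + h *\<^sub>R w \<in> S" "z + s *\<^sub>R u \<in> S"
      using S[of s h] S[of s 0] that h by auto
    have "((\<lambda>s. f (z + s *\<^sub>R u + h *\<^sub>R w)) has_derivative (\<lambda>c. dderiv f (z + s *\<^sub>R u + h *\<^sub>R w) (c *\<^sub>R u))) (at s)"
      by (rule has_derivative_compose[of "\<lambda>s. z + s *\<^sub>R u + h *\<^sub>R w" _ _ _ f, OF _ d1[OF a(1)]])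
        (auto intro!: derivative_eq_intros)
    moreover have "((\<lambda>s. f (z + s *\<^sub>R u)) has_derivative (\<lambda>c. dderiv f (z + s *\<^sub>R u) (c *\<^sub>R u))) (at s)"
      by (rule has_derivative_compose[of "\<lambda>s. z + s *\<^sub>R u" _ _ _ f, OF _ d1[OF a(2)]])
        (auto intro!: derivative_eq_intros)
    ultimately have "(G has_derivative (\<lambda>c. c * G' s)) (at s)"
      unfolding G_def G'_def using lin1 a has_derivative_diff by (fastforce simp: right_diff_distrib)
    then show ?thesis unfolding has_field_derivative_def
      by (rule has_derivative_eq_rhs) (simp add: fun_eq_iff mult.commute)
  qed
  obtain s where s: "0 < s" "s < h" "G h - G 0 = h * G' s"
    using MVT2[of 0 h G G'] h G by auto
  define H where "H t = dderiv f (z + s *\<^sub>R u + t *\<^sub>R w) u" for t :: real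
  define H' where "H' t = dderiv (\<lambda>x. dderiv f x u) (z + s *\<^sub>R u + t *\<^sub>R w) w" for t :: real
  have H: "(H has_real_derivative H' t) (at t)" if "0 \<le> t" "t \<le> h" for t
  proof -
    have a: "z + s *\<^sub>R u + t *\<^sub>R w \<in> S"
      using S[of s t] that s by auto
    have "(H has_derivative (\<lambda>c. dderiv (\<lambda>x. dderiv f x u) (z + s *\<^sub>R u + t *\<^sub>R w) (c *\<^sub>R w))) (at t)"
      unfolding H_def
      by (rule has_derivative_compose[of "\<lambda>t. z + s *\<^sub>R u + t *\<^sub>R w" _ _ _ "\<lambda>x. dderiv f x u", OF _ d2[OF a]])
        (auto intro!: derivative_eq_intros)
    then show ?thesis
      unfolding has_field_derivative_def H'_def lin2[OF a] real_scaleR_def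
      by (rule has_derivative_eq_rhs) (simp add: fun_eq_iff mult.commute)
  qed
  obtain t where t: "0 < t" "t < h" "H h - H 0 = h * H' t"
    using MVT2[of 0 h H H'] h H by auto
  have "G' s = H h - H 0" by (simp add: G'_def H_def)
  then have "f (z + h *\<^sub>R u + h *\<^sub>R w) - f (z + h *\<^sub>R u) - f (z + h *\<^sub>R w) + f z = h\<^sup>2 * H' t"
    using s t by (simp add: G_def power2_eq_square)
  then show ?thesis using that s t by (auto simp: H'_def)
qed

text \<open>The second difference is symmetric in the two directions, so by the mean value form
  both mixed derivatives take a common value at two points arbitrarily close to \<open>z\<close>; continuity
  does the rest.\<close>
lemma symmetric_second_dderiv_real:
  fixes f :: "'a::real_normed_vector \<Rightarrow> real"
  assumes S: "open S" "z \<in> S" and f: "Ck_on 2 f S"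
  shows "dderiv (\<lambda>x. dderiv f x u) z w = dderiv (\<lambda>x. dderiv f x w) z u"
proof -
  let ?A = "\<lambda>x. dderiv (\<lambda>x. dderiv f x u) x w" and ?B = "\<lambda>x. dderiv (\<lambda>x. dderiv f x w) x u"
  have c: "isCont ?A z" "isCont ?B z"
    using f S by (auto simp: numeral_2_eq_2 continuous_on_eq_continuous_at)
  have "\<bar>?A z - ?B z\<bar> \<le> 2 * e" if e: "e > 0" for e
  proof -
    obtain d1 where d1: "d1 > 0" "\<And>x. dist x z < d1 \<Longrightarrow> dist (?A x) (?A z) < e"
      using c(1) e unfolding continuous_at_eps_delta by blast
    obtain d2 where d2: "d2 > 0" "\<And>x. dist x z < d2 \<Longrightarrow> dist (?B x) (?B z) < e"
      using c(2) e unfolding continuous_at_eps_delta by blast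
    obtain d3 where d3: "d3 > 0" "ball z d3 \<subseteq> S" using S openE by blast
    define d where "d = min d1 (min d2 d3)"
    have d: "d > 0" using d1 d2 d3 by (simp add: d_def)
    define N where "N = norm u + norm w + 1"
    have pos: "N > 0" by (simp add: N_def add_nonneg_pos)
    \<comment> \<open>small enough for the whole parallelogram with sides \<open>h u\<close> and \<open>h w\<close> to lie within \<open>d\<close> of \<open>z\<close>\<close>
    define h where "h = d / (2 * N)"
    have h: "h > 0" using d pos by (simp add: h_def)
    have near: "dist (z + s *\<^sub>R u + t *\<^sub>R w) z < d" if "0 \<le> s" "s \<le> h" "0 \<le> t" "t \<le> h" for s t
    proof -
      have "dist (z + s *\<^sub>R u + t *\<^sub>R w) z \<le> s * norm u + t * norm w"
        using norm_triangle_ineq[of "s *\<^sub>R u" "t *\<^sub>R w"] that by (simp add: dist_norm)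
      also have "\<dots> \<le> h * norm u + h * norm w"
        using that by (intro add_mono mult_right_mono) auto
      also have "\<dots> \<le> h * N" using h by (simp add: N_def algebra_simps)
      also have "\<dots> = d / 2" using pos by (simp add: h_def N_def[symmetric] del: distrib_left_numeral)
      finally show ?thesis using d by simp
    qed
    have inS: "z + s *\<^sub>R u + t *\<^sub>R w \<in> S" if "0 \<le> s" "s \<le> h" "0 \<le> t" "t \<le> h" for s t
      using near[OF that] d3 by (auto simp: d_def dist_commute subset_iff)
    obtain s t where st: "0 < s" "s < h" "0 < t" "t < h"
      "f (z + h *\<^sub>R u + h *\<^sub>R w) - f (z + h *\<^sub>R u) - f (z + h *\<^sub>R w) + f z
        = h\<^sup>2 * ?A (z + s *\<^sub>R u + t *\<^sub>R w)"
      using second_difference_mean_value[OF h inS f] by blast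
    have inS': "z + s *\<^sub>R w + t *\<^sub>R u \<in> S" if "0 \<le> s" "s \<le> h" "0 \<le> t" "t \<le> h" for s t
      using inS[of t s] that by (simp add: algebra_simps)
    obtain s' t' where st': "0 < s'" "s' < h" "0 < t'" "t' < h"
      "f (z + h *\<^sub>R w + h *\<^sub>R u) - f (z + h *\<^sub>R w) - f (z + h *\<^sub>R u) + f z
        = h\<^sup>2 * ?B (z + s' *\<^sub>R w + t' *\<^sub>R u)"
      using second_difference_mean_value[OF h inS' f] by blast
    have "h\<^sup>2 * ?A (z + s *\<^sub>R u + t *\<^sub>R w) = h\<^sup>2 * ?B (z + s' *\<^sub>R w + t' *\<^sub>R u)"
      using st(5) st'(5) by (simp add: algebra_simps)
    then have "?A (z + s *\<^sub>R u + t *\<^sub>R w) = ?B (z + t' *\<^sub>R u + s' *\<^sub>R w)"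
      using h by (simp add: algebra_simps)
    moreover have "dist (?A (z + s *\<^sub>R u + t *\<^sub>R w)) (?A z) < e"
      using near[of s t] st by (intro d1) (auto simp: d_def)
    moreover have "dist (?B (z + t' *\<^sub>R u + s' *\<^sub>R w)) (?B z) < e"
      using near[of t' s'] st' by (intro d2) (auto simp: d_def)
    ultimately show ?thesis by (simp add: dist_real_def)
  qed
  then have "\<bar>?A z - ?B z\<bar> \<le> 0"
    by (metis dense_ge field_sum_of_halves half_gt_zero mult_2)
  then show ?thesis by simp
qed

lemma symmetric_second_dderiv:
  fixes f :: "'a::real_normed_vector \<Rightarrow> 'b::euclidean_space"
  assumes S: "open S" "z \<in> S" and f: "Ck_on 2 f S"
  shows "dderiv (\<lambda>x. dderiv f x u) z w = dderiv (\<lambda>x. dderiv f x w) z u"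
proof (rule euclidean_eqI)
  fix b :: 'b
  assume "b \<in> Basis"
  have b: "bounded_linear (\<lambda>y. y \<bullet> b)" by (rule bounded_linear_inner_left)
  have d1: "f differentiable at x" "(\<lambda>x. dderiv f x v) differentiable at x" if "x \<in> S" for x v
    using f that by (auto simp: numeral_2_eq_2)
  have unit_chart: "dderiv (\<lambda>x. f x \<bullet> b) x v = dderiv f x v \<bullet> b" if "x \<in> S" for x v
    by (intro dderiv_eq bounded_linear.has_derivative[OF b] has_derivative_dderiv d1 that)
  have e2: "dderiv (\<lambda>x. dderiv (\<lambda>x. f x \<bullet> b) x v) z y = dderiv (\<lambda>x. dderiv f x v) z y \<bullet> b" for v y
  proof -
    have "((\<lambda>x. dderiv f x v \<bullet> b) has_derivative (\<lambda>y. dderiv (\<lambda>x. dderiv f x v) z y \<bullet> b)) (at z)"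
      by (intro bounded_linear.has_derivative[OF b] has_derivative_dderiv d1 S)
    then have "((\<lambda>x. dderiv (\<lambda>x. f x \<bullet> b) x v) has_derivative (\<lambda>y. dderiv (\<lambda>x. dderiv f x v) z y \<bullet> b)) (at z)"
      by (rule has_derivative_transform_within_open[OF _ S]) (simp add: unit_chart)
    then show ?thesis by (rule dderiv_eq)
  qed
  have "Ck_on 2 (\<lambda>x. f x \<bullet> b) S" using Ck_on_bounded_linear[OF S(1) b f] .
  then have "dderiv (\<lambda>x. dderiv (\<lambda>x. f x \<bullet> b) x u) z w = dderiv (\<lambda>x. dderiv (\<lambda>x. f x \<bullet> b) x w) z u"
    using symmetric_second_dderiv_real S by blast
  then show "dderiv (\<lambda>x. dderiv f x u) z w \<bullet> b = dderiv (\<lambda>x. dderiv f x w) z u \<bullet> b"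
    by (simp add: e2)
qed

section \<open>Charts, tangent vectors and differentials\<close>

lemma chart_img_cases:
  assumes "y \<in> chart_img c"
  obtains q where "q \<in> fst c" "y = snd c q"
  using assms by (auto simp: chart_img_def)

text \<open>Everything below about tangent vectors only uses the chain rule for coordinate changes, so
  differentiable transitions suffice. This weaker notion is the one to be verified for the tangent
  bundle.\<close>
definition diff_atlas :: "('a, 'e::euclidean_space) atlas \<Rightarrow> bool"
  where "diff_atlas A \<longleftrightarrow>
    (\<forall>c\<in>A. inj_on (snd c) (fst c)) \<and>
    (\<forall>c\<in>A. \<forall>d\<in>A. open (snd c ` (fst c \<inter> fst d)) \<and>
        (\<forall>x\<in>snd c ` (fst c \<inter> fst d). (snd d \<circ> chart_inv c) differentiable at x))"

lemma smooth_manifold_imp_diff_atlas: "smooth_manifold A \<Longrightarrow> diff_atlas A"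
  unfolding smooth_manifold_def diff_atlas_def using smooth_on_differentiable by blast

lemma diff_atlas_inj: "diff_atlas A \<Longrightarrow> c \<in> A \<Longrightarrow> inj_on (snd c) (fst c)"
  by (simp add: diff_atlas_def)

lemma chart_inv_left: "inj_on (snd c) (fst c) \<Longrightarrow> p \<in> fst c \<Longrightarrow> chart_inv c (snd c p) = p"
  by (simp add: chart_inv_def)

lemma chart_inv_in: "y \<in> snd c ` U \<Longrightarrow> U \<subseteq> fst c \<Longrightarrow> chart_inv c y \<in> fst c"
  unfolding chart_inv_def by (rule inv_into_into) auto

lemma chart_inv_right: "y \<in> snd c ` U \<Longrightarrow> U \<subseteq> fst c \<Longrightarrow> snd c (chart_inv c y) = y"
  unfolding chart_inv_def by (rule f_inv_into_f) auto

lemma chart_inv_mem_iff: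
  "inj_on (snd c) (fst c) \<Longrightarrow> y \<in> snd c ` (fst c \<inter> U) \<Longrightarrow> chart_inv c y \<in> fst c \<inter> U"
  using chart_inv_left by fastforce

lemma open_chart_img: "diff_atlas A \<Longrightarrow> c \<in> A \<Longrightarrow> open (chart_img c)"
  unfolding diff_atlas_def chart_img_def by (metis Int_absorb)

lemma chart_at: "p \<in> points A \<Longrightarrow> chart_at A p \<in> A \<and> p \<in> fst (chart_at A p)"
  unfolding chart_at_def points_def by (rule someI_ex) auto

lemma in_points: "c \<in> A \<Longrightarrow> p \<in> fst c \<Longrightarrow> p \<in> points A"
  by (auto simp: points_def)

lemma transition_differentiable:
  assumes "diff_atlas A" "c \<in> A" "d \<in> A" "p \<in> fst c" "p \<in> fst d"
  shows "(snd d \<circ> chart_inv c) differentiable at (snd c p)"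
  using assms unfolding diff_atlas_def by blast

text \<open>The chain rule for coordinate changes. It is the reason why a coordinate vector in one chart
  determines a whole tangent vector, and why the space of tangent vectors at a point is isomorphic
  to the model space through any single chart.\<close>
lemma transition_cocycle:
  assumes A: "diff_atlas A" and c: "c \<in> A" "d \<in> A" "e \<in> A" and p: "p \<in> fst c" "p \<in> fst d" "p \<in> fst e"
  shows "dderiv (snd e \<circ> chart_inv d) (snd d p) (dderiv (snd d \<circ> chart_inv c) (snd c p) u)
    = dderiv (snd e \<circ> chart_inv c) (snd c p) u"
proof -
  have f: "((snd d \<circ> chart_inv c) has_derivative dderiv (snd d \<circ> chart_inv c) (snd c p)) (at (snd c p))"
    by (intro has_derivative_dderiv transition_differentiable[OF A c(1,2) p(1,2)])
  have val: "(snd d \<circ> chart_inv c) (snd c p) = snd d p"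
    using chart_inv_left[OF diff_atlas_inj[OF A c(1)] p(1)] by simp
  have g: "((snd e \<circ> chart_inv d) has_derivative dderiv (snd e \<circ> chart_inv d) (snd d p)) (at ((snd d \<circ> chart_inv c) (snd c p)))"
    unfolding val by (intro has_derivative_dderiv transition_differentiable[OF A c(2,3) p(2,3)])
  have "((\<lambda>x. (snd e \<circ> chart_inv d) ((snd d \<circ> chart_inv c) x)) has_derivative
     (\<lambda>u. dderiv (snd e \<circ> chart_inv d) (snd d p) (dderiv (snd d \<circ> chart_inv c) (snd c p) u))) (at (snd c p))"
    using has_derivative_compose[OF f g] .
  then have "((snd e \<circ> chart_inv c) has_derivative
     (\<lambda>u. dderiv (snd e \<circ> chart_inv d) (snd d p) (dderiv (snd d \<circ> chart_inv c) (snd c p) u))) (at (snd c p))"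
  proof (rule has_derivative_transform_within_open)
    show "open (snd c ` (fst c \<inter> fst d))" using A c unfolding diff_atlas_def by blast
    show "snd c p \<in> snd c ` (fst c \<inter> fst d)" using p by blast
    show "(snd e \<circ> chart_inv d) ((snd d \<circ> chart_inv c) y) = (snd e \<circ> chart_inv c) y"
      if "y \<in> snd c ` (fst c \<inter> fst d)" for y
      using chart_inv_left[OF diff_atlas_inj[OF A c(2)]]
        chart_inv_mem_iff[OF diff_atlas_inj[OF A c(1)] that] by simp
  qed
  from dderiv_eq[OF this] show ?thesis by simp
qed

lemma transition_self:
  assumes A: "diff_atlas A" and c: "c \<in> A" and p: "p \<in> fst c"
  shows "dderiv (snd c \<circ> chart_inv c) (snd c p) u = u"
proof -
  have "((\<lambda>x. x) has_derivative (\<lambda>x. x)) (at (snd c p))" by simp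
  then have "((snd c \<circ> chart_inv c) has_derivative (\<lambda>x. x)) (at (snd c p))"
  proof (rule has_derivative_transform_within_open)
    show "open (chart_img c)" by (rule open_chart_img[OF A c])
    show "snd c p \<in> chart_img c" using p by (simp add: chart_img_def)
    show "y = (snd c \<circ> chart_inv c) y" if "y \<in> chart_img c" for y
      using chart_inv_right[OF that[unfolded chart_img_def] order_refl] by simp
  qed
  then show ?thesis by (rule dderiv_eq)
qed

lemma coord_vec_chart:
  assumes "diff_atlas A" "c \<in> A" "p \<in> fst c"
  shows "coord_vec A c p u c = u"
  using assms transition_self by (simp add: coord_vec_def)

lemma coord_vec_in_tangent_space:
  assumes "diff_atlas A" "c \<in> A" "p \<in> fst c"
  shows "coord_vec A c p u \<in> tangent_space A p"
proof -
  have "coord_vec A c p u e = dderiv (snd e \<circ> chart_inv d) (snd d p) (coord_vec A c p u d)"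
    if "d \<in> A" "e \<in> A" "p \<in> fst d" "p \<in> fst e" for d e
    unfolding coord_vec_def
    using transition_cocycle[OF assms(1,2) that(1,2) assms(3) that(3,4)] that by simp
  moreover have "coord_vec A c p u d = 0" if "d \<notin> A \<or> p \<notin> fst d" for d
    using that by (auto simp: coord_vec_def)
  ultimately show ?thesis unfolding tangent_space_def by blast
qed

lemma coord_vec_of_tangent:
  assumes "v \<in> tangent_space A p" "c \<in> A" "p \<in> fst c"
  shows "coord_vec A c p (v c) = v"
proof
  fix d
  show "coord_vec A c p (v c) d = v d"
  proof (cases "d \<in> A \<and> p \<in> fst d")
    case True
    then have "v d = dderiv (snd d \<circ> chart_inv c) (snd c p) (v c)"
      using assms unfolding tangent_space_def by blast
    then show ?thesis using True by (simp add: coord_vec_def)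
  next
    case False
    then have "v d = 0" using assms(1) unfolding tangent_space_def by blast
    then show ?thesis using False by (auto simp: coord_vec_def)
  qed
qed

lemma tangent_space_eqI:
  assumes "v \<in> tangent_space A p" "w \<in> tangent_space A p" "c \<in> A" "p \<in> fst c" "v c = w c"
  shows "v = w"
  by (metis assms coord_vec_of_tangent)

lemma tangent_space_tlin:
  assumes A: "diff_atlas A" and v: "v \<in> tangent_space A p" and w: "w \<in> tangent_space A p"
  shows "tlin r v s w \<in> tangent_space A p"
proof -
  have "tlin r v s w d = dderiv (snd d \<circ> chart_inv c) (snd c p) (tlin r v s w c)"
    if c: "c \<in> A" "d \<in> A" "p \<in> fst c" "p \<in> fst d" for c d
  proof -
    have "linear (dderiv (snd d \<circ> chart_inv c) (snd c p))"
      by (rule dderiv_linear[OF transition_differentiable[OF A c]])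
    moreover have "v d = dderiv (snd d \<circ> chart_inv c) (snd c p) (v c)"
      "w d = dderiv (snd d \<circ> chart_inv c) (snd c p) (w c)"
      using v w c unfolding tangent_space_def by blast+
    ultimately show ?thesis by (simp add: tlin_def linear_add linear_cmul)
  qed
  moreover have "tlin r v s w c = 0" if "c \<notin> A \<or> p \<notin> fst c" for c
  proof -
    have "v c = 0" "w c = 0" using that v w unfolding tangent_space_def by blast+
    then show ?thesis by (simp add: tlin_def)
  qed
  ultimately show ?thesis unfolding tangent_space_def by blast
qed

lemma zero_in_tangent_space:
  assumes A: "diff_atlas A"
  shows "(\<lambda>_. 0) \<in> tangent_space A p"
  unfolding tangent_space_def
  using linear_0[OF dderiv_linear[OF transition_differentiable[OF A]]] by simp

lemma tangent_space_tcomb: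
  assumes A: "diff_atlas A" and V: "\<And>i. V i \<in> tangent_space A p"
  shows "tcomb y V \<in> tangent_space A p"
proof -
  have "(\<lambda>c. \<Sum>i\<in>I. y i *\<^sub>R V i c) \<in> tangent_space A p" if "finite I" for I
    using that
  proof (induction I)
    case empty show ?case using zero_in_tangent_space[OF A] by simp
  next
    case (insert i I)
    have "(\<lambda>c. \<Sum>i\<in>insert i I. y i *\<^sub>R V i c) = tlin (y i) (V i) 1 (\<lambda>c. \<Sum>i\<in>I. y i *\<^sub>R V i c)"
      using insert by (simp add: tlin_def)
    then show ?case using tangent_space_tlin[OF A V insert.IH] by simp
  qed
  then show ?thesis by (simp add: tcomb_def)
qed

text \<open>The definition of the derivative uses a chosen chart; the chain rule makes every other chart around
  the point equally good.\<close>
lemma deriv_at_chart: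
  assumes A: "diff_atlas A" and c: "c \<in> A" and p: "p \<in> fst c" and v: "v \<in> tangent_space A p"
    and f: "(f \<circ> chart_inv c) differentiable at (snd c p)"
  shows "deriv_at A f p v = dderiv (f \<circ> chart_inv c) (snd c p) (v c)"
proof -
  define d where "d = chart_at A p"
  have d: "d \<in> A" "p \<in> fst d"
    using chart_at[OF in_points[OF c p]] by (simp_all add: d_def)
  have t: "((snd c \<circ> chart_inv d) has_derivative dderiv (snd c \<circ> chart_inv d) (snd d p)) (at (snd d p))"
    by (intro has_derivative_dderiv transition_differentiable[OF A d(1) c d(2) p])
  have val: "(snd c \<circ> chart_inv d) (snd d p) = snd c p"
    using chart_inv_left[OF diff_atlas_inj[OF A d(1)] d(2)] by simp
  have g: "((f \<circ> chart_inv c) has_derivative dderiv (f \<circ> chart_inv c) (snd c p)) (at ((snd c \<circ> chart_inv d) (snd d p)))"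
    unfolding val by (intro has_derivative_dderiv f)
  have "((\<lambda>x. (f \<circ> chart_inv c) ((snd c \<circ> chart_inv d) x)) has_derivative
     (\<lambda>u. dderiv (f \<circ> chart_inv c) (snd c p) (dderiv (snd c \<circ> chart_inv d) (snd d p) u))) (at (snd d p))"
    using has_derivative_compose[OF t g] .
  then have "((f \<circ> chart_inv d) has_derivative
     (\<lambda>u. dderiv (f \<circ> chart_inv c) (snd c p) (dderiv (snd c \<circ> chart_inv d) (snd d p) u))) (at (snd d p))"
  proof (rule has_derivative_transform_within_open)
    show "open (snd d ` (fst d \<inter> fst c))" using A c d unfolding diff_atlas_def by blast
    show "snd d p \<in> snd d ` (fst d \<inter> fst c)" using p d by blast
    show "(f \<circ> chart_inv c) ((snd c \<circ> chart_inv d) y) = (f \<circ> chart_inv d) y"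
      if "y \<in> snd d ` (fst d \<inter> fst c)" for y
      using chart_inv_left[OF diff_atlas_inj[OF A c]]
        chart_inv_mem_iff[OF diff_atlas_inj[OF A d(1)] that] by simp
  qed
  from dderiv_eq[OF this]
  have "deriv_at A f p v = dderiv (f \<circ> chart_inv c) (snd c p) (dderiv (snd c \<circ> chart_inv d) (snd d p) (v d))"
    by (simp add: deriv_at_def d_def[symmetric])
  moreover have "v c = dderiv (snd c \<circ> chart_inv d) (snd d p) (v d)"
    using v c d p unfolding tangent_space_def by blast
  ultimately show ?thesis by simp
qed

lemma smooth_map_open: "smooth_map A B f \<Longrightarrow> c \<in> A \<Longrightarrow> d \<in> B \<Longrightarrow> open (snd c ` (fst c \<inter> f -` fst d))"
  by (simp add: smooth_map_def)

lemma smooth_map_smooth_on: "smooth_map A B f \<Longrightarrow> c \<in> A \<Longrightarrow> d \<in> B \<Longrightarrow>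
  smooth_on (snd c ` (fst c \<inter> f -` fst d)) (snd d \<circ> f \<circ> chart_inv c)"
  by (simp add: smooth_map_def)

lemma smooth_map_has_derivative:
  assumes "smooth_map A B f" "c \<in> A" "d \<in> B" "p \<in> fst c" "f p \<in> fst d"
  shows "((snd d \<circ> f \<circ> chart_inv c) has_derivative dderiv (snd d \<circ> f \<circ> chart_inv c) (snd c p)) (at (snd c p))"
  using assms by (intro has_derivative_dderiv smooth_on_differentiable[OF smooth_map_smooth_on[OF assms(1-3)]]) blast

lemma smooth_map_comp_has_derivative:
  assumes A: "diff_atlas A" and B: "diff_atlas B" and f: "smooth_map A B f" and g: "smooth_map B C g"
    and c: "c \<in> A" "d \<in> B" "e \<in> C" and p: "p \<in> fst c" "f p \<in> fst d" "g (f p) \<in> fst e"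
  shows "((snd e \<circ> (g \<circ> f) \<circ> chart_inv c) has_derivative
    (\<lambda>u. dderiv (snd e \<circ> g \<circ> chart_inv d) (snd d (f p)) (dderiv (snd d \<circ> f \<circ> chart_inv c) (snd c p) u)))
    (at (snd c p))"
proof -
  have val: "(snd d \<circ> f \<circ> chart_inv c) (snd c p) = snd d (f p)"
    using chart_inv_left[OF diff_atlas_inj[OF A c(1)] p(1)] by simp
  have gd: "((snd e \<circ> g \<circ> chart_inv d) has_derivative dderiv (snd e \<circ> g \<circ> chart_inv d) (snd d (f p))) (at ((snd d \<circ> f \<circ> chart_inv c) (snd c p)))"
    unfolding val by (intro smooth_map_has_derivative[OF g] c p)
  have "((\<lambda>x. (snd e \<circ> g \<circ> chart_inv d) ((snd d \<circ> f \<circ> chart_inv c) x)) has_derivative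
    (\<lambda>u. dderiv (snd e \<circ> g \<circ> chart_inv d) (snd d (f p)) (dderiv (snd d \<circ> f \<circ> chart_inv c) (snd c p) u)))
    (at (snd c p))"
    using has_derivative_compose[OF smooth_map_has_derivative[OF f c(1,2) p(1,2)] gd] .
  then show ?thesis
  proof (rule has_derivative_transform_within_open)
    show "open (snd c ` (fst c \<inter> f -` fst d))" by (rule smooth_map_open[OF f c(1,2)])
    show "snd c p \<in> snd c ` (fst c \<inter> f -` fst d)" using p by blast
    show "(snd e \<circ> g \<circ> chart_inv d) ((snd d \<circ> f \<circ> chart_inv c) y) = (snd e \<circ> (g \<circ> f) \<circ> chart_inv c) y"
      if "y \<in> snd c ` (fst c \<inter> f -` fst d)" for y
      using chart_inv_left[OF diff_atlas_inj[OF B c(2)]]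
        chart_inv_mem_iff[OF diff_atlas_inj[OF A c(1)] that] by simp
  qed
qed

text \<open>Both sides are the coordinates of the image of \<open>v\<close>, once computed through each of two charts of the
  source.\<close>
lemma smooth_map_change_chart:
  assumes A: "diff_atlas A" and f: "smooth_map A B f" 
    and c: "c \<in> A" "c' \<in> A" "d \<in> B" and p: "p \<in> fst c" "p \<in> fst c'" "f p \<in> fst d"
    and v: "v \<in> tangent_space A p"
  shows "dderiv (snd d \<circ> f \<circ> chart_inv c') (snd c' p) (v c') = dderiv (snd d \<circ> f \<circ> chart_inv c) (snd c p) (v c)"
proof -
  have val: "(snd c' \<circ> chart_inv c) (snd c p) = snd c' p"
    using chart_inv_left[OF diff_atlas_inj[OF A c(1)] p(1)] by simp
  have gd: "((snd d \<circ> f \<circ> chart_inv c') has_derivative dderiv (snd d \<circ> f \<circ> chart_inv c') (snd c' p)) (at ((snd c' \<circ> chart_inv c) (snd c p)))"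
    unfolding val by (intro smooth_map_has_derivative[OF f] c p)
  have "((\<lambda>x. (snd d \<circ> f \<circ> chart_inv c') ((snd c' \<circ> chart_inv c) x)) has_derivative
    (\<lambda>u. dderiv (snd d \<circ> f \<circ> chart_inv c') (snd c' p) (dderiv (snd c' \<circ> chart_inv c) (snd c p) u)))
    (at (snd c p))"
    by (rule has_derivative_compose[OF has_derivative_dderiv[OF transition_differentiable[OF A c(1,2) p(1,2)]] gd])
  then have "((snd d \<circ> f \<circ> chart_inv c) has_derivative
    (\<lambda>u. dderiv (snd d \<circ> f \<circ> chart_inv c') (snd c' p) (dderiv (snd c' \<circ> chart_inv c) (snd c p) u)))
    (at (snd c p))"
  proof (rule has_derivative_transform_within_open)
    show "open (snd c ` (fst c \<inter> fst c'))" using A c unfolding diff_atlas_def by blast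
    show "snd c p \<in> snd c ` (fst c \<inter> fst c')" using p by blast
    show "(snd d \<circ> f \<circ> chart_inv c') ((snd c' \<circ> chart_inv c) y) = (snd d \<circ> f \<circ> chart_inv c) y"
      if "y \<in> snd c ` (fst c \<inter> fst c')" for y
      using chart_inv_left[OF diff_atlas_inj[OF A c(2)]]
        chart_inv_mem_iff[OF diff_atlas_inj[OF A c(1)] that] by simp
  qed
  moreover have "v c' = dderiv (snd c' \<circ> chart_inv c) (snd c p) (v c)"
    using v c p unfolding tangent_space_def by blast
  ultimately show ?thesis using dderiv_eq by metis
qed

lemma
  assumes A: "diff_atlas A" and B: "diff_atlas B" and f: "smooth_map A B f" 
    and p: "p \<in> points A" and v: "v \<in> tangent_space A p"
  shows differential_in_tangent_space: "differential A B f p v \<in> tangent_space B (f p)"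
    and differential_chart: "c \<in> A \<Longrightarrow> d \<in> B \<Longrightarrow> p \<in> fst c \<Longrightarrow> f p \<in> fst d \<Longrightarrow>
      differential A B f p v d = dderiv (snd d \<circ> f \<circ> chart_inv c) (snd c p) (v c)"
proof -
  define c' where "c' = chart_at A p"
  define d' where "d' = chart_at B (f p)"
  have fp: "f p \<in> points B" using f p by (auto simp: smooth_map_def)
  have c': "c' \<in> A" "p \<in> fst c'" and d': "d' \<in> B" "f p \<in> fst d'"
    using chart_at[OF p] chart_at[OF fp] by (simp_all add: c'_def d'_def)
  have eq: "differential A B f p v = coord_vec B d' (f p) (dderiv (snd d' \<circ> f \<circ> chart_inv c') (snd c' p) (v c'))"
    by (simp add: differential_def c'_def d'_def Let_def)
  show "differential A B f p v \<in> tangent_space B (f p)"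
    unfolding eq by (rule coord_vec_in_tangent_space[OF B d'])
  assume c: "c \<in> A" "p \<in> fst c" and d: "d \<in> B" "f p \<in> fst d"
  have val: "(snd d' \<circ> f \<circ> chart_inv c) (snd c p) = snd d' (f p)"
    using chart_inv_left[OF diff_atlas_inj[OF A c(1)] c(2)] by simp
  have gd: "((snd d \<circ> chart_inv d') has_derivative dderiv (snd d \<circ> chart_inv d') (snd d' (f p))) (at ((snd d' \<circ> f \<circ> chart_inv c) (snd c p)))"
    unfolding val by (intro has_derivative_dderiv transition_differentiable[OF B] d d')
  have "((\<lambda>x. (snd d \<circ> chart_inv d') ((snd d' \<circ> f \<circ> chart_inv c) x)) has_derivative
    (\<lambda>u. dderiv (snd d \<circ> chart_inv d') (snd d' (f p)) (dderiv (snd d' \<circ> f \<circ> chart_inv c) (snd c p) u)))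
    (at (snd c p))"
    by (rule has_derivative_compose[OF smooth_map_has_derivative[OF f c(1) d'(1) c(2) d'(2)] gd])
  then have "((snd d \<circ> f \<circ> chart_inv c) has_derivative
    (\<lambda>u. dderiv (snd d \<circ> chart_inv d') (snd d' (f p)) (dderiv (snd d' \<circ> f \<circ> chart_inv c) (snd c p) u)))
    (at (snd c p))"
  proof (rule has_derivative_transform_within_open)
    show "open (snd c ` (fst c \<inter> f -` fst d'))" by (rule smooth_map_open[OF f c(1) d'(1)])
    show "snd c p \<in> snd c ` (fst c \<inter> f -` fst d')" using c d' by blast
    show "(snd d \<circ> chart_inv d') ((snd d' \<circ> f \<circ> chart_inv c) y) = (snd d \<circ> f \<circ> chart_inv c) y"
      if "y \<in> snd c ` (fst c \<inter> f -` fst d')" for y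
      using chart_inv_left[OF diff_atlas_inj[OF B d'(1)]]
        chart_inv_mem_iff[OF diff_atlas_inj[OF A c(1)] that] by simp
  qed
  from dderiv_eq[OF this]
  show "differential A B f p v d = dderiv (snd d \<circ> f \<circ> chart_inv c) (snd c p) (v c)"
    unfolding eq using d
    by (simp add: coord_vec_def smooth_map_change_chart[OF A f c(1) c'(1) d'(1) c(2) c'(2) d'(2) v])
qed



text \<open>Linearity of functions on tangent spaces is available in the form of combinations of two vectors;
  this extends it to combinations over a finite index type.\<close>
lemma tcomb_linear_image:
  fixes f :: "('a, 'e::euclidean_space) tvec \<Rightarrow> 'w::real_vector"
  assumes A: "diff_atlas A"
    and f: "\<And>u w r s. u \<in> tangent_space A q \<Longrightarrow> w \<in> tangent_space A q \<Longrightarrow>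
      f (tlin r u s w) = r *\<^sub>R f u + s *\<^sub>R f w"
    and V: "\<And>i. V i \<in> tangent_space A q"
  shows "f (tcomb y V) = (\<Sum>i\<in>UNIV. y i *\<^sub>R f (V i))"
proof -
  have "f (\<lambda>c. \<Sum>i\<in>I. y i *\<^sub>R V i c) = (\<Sum>i\<in>I. y i *\<^sub>R f (V i))
      \<and> (\<lambda>c. \<Sum>i\<in>I. y i *\<^sub>R V i c) \<in> tangent_space A q"
    if "finite I" for I
    using that
  proof (induction I)
    case empty
    have "f (tlin 0 (\<lambda>_. 0) 0 (\<lambda>_. 0)) = 0"
      using f[OF zero_in_tangent_space[OF A] zero_in_tangent_space[OF A], of 0 0] by simp
    then show ?case using zero_in_tangent_space[OF A] by (simp add: tlin_def)
  next
    case (insert i I)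
    have eq: "(\<lambda>c. \<Sum>i\<in>insert i I. y i *\<^sub>R V i c) = tlin (y i) (V i) 1 (\<lambda>c. \<Sum>i\<in>I. y i *\<^sub>R V i c)"
      using insert by (simp add: tlin_def)
    show ?case unfolding eq
      using insert f[OF V, of "\<lambda>c. \<Sum>i\<in>I. y i *\<^sub>R V i c" "y i" i 1] tangent_space_tlin[OF A V] by simp
  qed
  then show ?thesis by (simp add: tcomb_def)
qed

lemma restrict_atlas_points: "restrict_atlas A (points A) = A"
proof -
  have "(fst c \<inter> points A, snd c) = c" if "c \<in> A" for c
    using in_points[OF that] by (auto simp: prod_eq_iff)
  then show ?thesis by (auto simp: restrict_atlas_def image_iff)
qed

lemma openin_points:
  assumes "diff_atlas A"
  shows "openin (manifold_top A) (points A)"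
proof -
  have "snd c ` (fst c \<inter> points A) = chart_img c" if "c \<in> A" for c
    using in_points[OF that] by (auto simp: chart_img_def)
  then show ?thesis
    using openin_manifold_top[OF diff_atlas_inj[OF assms]] open_chart_img[OF assms] by auto
qed

section \<open>The atlas of the tangent bundle\<close>

lemma lift_chart_inj:
  assumes "diff_atlas A" "c \<in> A"
  shows "inj_on (snd (lift_chart A c)) (fst (lift_chart A c))"
proof (rule inj_onI, clarsimp simp: lift_chart_def)
  fix q v q' v' 
  assume h: "q \<in> fst c" "v \<in> tangent_space A q" "q' \<in> fst c" "v' \<in> tangent_space A q'"
    "snd c q = snd c q'" "v c = v' c"
  then have "q = q'" using diff_atlas_inj[OF assms] by (meson inj_onD)
  then show "q = q' \<and> v = v'" using h tangent_space_eqI[of v A q v' c] assms by simp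
qed

lemma lift_chart_apply [simp]: "snd (lift_chart A c) (q, v) = (snd c q, v c)"
  by (simp add: lift_chart_def)

lemma lift_chart_domain [simp]: "(q, v) \<in> fst (lift_chart A c) \<longleftrightarrow> q \<in> fst c \<and> v \<in> tangent_space A q"
  by (simp add: lift_chart_def)

text \<open>A point together with an arbitrary coordinate vector determines a tangent vector, so over its
  domain an induced chart is onto a cylinder.\<close>
lemma lift_chart_image:
  assumes A: "diff_atlas A" and c: "c \<in> A"
  shows "snd (lift_chart A c) ` (fst (lift_chart A c) \<inter> {(q, v). q \<in> U}) = snd c ` (fst c \<inter> U) \<times> UNIV"
proof (intro equalityI subsetI)
  fix z assume "z \<in> snd c ` (fst c \<inter> U) \<times> (UNIV :: 'b set)"
  then obtain q where q: "q \<in> fst c" "q \<in> U" "fst z = snd c q" by (auto simp: mem_Times_iff)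
  have "z = snd (lift_chart A c) (q, coord_vec A c q (snd z))"
    using q coord_vec_chart[OF A c] by (simp add: prod_eq_iff)
  moreover have "(q, coord_vec A c q (snd z)) \<in> fst (lift_chart A c) \<inter> {(q, v). q \<in> U}"
    using q coord_vec_in_tangent_space[OF A c] by simp
  ultimately show "z \<in> snd (lift_chart A c) ` (fst (lift_chart A c) \<inter> {(q, v). q \<in> U})" by blast
qed (auto simp: lift_chart_def)

lemma chart_img_lift_chart:
  assumes "diff_atlas A" "c \<in> A"
  shows "chart_img (lift_chart A c) = chart_img c \<times> UNIV"
  using lift_chart_image[OF assms, of UNIV] by (simp add: chart_img_def)

lemma chart_inv_lift_chart:
  assumes A: "diff_atlas A" and c: "c \<in> A" and x: "x \<in> chart_img c"
  shows "chart_inv (lift_chart A c) (x, u) = (chart_inv c x, coord_vec A c (chart_inv c x) u)"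
proof -
  have q: "chart_inv c x \<in> fst c" "snd c (chart_inv c x) = x"
    using x chart_inv_in[of x c "fst c"] chart_inv_right[of x c "fst c"] by (auto simp: chart_img_def)
  have "chart_inv (lift_chart A c) (snd (lift_chart A c) (chart_inv c x, coord_vec A c (chart_inv c x) u))
    = (chart_inv c x, coord_vec A c (chart_inv c x) u)"
    using q coord_vec_in_tangent_space[OF A c]
    by (intro chart_inv_left lift_chart_inj A c) simp
  then show ?thesis using q coord_vec_chart[OF A c] by simp
qed

text \<open>The transition maps of the tangent bundle are \<open>(x, u) \<mapsto> (\<phi> x, D\<phi>(x) u)\<close>. Writing \<open>u\<close> in a basis
  turns the second component into a sum of products of smooth functions.\<close>
lemma diff_atlas_tangent_atlas:
  assumes M: "smooth_manifold A"
  shows "diff_atlas (tangent_atlas A)"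
proof -
  have A: "diff_atlas A" by (rule smooth_manifold_imp_diff_atlas[OF M])
  have ov: "snd (lift_chart A c) ` (fst (lift_chart A c) \<inter> fst (lift_chart A d)) = snd c ` (fst c \<inter> fst d) \<times> UNIV"
    if "c \<in> A" "d \<in> A" for c d
  proof -
    have "fst (lift_chart A c) \<inter> fst (lift_chart A d) = fst (lift_chart A c) \<inter> {(q, v). q \<in> fst d}"
      by (auto simp: lift_chart_def)
    then show ?thesis using lift_chart_image[OF A that(1)] by simp
  qed
  have op: "open (snd c ` (fst c \<inter> fst d) \<times> (UNIV :: 'b set))" if "c \<in> A" "d \<in> A" for c d
    using A that unfolding diff_atlas_def by (intro open_Times) auto
  have "(snd (lift_chart A d) \<circ> chart_inv (lift_chart A c)) differentiable at z"
    if c: "c \<in> A" and d: "d \<in> A" and z: "z \<in> snd c ` (fst c \<inter> fst d) \<times> UNIV" for c d z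
  proof -
    let ?\<phi> = "snd d \<circ> chart_inv c" and ?S = "snd c ` (fst c \<inter> fst d)"
    let ?T = "?S \<times> (UNIV :: 'b set)"
    have sm: "smooth_on ?S ?\<phi>" using M c d unfolding smooth_manifold_def by blast
    have T: "open ?T" by (rule op[OF c d])
    have S1: "smooth_on ?T (\<lambda>z. ?\<phi> (fst z))"
      by (rule smooth_on_compose_fst[OF T _ sm]) auto
    have S2: "smooth_on ?T (\<lambda>z. \<Sum>b\<in>Basis. (snd z \<bullet> b) *\<^sub>R dderiv ?\<phi> (fst z) b)"
    proof (intro smooth_on_sum T smooth_on_scaleR)
      fix b :: 'b
      show "smooth_on ?T (\<lambda>z. snd z \<bullet> b)"
        by (rule smooth_on_bounded_linear[OF T _ smooth_on_ident])
          (rule bounded_linear_compose[OF bounded_linear_inner_left bounded_linear_snd])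
      show "smooth_on ?T (\<lambda>z. dderiv ?\<phi> (fst z) b)"
        by (rule smooth_on_compose_fst[OF T _ smooth_on_dderiv[OF sm]]) auto
    qed
    have "(\<lambda>z. (?\<phi> (fst z), \<Sum>b\<in>Basis. (snd z \<bullet> b) *\<^sub>R dderiv ?\<phi> (fst z) b)) differentiable at z"
      using has_derivative_Pair[OF has_derivative_dderiv has_derivative_dderiv, OF smooth_on_differentiable[OF S1 z] smooth_on_differentiable[OF S2 z]]
      unfolding differentiable_def by blast
    then show ?thesis
    proof (rule differentiable_cong_open[OF T z])
      fix y assume y: "y \<in> ?T"
      then obtain q where q: "q \<in> fst c" "q \<in> fst d" "fst y = snd c q" by auto
      have cq: "chart_inv c (fst y) = q" using q chart_inv_left[OF diff_atlas_inj[OF A c]] by simp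
      have "fst y \<in> chart_img c" using q by (simp add: chart_img_def)
      from chart_inv_lift_chart[OF A c this, of "snd y"]
      have "chart_inv (lift_chart A c) y = (q, coord_vec A c q (snd y))" using cq by simp
      then have "(snd (lift_chart A d) \<circ> chart_inv (lift_chart A c)) y = (snd d q, dderiv ?\<phi> (snd c q) (snd y))"
        using q d by (simp add: coord_vec_def)
      also have "dderiv ?\<phi> (snd c q) (snd y) = dderiv ?\<phi> (snd c q) (\<Sum>b\<in>Basis. (snd y \<bullet> b) *\<^sub>R b)"
        by (simp add: euclidean_representation)
      also have "\<dots> = (\<Sum>b\<in>Basis. (snd y \<bullet> b) *\<^sub>R dderiv ?\<phi> (snd c q) b)"
        using dderiv_linear[OF transition_differentiable[OF A c d q(1,2)]]
        by (simp add: linear_sum linear_cmul)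
      finally show "(?\<phi> (fst y), \<Sum>b\<in>Basis. (snd y \<bullet> b) *\<^sub>R dderiv ?\<phi> (fst y) b)
        = (snd (lift_chart A d) \<circ> chart_inv (lift_chart A c)) y"
        using q cq by simp
    qed
  qed
  then have "open (snd (lift_chart A c) ` (fst (lift_chart A c) \<inter> fst (lift_chart A d))) \<and>
     (\<forall>z\<in>snd (lift_chart A c) ` (fst (lift_chart A c) \<inter> fst (lift_chart A d)).
        (snd (lift_chart A d) \<circ> chart_inv (lift_chart A c)) differentiable at z)"
    if "c \<in> A" "d \<in> A" for c d
    unfolding ov[OF that] using op that by blast
  then show ?thesis
    unfolding diff_atlas_def tangent_atlas_def using lift_chart_inj[OF A] by blast
qed

section \<open>Euler-Lagrange expressions and geodesic sprays\<close>

lemma bounded_bilinear_matrix_vector_mult':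
  "bounded_bilinear ((*v) :: real^'n^'m \<Rightarrow> real^'n \<Rightarrow> real^'m)"
proof (unfold bilinear_conv_bounded_bilinear[symmetric], unfold bilinear_def, intro conjI allI)
  show "linear ((*v) A)" for A :: "real^'n^'m" by (rule matrix_vector_mul_linear)
  show "linear (\<lambda>A :: real^'n^'m. A *v v)" for v
    by (rule linearI) (auto simp: matrix_vector_mult_def vec_eq_iff sum.distrib distrib_right sum_distrib_left mult.assoc)
qed

lemma has_derivative_quadratic:
  fixes h :: "'a::real_normed_vector \<Rightarrow> real^'n^'n"
  assumes "h differentiable at x" "u differentiable at x" "w differentiable at x"
  shows "((\<lambda>x. u x \<bullet> (h x *v w x)) has_derivative
    (\<lambda>z. dderiv u x z \<bullet> (h x *v w x) + u x \<bullet> (dderiv h x z *v w x) + u x \<bullet> (h x *v dderiv w x z))) (at x)"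
proof -
  have "((\<lambda>x. h x *v w x) has_derivative (\<lambda>z. h x *v dderiv w x z + dderiv h x z *v w x)) (at x)"
    by (intro bounded_bilinear.FDERIV[OF bounded_bilinear_matrix_vector_mult'] has_derivative_dderiv assms)
  from has_derivative_inner[OF has_derivative_dderiv[OF assms(2)] this]
  show ?thesis
    by (rule has_derivative_eq_rhs) (simp add: fun_eq_iff inner_add_right)
qed

text \<open>With the quadratic Lagrangian of the matrix field \<open>h\<close>, this is the expression
  \<open>d/dt (\<partial>L/\<partial>v) w - (\<partial>L/\<partial>x) w\<close> along a curve through \<open>x\<close> with velocity \<open>v\<close> and acceleration \<open>F\<close>, paired
  with the test vector \<open>w\<close>.\<close>
definition euler_lagrange :: "(real^'n \<Rightarrow> real^'n^'n) \<Rightarrow> real^'n \<Rightarrow> real^'n \<Rightarrow> real^'n \<Rightarrow> real^'n \<Rightarrow> real"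
  where "euler_lagrange h x v F w = F \<bullet> (h x *v w) + v \<bullet> (dderiv h x v *v w) - v \<bullet> (dderiv h x w *v v) / 2"

text \<open>If velocity and test vector are extended to fields, the derivatives of \<open>h\<close> can be traded for
  derivatives of the functions \<open>h(Y, W)\<close> and \<open>h(Y, Y)\<close> at the price of a Lie bracket. This makes
  metrics comparable that agree on some vectors of a frame but not on all of them.\<close>
lemma euler_lagrange_along_fields:
  assumes h: "h differentiable at x" and Y: "Y differentiable at x" and W: "W differentiable at x"
    and sym: "\<And>u w. u \<bullet> (h x *v w) = w \<bullet> (h x *v u)"
  shows "euler_lagrange h x (Y x) F (W x) = (F - dderiv Y x (Y x)) \<bullet> (h x *v W x)
    + dderiv (\<lambda>x. Y x \<bullet> (h x *v W x)) x (Y x) - dderiv (\<lambda>x. Y x \<bullet> (h x *v Y x)) x (W x) / 2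
    + Y x \<bullet> (h x *v (dderiv Y x (W x) - dderiv W x (Y x)))"
  unfolding euler_lagrange_def dderiv_eq[OF has_derivative_quadratic[OF h Y W]]
    dderiv_eq[OF has_derivative_quadratic[OF h Y Y]]
  using sym[of "dderiv Y x (W x)" "Y x"]
  by (simp add: matrix_vector_mult_diff_distrib inner_diff_left inner_diff_right field_simps)

lemma euler_lagrange_linear:
  assumes "h differentiable at x"
  shows "linear (euler_lagrange h x v F)"
proof -
  note l = dderiv_linear[OF assms]
  note s = bounded_bilinear.add_left[OF bounded_bilinear_matrix_vector_mult']
    bounded_bilinear.scaleR_left[OF bounded_bilinear_matrix_vector_mult']
  show ?thesis
    unfolding euler_lagrange_def
    by (rule linearI)
      (simp_all add: linear_add[OF l] linear_cmul[OF l] s inner_add_right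
        matrix_vector_right_distrib matrix_vector_mult_scaleR algebra_simps)
qed

lemma vec_eq_sum_axis: "(v :: real^'n) = (\<Sum>i\<in>UNIV. v $ i *\<^sub>R axis i 1)"
  using basis_expansion[of v] by (simp add: scalar_mult_eq_scaleR)

lemma mat_form_expand: "u \<bullet> (A *v w) = (\<Sum>i\<in>UNIV. \<Sum>j\<in>UNIV. A $ i $ j * u $ i * w $ j)"
  for A :: "real^'n^'m"
  by (simp add: inner_vec_def matrix_vector_mult_def sum_distrib_left mult_ac)

text \<open>The right-hand side spells out the geodesic spray with its Christoffel symbols. Testing the
  Euler-Lagrange expression on the coordinate vectors gives \<open>h F\<close>, and the invertible matrix
  \<open>h\<close> can be cancelled.\<close>
lemma spray_of_euler_lagrange:
  fixes h :: "real^'n \<Rightarrow> real^'n^'n"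
  assumes h: "h differentiable at x" and inv: "invertible (h x)"
    and S: "open S" "x \<in> S" and sym: "\<And>y i j. y \<in> S \<Longrightarrow> h y $ i $ j = h y $ j $ i"
    and el: "\<And>w. euler_lagrange h x v F w = 0"
  shows "F $ k = - (\<Sum>i\<in>UNIV. \<Sum>j\<in>UNIV. (1 / 2 * (\<Sum>l\<in>UNIV. matrix_inv (h x) $ k $ l *
    (dderiv (\<lambda>y. h y $ j $ l) x (axis i 1) + dderiv (\<lambda>y. h y $ i $ l) x (axis j 1)
     - dderiv (\<lambda>y. h y $ i $ j) x (axis l 1)))) * v $ i * v $ j)"
proof -
  define D where "D i j l = dderiv h x (axis i 1) $ j $ l" for i j l
  have comp: "((\<lambda>y. h y $ j $ l) has_derivative (\<lambda>z. dderiv h x z $ j $ l)) (at x)" for j l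
    by (intro bounded_linear.has_derivative[OF bounded_linear_vec_nth] has_derivative_dderiv h)
  have D: "dderiv (\<lambda>y. h y $ j $ l) x (axis i 1) = D i j l" for i j l
    unfolding D_def by (rule dderiv_eq[OF comp])
  have dv: "dderiv h x v $ j $ l = (\<Sum>i\<in>UNIV. v $ i * D i j l)" for j l
  proof -
    have "dderiv h x v = (\<Sum>i\<in>UNIV. v $ i *\<^sub>R dderiv h x (axis i 1))"
      using linear_sum[OF dderiv_linear[OF h], of "\<lambda>i. v $ i *\<^sub>R axis i 1" UNIV]
        linear_cmul[OF dderiv_linear[OF h]] vec_eq_sum_axis[of v] by simp
    then show ?thesis by (simp add: D_def)
  qed
  have symx: "(h x *v F) $ l = F \<bullet> (h x *v axis l 1)" for l
    using sym[OF S(2)]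
    by (simp add: matrix_vector_mult_def inner_vec_def axis_def if_distrib[of "\<lambda>y. _ * y"] mult.commute cong: if_cong)
  define T where "T l = (\<Sum>i\<in>UNIV. \<Sum>j\<in>UNIV. (D i j l + D j i l - D l i j) * v $ i * v $ j) / 2" for l
  have T: "T l = - (h x *v F) $ l" for l
  proof -
    have unit_chart: "v \<bullet> (dderiv h x v *v axis l 1) = (\<Sum>i\<in>UNIV. \<Sum>j\<in>UNIV. D i j l * v $ i * v $ j)"
    proof -
      have "v \<bullet> (dderiv h x v *v axis l 1) = (\<Sum>j\<in>UNIV. v $ j * dderiv h x v $ j $ l)"
        by (simp add: matrix_vector_mult_def inner_vec_def axis_def if_distrib[of "\<lambda>y. _ * y"] cong: if_cong)
      also have "\<dots> = (\<Sum>j\<in>UNIV. \<Sum>i\<in>UNIV. D i j l * v $ i * v $ j)"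
        by (simp add: dv sum_distrib_left mult_ac)
      finally show ?thesis by (subst sum.swap)
    qed
    have e2: "(\<Sum>i\<in>UNIV. \<Sum>j\<in>UNIV. D j i l * v $ i * v $ j) = (\<Sum>i\<in>UNIV. \<Sum>j\<in>UNIV. D i j l * v $ i * v $ j)"
      by (subst sum.swap) (simp add: mult_ac)
    have e3: "v \<bullet> (dderiv h x (axis l 1) *v v) = (\<Sum>i\<in>UNIV. \<Sum>j\<in>UNIV. D l i j * v $ i * v $ j)"
      by (simp add: mat_form_expand D_def)
    have "T l = v \<bullet> (dderiv h x v *v axis l 1) - v \<bullet> (dderiv h x (axis l 1) *v v) / 2"
      unfolding unit_chart e3 T_def using e2
      by (simp add: sum.distrib sum_subtractf distrib_right left_diff_distrib)
    then show ?thesis using el[of "axis l 1"] unfolding euler_lagrange_def symx by linarith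
  qed
  have "(\<Sum>i\<in>UNIV. \<Sum>j\<in>UNIV. (1 / 2 * (\<Sum>l\<in>UNIV. matrix_inv (h x) $ k $ l *
    (D i j l + D j i l - D l i j))) * v $ i * v $ j)
    = (\<Sum>i\<in>UNIV. \<Sum>j\<in>UNIV. \<Sum>l\<in>UNIV. matrix_inv (h x) $ k $ l * ((D i j l + D j i l - D l i j) * v $ i * v $ j / 2))"
    by (simp add: sum_distrib_left sum_distrib_right mult_ac)
  also have "\<dots> = (\<Sum>i\<in>UNIV. \<Sum>l\<in>UNIV. \<Sum>j\<in>UNIV. matrix_inv (h x) $ k $ l * ((D i j l + D j i l - D l i j) * v $ i * v $ j / 2))"
    by (intro sum.cong refl sum.swap)
  also have "\<dots> = (\<Sum>l\<in>UNIV. \<Sum>i\<in>UNIV. \<Sum>j\<in>UNIV. matrix_inv (h x) $ k $ l * ((D i j l + D j i l - D l i j) * v $ i * v $ j / 2))"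
    by (rule sum.swap)
  also have "\<dots> = (\<Sum>l\<in>UNIV. matrix_inv (h x) $ k $ l * T l)"
    by (simp add: T_def sum_distrib_left sum_divide_distrib)
  also have "\<dots> = - (matrix_inv (h x) *v (h x *v F)) $ k"
    by (simp add: T matrix_vector_mult_def sum_negf)
  also have "matrix_inv (h x) *v (h x *v F) = F"
  proof -
    have "matrix_inv (h x) ** h x = mat 1"
      using inv unfolding matrix_inv_def invertible_def by (rule someI2_ex) simp
    then show ?thesis by (simp add: matrix_vector_mul_assoc)
  qed
  finally show ?thesis unfolding D by simp
qed

lemma axis_inner_mult: "axis a 1 \<bullet> (A *v axis b 1) = A $ a $ b" for A :: "real^'i^'j"
  by (simp add: inner_axis' matrix_vector_mult_basis column_def)

text \<open>Bilinearity reduces the metric to its values on the coordinate vectors, which are the entries of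
  the matrix.\<close>
lemma riemannian_metric_in_chart:
  assumes A: "diff_atlas A" and g: "riemannian_metric A g" and c: "c \<in> A" "p \<in> fst c"
    and u: "u \<in> tangent_space A p" and w: "w \<in> tangent_space A p"
  shows "g p u w = u c \<bullet> (metric_mat A g c (snd c p) *v w c)"
proof -
  let ?e = "\<lambda>i. coord_vec A c p (axis i 1)"
  have e: "?e i \<in> tangent_space A p" for i by (rule coord_vec_in_tangent_space[OF A c])
  have p: "p \<in> points A" by (rule in_points[OF c])
  have sym: "g p a b = g p b a" if "a \<in> tangent_space A p" "b \<in> tangent_space A p" for a b
    using g that p unfolding riemannian_metric_def by blast
  have rep: "a = tcomb (\<lambda>i. a c $ i) ?e" if a: "a \<in> tangent_space A p" for a
  proof (rule tangent_space_eqI[OF a tangent_space_tcomb[OF A e] c])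
    show "a c = tcomb (\<lambda>i. a c $ i) ?e c"
      unfolding tcomb_def by (subst (1) vec_eq_sum_axis) (simp only: coord_vec_chart[OF A c])
  qed
  have expand: "g p a b = (\<Sum>i\<in>UNIV. a c $ i * g p (?e i) b)"
    if a: "a \<in> tangent_space A p" and b: "b \<in> tangent_space A p" for a b
  proof -
    have "g p (tcomb (\<lambda>i. a c $ i) ?e) b = (\<Sum>i\<in>UNIV. (a c $ i) *\<^sub>R g p (?e i) b)"
      by (rule tcomb_linear_image[OF A, where f="\<lambda>a. g p a b", OF _ e])
        (use g p b in \<open>simp add: riemannian_metric_def\<close>)
    then show ?thesis by (subst rep[OF a]) simp
  qed
  have mm: "metric_mat A g c (snd c p) $ i $ j = g p (?e i) (?e j)" for i j
    using chart_inv_left[OF diff_atlas_inj[OF A c(1)] c(2)] by (simp add: metric_mat_def)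
  have "g p (?e i) w = (\<Sum>j\<in>UNIV. w c $ j * g p (?e i) (?e j))" for i
    using expand[OF w e] sym[OF e w] sym[OF e e] by simp
  then show ?thesis
    using expand[OF u w] by (simp add: mat_form_expand mm sum_distrib_left mult_ac)
qed

lemma metric_mat_symmetric:
  assumes A: "diff_atlas A" and g: "riemannian_metric A g" and c: "c \<in> A" and x: "x \<in> chart_img c"
  shows "metric_mat A g c x $ i $ j = metric_mat A g c x $ j $ i"
proof -
  have q: "chart_inv c x \<in> fst c"
    using x chart_inv_in[of x c "fst c"] by (auto simp: chart_img_def)
  show ?thesis
    unfolding metric_mat_def
    using g in_points[OF c q] coord_vec_in_tangent_space[OF A c q]
    by (simp add: riemannian_metric_def Let_def)
qed

lemma metric_mat_invertible:
  assumes A: "diff_atlas A" and g: "riemannian_metric A g" and c: "c \<in> A" "p \<in> fst c"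
  shows "invertible (metric_mat A g c (snd c p))"
proof -
  have "u = 0" if u: "metric_mat A g c (snd c p) *v u = 0" for u
  proof (rule ccontr)
    assume "u \<noteq> 0"
    let ?u = "coord_vec A c p u"
    have t: "?u \<in> tangent_space A p" by (rule coord_vec_in_tangent_space[OF A c])
    have "?u \<noteq> (\<lambda>_. 0)" using coord_vec_chart[OF A c, of u] \<open>u \<noteq> 0\<close> by auto
    then have "g p ?u ?u > 0"
      using g t in_points[OF c] unfolding riemannian_metric_def by blast
    then show False
      using riemannian_metric_in_chart[OF A g c t t] coord_vec_chart[OF A c, of u] u by simp
  qed
  then show ?thesis
    unfolding invertible_left_inverse matrix_left_invertible_ker by blast
qed

lemma metric_mat_form_sym:
  assumes A: "diff_atlas A" and g: "riemannian_metric A g" and c: "c \<in> A" and x: "x \<in> chart_img c"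
  shows "u \<bullet> (metric_mat A g c x *v w) = w \<bullet> (metric_mat A g c x *v u)"
  unfolding mat_form_expand
  by (subst sum.swap) (simp add: metric_mat_symmetric[OF A g c x, of _ _] mult_ac)

lemma metric_mat_differentiable:
  assumes "riemannian_metric A g" "c \<in> A" "p \<in> fst c"
  shows "metric_mat A g c differentiable at (snd c p)"
  by (rule smooth_on_differentiable[of "chart_img c"])
    (use assms in \<open>auto simp: riemannian_metric_def chart_img_def\<close>)

section \<open>Dimension of diffeomorphic manifolds and charts of products\<close>

text \<open>The derivative of a diffeomorphism in charts has a left inverse, the derivative of the inverse
  map.\<close>
lemma diffeomorphism_dim_le:
  fixes A :: "('a, 'e::euclidean_space) atlas" and B :: "('b, 'f::euclidean_space) atlas"
  assumes f: "diffeomorphism A B f" and A: "\<And>c. c \<in> A \<Longrightarrow> inj_on (snd c) (fst c)"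
    and B: "\<And>d. d \<in> B \<Longrightarrow> inj_on (snd d) (fst d)" and p: "p \<in> points A"
  shows "DIM('e) \<le> DIM('f)"
proof -
  let ?h = "inv_into (points A) f"
  have sm: "smooth_map A B f" "smooth_map B A ?h" and bij: "bij_betw f (points A) (points B)"
    using f by (auto simp: diffeomorphism_def)
  have hf: "?h (f q) = q" if "q \<in> points A" for q
    using bij that by (auto simp: bij_betw_def)
  obtain c where c: "c \<in> A" "p \<in> fst c" using p by (auto simp: points_def)
  have "f p \<in> points B" using bij p by (auto simp: bij_betw_def)
  then obtain d where d: "d \<in> B" "f p \<in> fst d" by (auto simp: points_def)
  let ?F = "snd d \<circ> f \<circ> chart_inv c" and ?H = "snd c \<circ> ?h \<circ> chart_inv d"
  have F: "(?F has_derivative dderiv ?F (snd c p)) (at (snd c p))"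
    by (rule smooth_map_has_derivative[OF sm(1) c(1) d(1) c(2) d(2)])
  have val: "?F (snd c p) = snd d (f p)" using chart_inv_left[OF A[OF c(1)] c(2)] by simp
  have H: "(?H has_derivative dderiv ?H (snd d (f p))) (at (?F (snd c p)))"
    unfolding val using smooth_map_has_derivative[OF sm(2) d(1) c(1) d(2)] hf[OF p] c(2) by simp
  have "((\<lambda>y. ?H (?F y)) has_derivative (\<lambda>u. dderiv ?H (snd d (f p)) (dderiv ?F (snd c p) u))) (at (snd c p))"
    by (rule has_derivative_compose[OF F H])
  then have "((\<lambda>y. y) has_derivative (\<lambda>u. dderiv ?H (snd d (f p)) (dderiv ?F (snd c p) u))) (at (snd c p))"
  proof (rule has_derivative_transform_within_open)
    show "open (snd c ` (fst c \<inter> f -` fst d))" by (rule smooth_map_open[OF sm(1) c(1) d(1)])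
    show "snd c p \<in> snd c ` (fst c \<inter> f -` fst d)" using c d by blast
    fix y assume "y \<in> snd c ` (fst c \<inter> f -` fst d)"
    then obtain q where q: "q \<in> fst c" "f q \<in> fst d" "y = snd c q" by auto
    then show "?H (?F y) = y"
      using chart_inv_left[OF A[OF c(1)]] chart_inv_left[OF B[OF d(1)]] hf[OF in_points[OF c(1)]]
      by simp
  qed
  then have "(\<lambda>u. dderiv ?H (snd d (f p)) (dderiv ?F (snd c p) u)) = (\<lambda>u. u)"
    using has_derivative_unique has_derivative_ident by blast
  then have "inj (dderiv ?F (snd c p))" by (intro inj_on_inverseI) (rule fun_cong)
  then have "dim (range (dderiv ?F (snd c p))) = DIM('e)"
    using dim_image_eq[OF has_derivative_linear[OF F], of UNIV] by simp
  then show ?thesis using dim_subset_UNIV by metis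
qed

lemma prod_chart_inv:
  assumes "inj_on (snd c) (fst c)" "inj_on (snd d) (fst d)" "p \<in> fst c" "q \<in> fst d"
  shows "chart_inv (fst c \<times> fst d, map_prod (snd c) (snd d)) (snd c p, snd d q) = (p, q)"
proof -
  have "inj_on (map_prod (snd c) (snd d)) (fst c \<times> fst d)"
    by (rule map_prod_inj_on[OF assms(1,2)])
  from inv_into_f_f[OF this, of "(p, q)"] show ?thesis
    using assms by (simp add: chart_inv_def)
qed

lemma prod_atlas_mem: "c \<in> A \<Longrightarrow> d \<in> B \<Longrightarrow> (fst c \<times> fst d, map_prod (snd c) (snd d)) \<in> prod_atlas A B"
  by (auto simp: prod_atlas_def)

section \<open>Chaplygin systems and the action in charts\<close>

locale chaplygin_frame =
  fixes G :: "('g, 'z) monoid_scheme"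
    and AG :: "('g, real^'k::finite) atlas"
    and AQ :: "('q, real^'n::finite) atlas"
    and AB :: "('q set, real^'m::finite) atlas"
    and \<psi> :: "'g \<Rightarrow> 'q \<Rightarrow> 'q"
    and g :: "('q, real^'n) metric"
    and \<omega> :: "'q \<Rightarrow> ('q, real^'n) tvec \<Rightarrow> ('g, real^'k) tvec"
    and x :: "('q set, real^'m) chart"
    and X :: "'m \<Rightarrow> 'q \<Rightarrow> ('q, real^'n) tvec"
    and E :: "'k \<Rightarrow> ('g, real^'k) tvec"
  assumes chaplygin: "chaplygin_system G AG AQ AB \<psi> g \<omega>"
    and x_chart: "x \<in> AB" and x_global: "fst x = points AB"
    and X_lift: "\<forall>a. horizontal_lift G AQ AB \<psi> \<omega> (\<lambda>b. coord_vec AB x b (axis a 1)) (X a)"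
    and E_basis: "lie_algebra_basis G AG E"
begin

abbreviation "\<D> \<equiv> horizontal AQ \<omega>"
abbreviation "E\<^sub>Q i \<equiv> inf_generator G AG AQ \<psi> (E i)"
abbreviation "\<pi> \<equiv> orbit G \<psi>"
abbreviation "T q \<equiv> tangent_space AQ q"

lemma principal: "principal_bundle G AG AQ AB \<psi>"
  and metric: "riemannian_metric AQ g"
  and inv_metric: "invariant_metric G AQ \<psi> g"
  and connection: "principal_connection G AG AQ \<psi> \<omega>"
  using chaplygin by (auto simp: chaplygin_system_def)

lemma AQ_manifold: "smooth_manifold AQ" and AB_manifold: "smooth_manifold AB"
  and lie: "lie_group G AG" and action: "group_action G (points AQ) \<psi>"
  and smooth_action: "smooth_map (prod_atlas AG AQ) AQ (\<lambda>(s, q). \<psi> s q)"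
  and base_points: "points AB = orbits G (points AQ) \<psi>"
  and smooth_\<pi>: "smooth_map AQ AB \<pi>"
  using principal unfolding principal_bundle_def by blast+

lemma AG_manifold: "smooth_manifold AG" and grp: "group G" and AG_points: "points AG = carrier G"
  using lie by (auto simp: lie_group_def)

lemmas AQ = smooth_manifold_imp_diff_atlas[OF AQ_manifold]
lemmas AB = smooth_manifold_imp_diff_atlas[OF AB_manifold]
lemmas AG = smooth_manifold_imp_diff_atlas[OF AG_manifold]

lemma act_points: "s \<in> carrier G \<Longrightarrow> q \<in> points AQ \<Longrightarrow> \<psi> s q \<in> points AQ"
  using group_action.element_image[OF action] by blast

lemma act_one: "q \<in> points AQ \<Longrightarrow> \<psi> \<one>\<^bsub>G\<^esub> q = q"
  using group_action.id_eq_one[OF action] by (metis restrict_apply')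

lemma one_carrier: "\<one>\<^bsub>G\<^esub> \<in> carrier G"
  using grp by (simp add: group.is_monoid)

lemma \<pi>_act: 
  assumes s: "s \<in> carrier G" and q: "q \<in> points AQ"
  shows "\<pi> (\<psi> s q) = \<pi> q"
proof -
  have comp: "\<psi> t (\<psi> s q) = \<psi> (t \<otimes>\<^bsub>G\<^esub> s) q" if "t \<in> carrier G" for t
    using group_action.composition_rule[OF action q that s] by simp
  have "\<psi> t q \<in> \<pi> (\<psi> s q)" if t: "t \<in> carrier G" for t
  proof -
    have m: "t \<otimes>\<^bsub>G\<^esub> inv\<^bsub>G\<^esub> s \<in> carrier G" using t s grp by (simp add: group.is_monoid monoid.m_closed group.inv_closed)
    have "\<psi> (t \<otimes>\<^bsub>G\<^esub> inv\<^bsub>G\<^esub> s) (\<psi> s q) = \<psi> t q"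
      using comp[OF m] t s grp by (simp add: group.inv_solve_right' monoid.m_assoc group.is_monoid group.l_inv group.inv_closed monoid.r_one)
    moreover have "\<psi> (t \<otimes>\<^bsub>G\<^esub> inv\<^bsub>G\<^esub> s) (\<psi> s q) \<in> \<pi> (\<psi> s q)" using m by (auto simp: orbit_def)
    ultimately show ?thesis by simp
  qed
  moreover have "\<psi> t (\<psi> s q) \<in> \<pi> q" if t: "t \<in> carrier G" for t
    using comp[OF t] t s grp unfolding orbit_def by (auto intro: monoid.m_closed group.is_monoid)
  ultimately show ?thesis unfolding orbit_def by blast
qed

lemma \<pi>_in_x: "q \<in> points AQ \<Longrightarrow> \<pi> q \<in> fst x"
  using smooth_\<pi> x_global by (auto simp: smooth_map_def)

text \<open>The coordinate expression of \<open>(s, q) \<mapsto> sq\<close> in the charts \<open>d\<close> of the group and \<open>c\<close>, \<open>c'\<close> of \<open>Q\<close>. Outside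
  \<open>act_dom\<close> its values are arbitrary.\<close>
definition act_coord :: "('g, real^'k) chart \<Rightarrow> ('q, real^'n) chart \<Rightarrow> ('q, real^'n) chart \<Rightarrow>
    (real^'k) \<times> (real^'n) \<Rightarrow> real^'n" where
  "act_coord d c c' = (\<lambda>z. snd c' (\<psi> (chart_inv d (fst z)) (chart_inv c (snd z))))"

definition act_dom :: "('g, real^'k) chart \<Rightarrow> ('q, real^'n) chart \<Rightarrow> ('q, real^'n) chart \<Rightarrow> ((real^'k) \<times> (real^'n)) set" where
  "act_dom d c c' = (\<lambda>(s, q). (snd d s, snd c q)) ` {(s, q). s \<in> fst d \<and> q \<in> fst c \<and> \<psi> s q \<in> fst c'}"

lemma act_coord_apply: "d \<in> AG \<Longrightarrow> c \<in> AQ \<Longrightarrow> s \<in> fst d \<Longrightarrow> q \<in> fst c \<Longrightarrow> act_coord d c c' (snd d s, snd c q) = snd c' (\<psi> s q)"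
  using chart_inv_left[OF diff_atlas_inj[OF AG]] chart_inv_left[OF diff_atlas_inj[OF AQ]]
  by (simp add: act_coord_def)

lemma act_dom_iff:
  assumes "d \<in> AG" "c \<in> AQ" "s \<in> fst d" "q \<in> fst c"
  shows "(snd d s, snd c q) \<in> act_dom d c c' \<longleftrightarrow> \<psi> s q \<in> fst c'"
proof -
  have "s' = s" if "s' \<in> fst d" "snd d s' = snd d s" for s'
    using diff_atlas_inj[OF AG assms(1)] that assms by (meson inj_onD)
  moreover have "q' = q" if "q' \<in> fst c" "snd c q' = snd c q" for q'
    using diff_atlas_inj[OF AQ assms(2)] that assms by (meson inj_onD)
  ultimately show ?thesis using assms unfolding act_dom_def by force
qed

lemma
  assumes d: "d \<in> AG" and c: "c \<in> AQ" "c' \<in> AQ"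
  shows open_act_dom: "open (act_dom d c c')" and smooth_act_coord: "smooth_on (act_dom d c c') (act_coord d c c')"
proof -
  let ?e = "(fst d \<times> fst c, map_prod (snd d) (snd c))"
  have e: "?e \<in> prod_atlas AG AQ" by (rule prod_atlas_mem[OF d c(1)])
  have im: "snd ?e ` (fst ?e \<inter> (\<lambda>(s, q). \<psi> s q) -` fst c') = act_dom d c c'"
    unfolding act_dom_def by (rule image_cong) auto
  show op: "open (act_dom d c c')" using smooth_map_open[OF smooth_action e c(2)] unfolding im .
  have "smooth_on (act_dom d c c') (snd c' \<circ> (\<lambda>(s, q). \<psi> s q) \<circ> chart_inv ?e)"
    using smooth_map_smooth_on[OF smooth_action e c(2)] unfolding im .
  then show "smooth_on (act_dom d c c') (act_coord d c c')"
  proof (rule smooth_on_cong[OF op])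
    fix z assume "z \<in> act_dom d c c'"
    then obtain s q where "z = (snd d s, snd c q)" "s \<in> fst d" "q \<in> fst c" by (auto simp: act_dom_def)
    then show "(snd c' \<circ> (\<lambda>(s, q). \<psi> s q) \<circ> chart_inv ?e) z = act_coord d c c' z"
      using prod_chart_inv[OF diff_atlas_inj[OF AG d] diff_atlas_inj[OF AQ c(1)]] act_coord_apply[OF d c(1)]
      by simp
  qed
qed

text \<open>In charts a translation is the slice of the action at a fixed group element.\<close>
lemma smooth_map_translation:
  assumes s: "s \<in> carrier G"
  shows "smooth_map AQ AQ (\<psi> s)"
  unfolding smooth_map_def
proof (intro conjI ballI)
  show "\<psi> s ` points AQ \<subseteq> points AQ" using act_points[OF s] by blast
  fix c c' assume c: "c \<in> AQ" "c' \<in> AQ"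
  have "s \<in> points AG" using s AG_points by simp
  then obtain d where d: "d \<in> AG" "s \<in> fst d" by (auto simp: points_def)
  let ?S = "snd c ` (fst c \<inter> \<psi> s -` fst c')"
  have eq: "?S = {y. (snd d s, y) \<in> act_dom d c c'}"
  proof (intro equalityI subsetI)
    fix y assume "y \<in> {y. (snd d s, y) \<in> act_dom d c c'}"
    then obtain s' q where sq: "s' \<in> fst d" "q \<in> fst c" "\<psi> s' q \<in> fst c'" "snd d s' = snd d s" "y = snd c q"
      by (auto simp: act_dom_def)
    then have "s' = s" using diff_atlas_inj[OF AG d(1)] d(2) by (meson inj_onD)
    then show "y \<in> ?S" using sq by blast
  qed (auto simp: act_dom_iff[OF d(1) c(1) d(2)])
  have op: "open (act_dom d c c')" by (rule open_act_dom[OF d(1) c])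
  show S: "open ?S"
    unfolding eq using continuous_open_preimage[of UNIV "\<lambda>y. (snd d s, y)" "act_dom d c c'"] op
    by (simp add: vimage_def continuous_on_Pair)
  have "smooth_on ?S (\<lambda>y. act_coord d c c' ((snd d s, 0) + (0, y)))"
    by (rule smooth_on_compose_affine[OF S _ _ smooth_act_coord[OF d(1) c]])
      (use eq in \<open>auto intro!: bounded_linear_Pair bounded_linear_zero bounded_linear_ident\<close>)
  then show "smooth_on ?S (snd c' \<circ> \<psi> s \<circ> chart_inv c)"
    by (rule smooth_on_cong[OF S])
      (auto simp: act_coord_apply[OF d(1) c(1) d(2)] chart_inv_left[OF diff_atlas_inj[OF AQ c(1)]])
qed

text \<open>In charts an orbit map is the slice of the action at a fixed point.\<close>
lemma smooth_map_orbit: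
  assumes q: "q \<in> points AQ"
  shows "smooth_map AG AQ (\<lambda>s. \<psi> s q)"
  unfolding smooth_map_def
proof (intro conjI ballI)
  show "(\<lambda>s. \<psi> s q) ` points AG \<subseteq> points AQ" using act_points q AG_points by blast
  fix d c' assume d: "d \<in> AG" and c': "c' \<in> AQ"
  obtain c where c: "c \<in> AQ" "q \<in> fst c" using q by (auto simp: points_def)
  let ?S = "snd d ` (fst d \<inter> (\<lambda>s. \<psi> s q) -` fst c')"
  have eq: "?S = {t. (t, snd c q) \<in> act_dom d c c'}"
  proof (intro equalityI subsetI)
    fix y assume "y \<in> {t. (t, snd c q) \<in> act_dom d c c'}"
    then obtain s q' where sq: "s \<in> fst d" "q' \<in> fst c" "\<psi> s q' \<in> fst c'" "snd c q' = snd c q" "y = snd d s"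
      by (auto simp: act_dom_def)
    then have "q' = q" using diff_atlas_inj[OF AQ c(1)] c(2) by (meson inj_onD)
    then show "y \<in> ?S" using sq by blast
  qed (auto simp: act_dom_iff[OF d c(1) _ c(2)])
  have op: "open (act_dom d c c')" by (rule open_act_dom[OF d c(1) c'])
  show S: "open ?S"
    unfolding eq using continuous_open_preimage[of UNIV "\<lambda>t. (t, snd c q)" "act_dom d c c'"] op
    by (simp add: vimage_def continuous_on_Pair)
  have "smooth_on ?S (\<lambda>t. act_coord d c c' ((0, snd c q) + (t, 0)))"
    by (rule smooth_on_compose_affine[OF S _ _ smooth_act_coord[OF d c(1) c']])
      (use eq in \<open>auto intro!: bounded_linear_Pair bounded_linear_zero bounded_linear_ident\<close>)
  then show "smooth_on ?S (snd c' \<circ> (\<lambda>s. \<psi> s q) \<circ> chart_inv d)"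
    by (rule smooth_on_cong[OF S])
      (auto simp: act_coord_apply[OF d c(1) _ c(2)] chart_inv_left[OF diff_atlas_inj[OF AG d]])
qed

section \<open>The coframe dual to horizontal lifts and generators\<close>

lemma E_tangent: "E i \<in> tangent_space AG \<one>\<^bsub>G\<^esub>"
  using E_basis by (simp add: lie_algebra_basis_def)

lemma one_points: "\<one>\<^bsub>G\<^esub> \<in> points AG"
  using one_carrier AG_points by simp

lemma X_sections: "X a \<in> sections AQ \<D>"
  using X_lift by (simp add: horizontal_lift_def)

lemma X_tangent: "q \<in> points AQ \<Longrightarrow> X a q \<in> T q"
  and X_horizontal: "q \<in> points AQ \<Longrightarrow> X a q \<in> \<D> q"
  using X_sections[of a] by (auto simp: sections_def horizontal_def)

lemma generator_tangent: "q \<in> points AQ \<Longrightarrow> E\<^sub>Q i q \<in> T q"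
  unfolding inf_generator_def
  using differential_in_tangent_space[OF AG AQ smooth_map_orbit one_points E_tangent] act_one by metis

lemma generator_chart:
  assumes "q \<in> fst c" "c \<in> AQ" "d \<in> AG" "\<one>\<^bsub>G\<^esub> \<in> fst d"
  shows "E\<^sub>Q i q c = dderiv (snd c \<circ> (\<lambda>s. \<psi> s q) \<circ> chart_inv d) (snd d \<one>\<^bsub>G\<^esub>) (E i d)"
  unfolding inf_generator_def
  using assms in_points[OF assms(2,1)]
  by (intro differential_chart[OF AG AQ smooth_map_orbit one_points E_tangent]) (simp_all add: act_one)

definition \<alpha> :: "'q \<Rightarrow> ('q, real^'n) tvec \<Rightarrow> real^'m" where
  "\<alpha> q u = differential AQ AB \<pi> q u x"

lemma \<alpha>_chart:
  assumes "c \<in> AQ" "q \<in> fst c" "u \<in> T q"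
  shows "\<alpha> q u = dderiv (snd x \<circ> \<pi> \<circ> chart_inv c) (snd c q) (u c)"
  unfolding \<alpha>_def
  using differential_chart[OF AQ AB smooth_\<pi> in_points[OF assms(1,2)] assms(3,1) x_chart assms(2)]
    \<pi>_in_x[OF in_points[OF assms(1,2)]] by simp

lemma \<pi>_has_derivative:
  assumes "c \<in> AQ" "q \<in> fst c"
  shows "((snd x \<circ> \<pi> \<circ> chart_inv c) has_derivative dderiv (snd x \<circ> \<pi> \<circ> chart_inv c) (snd c q)) (at (snd c q))"
  by (rule smooth_map_has_derivative[OF smooth_\<pi> assms(1) x_chart assms(2) \<pi>_in_x[OF in_points[OF assms]]])

lemma \<alpha>_tlin:
  assumes q: "q \<in> points AQ" and u: "u \<in> T q" "w \<in> T q"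
  shows "\<alpha> q (tlin r u s w) = r *\<^sub>R \<alpha> q u + s *\<^sub>R \<alpha> q w"
proof -
  obtain c where c: "c \<in> AQ" "q \<in> fst c" using q by (auto simp: points_def)
  note l = has_derivative_linear[OF \<pi>_has_derivative[OF c]]
  show ?thesis
    using \<alpha>_chart[OF c] u tangent_space_tlin[OF AQ u] 
    by (simp add: tlin_def linear_add[OF l] linear_cmul[OF l])
qed

lemma \<alpha>_X: "q \<in> points AQ \<Longrightarrow> \<alpha> q (X a q) = axis a 1"
  unfolding \<alpha>_def using X_lift coord_vec_chart[OF AB x_chart \<pi>_in_x] by (simp add: horizontal_lift_def)

text \<open>The projection is constant along the orbit map whose differential defines the generator.\<close>
lemma \<alpha>_generator:
  assumes q: "q \<in> points AQ" 
  shows "\<alpha> q (E\<^sub>Q i q) = 0"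
proof -
  obtain c where c: "c \<in> AQ" "q \<in> fst c" using q by (auto simp: points_def)
  obtain d where d: "d \<in> AG" "\<one>\<^bsub>G\<^esub> \<in> fst d" using one_points by (auto simp: points_def)
  let ?D = "\<lambda>u. dderiv (snd x \<circ> \<pi> \<circ> chart_inv c) (snd c q) (dderiv (snd c \<circ> (\<lambda>s. \<psi> s q) \<circ> chart_inv d) (snd d \<one>\<^bsub>G\<^esub>) u)"
  have "((snd x \<circ> (\<pi> \<circ> (\<lambda>s. \<psi> s q)) \<circ> chart_inv d) has_derivative ?D) (at (snd d \<one>\<^bsub>G\<^esub>))"
    using smooth_map_comp_has_derivative[OF AG AQ smooth_map_orbit[OF q] smooth_\<pi> d(1) c(1) x_chart d(2)]
      c(2) \<pi>_in_x[OF q] by (simp add: act_one[OF q])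
  then have "((\<lambda>t. snd x (\<pi> q)) has_derivative ?D) (at (snd d \<one>\<^bsub>G\<^esub>))"
  proof (rule has_derivative_transform_within_open)
    show "open (chart_img d)" by (rule open_chart_img[OF AG d(1)])
    show "snd d \<one>\<^bsub>G\<^esub> \<in> chart_img d" using d by (simp add: chart_img_def)
    fix t assume "t \<in> chart_img d"
    then have "chart_inv d t \<in> carrier G"
      using chart_inv_in[of t d "fst d"] in_points[OF d(1)] AG_points by (auto simp: chart_img_def)
    then show "(snd x \<circ> (\<pi> \<circ> (\<lambda>s. \<psi> s q)) \<circ> chart_inv d) t = snd x (\<pi> q)"
      using \<pi>_act q by simp
  qed
  then have "?D = (\<lambda>_. 0)" using has_derivative_unique has_derivative_const by blast
  then show ?thesis
    unfolding \<alpha>_chart[OF c generator_tangent[OF q]] generator_chart[OF c(2,1) d] by metis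
qed

text \<open>The projection is unchanged by translations, and so is its differential.\<close>
lemma \<alpha>_act:
  assumes s: "s \<in> carrier G" and q: "q \<in> points AQ" and u: "u \<in> T q"
  shows "\<alpha> (\<psi> s q) (differential AQ AQ (\<psi> s) q u) = \<alpha> q u"
proof -
  obtain c where c: "c \<in> AQ" "q \<in> fst c" using q by (auto simp: points_def)
  obtain c' where c': "c' \<in> AQ" "\<psi> s q \<in> fst c'" using act_points[OF s q] by (auto simp: points_def)
  note sm = smooth_map_translation[OF s]
  let ?D = "\<lambda>u. dderiv (snd x \<circ> \<pi> \<circ> chart_inv c') (snd c' (\<psi> s q)) (dderiv (snd c' \<circ> \<psi> s \<circ> chart_inv c) (snd c q) u)"
  have "((snd x \<circ> (\<pi> \<circ> \<psi> s) \<circ> chart_inv c) has_derivative ?D) (at (snd c q))"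
    by (rule smooth_map_comp_has_derivative[OF AQ AQ sm smooth_\<pi> c(1) c'(1) x_chart c(2) c'(2) \<pi>_in_x[OF act_points[OF s q]]])
  then have "((snd x \<circ> \<pi> \<circ> chart_inv c) has_derivative ?D) (at (snd c q))"
  proof (rule has_derivative_transform_within_open)
    show "open (chart_img c)" by (rule open_chart_img[OF AQ c(1)])
    show "snd c q \<in> chart_img c" using c by (simp add: chart_img_def)
    fix t assume "t \<in> chart_img c"
    then have "chart_inv c t \<in> points AQ"
      using chart_inv_in[of t c "fst c"] in_points[OF c(1)] by (auto simp: chart_img_def)
    then show "(snd x \<circ> (\<pi> \<circ> \<psi> s) \<circ> chart_inv c) t = (snd x \<circ> \<pi> \<circ> chart_inv c) t"
      using \<pi>_act[OF s] by simp
  qed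
  from dderiv_eq[OF this, of "u c"] show ?thesis
    unfolding \<alpha>_chart[OF c u] \<alpha>_chart[OF c' differential_in_tangent_space[OF AQ AQ sm q u]]
      differential_chart[OF AQ AQ sm q u c(1) c'(1) c(2) c'(2)] by simp
qed

text \<open>Elements of the Lie algebra are handled through their coordinates in one chart around the identity;
  in these coordinates the basis is an invertible matrix.\<close>
definition "unit_chart = chart_at AG \<one>\<^bsub>G\<^esub>"

definition E_mat :: "real^'k^'k" where "E_mat = (\<chi> j i. E i unit_chart $ j)"

definition \<beta> :: "'q \<Rightarrow> ('q, real^'n) tvec \<Rightarrow> real^'k" where
  "\<beta> q u = matrix_inv E_mat *v \<omega> q u unit_chart"

lemma unit_chart: "unit_chart \<in> AG" "\<one>\<^bsub>G\<^esub> \<in> fst unit_chart"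
  using chart_at[OF one_points] by (simp_all add: unit_chart_def)

lemma E_mat_mult: "E_mat *v y = tcomb (\<lambda>i. y $ i) E unit_chart"
  by (simp add: E_mat_def tcomb_def matrix_vector_mult_def vec_eq_iff mult.commute)

lemma tcomb_E_inj:
  assumes "tcomb (\<lambda>i. y $ i) E = tcomb (\<lambda>i. z $ i) E"
  shows "y = z"
proof -
  have "tcomb (\<lambda>i. y $ i) E \<in> tangent_space AG \<one>\<^bsub>G\<^esub>"
    by (rule tangent_space_tcomb[OF AG E_tangent])
  then have "(\<lambda>i. y $ i) = (\<lambda>i. z $ i)"
    using E_basis assms unfolding lie_algebra_basis_def by metis
  then show ?thesis by (simp add: vec_eq_iff fun_eq_iff)
qed

lemma E_mat_invertible: "invertible E_mat"
proof -
  have "y = 0" if "E_mat *v y = 0" for y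
  proof (rule tcomb_E_inj)
    have t: "tcomb (\<lambda>i. y $ i) E \<in> tangent_space AG \<one>\<^bsub>G\<^esub>" for y :: "real^'k"
      by (rule tangent_space_tcomb[OF AG E_tangent])
    show "tcomb (\<lambda>i. y $ i) E = tcomb (\<lambda>i. 0 $ i) E"
      by (rule tangent_space_eqI[OF t t unit_chart]) (use that E_mat_mult[of y] E_mat_mult[of 0] in simp)
  qed
  then show ?thesis
    unfolding invertible_left_inverse matrix_left_invertible_ker by blast
qed

lemma E_mat_inv: "matrix_inv E_mat *v (E_mat *v y) = y"
proof -
  have "E_mat *v (matrix_inv E_mat *v (E_mat *v y)) = E_mat *v y"
    by (rule matrix_inv_mult_vector[OF E_mat_invertible])
  then show ?thesis
    using E_mat_invertible unfolding invertible_left_inverse matrix_left_invertible_injective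
    by (meson injD)
qed

lemma \<omega>_lie: "q \<in> points AQ \<Longrightarrow> u \<in> T q \<Longrightarrow> \<omega> q u \<in> tangent_space AG \<one>\<^bsub>G\<^esub>"
  using connection unfolding principal_connection_def by blast

lemma \<omega>_tlin: "q \<in> points AQ \<Longrightarrow> u \<in> T q \<Longrightarrow> w \<in> T q \<Longrightarrow> \<omega> q (tlin r u s w) = tlin r (\<omega> q u) s (\<omega> q w)"
  using connection unfolding principal_connection_def by blast

lemma \<omega>_act: "s \<in> carrier G \<Longrightarrow> q \<in> points AQ \<Longrightarrow> u \<in> T q \<Longrightarrow>
   \<omega> (\<psi> s q) (differential AQ AQ (\<psi> s) q u) = Ad G AG s (\<omega> q u)"
  using connection unfolding principal_connection_def by blast

lemma \<omega>_generator: "q \<in> points AQ \<Longrightarrow> \<omega> q (E\<^sub>Q i q) = E i"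
  using connection E_tangent unfolding principal_connection_def by blast

lemma \<beta>_tlin:
  assumes q: "q \<in> points AQ" and u: "u \<in> T q" "w \<in> T q"
  shows "\<beta> q (tlin r u s w) = r *\<^sub>R \<beta> q u + s *\<^sub>R \<beta> q w"
  unfolding \<beta>_def \<omega>_tlin[OF assms]
  by (simp add: tlin_def matrix_vector_right_distrib matrix_vector_mult_scaleR)

lemma \<beta>_generator: "q \<in> points AQ \<Longrightarrow> \<beta> q (E\<^sub>Q i q) = axis i 1"
  using E_mat_inv[of "axis i 1"]
  by (simp add: \<beta>_def \<omega>_generator E_mat_mult tcomb_def axis_def if_distrib[of "\<lambda>r. r *\<^sub>R _"] cong: if_cong)

lemma \<beta>_horizontal: "u \<in> \<D> q \<Longrightarrow> \<beta> q u = 0"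
  by (simp add: \<beta>_def horizontal_def)

lemma \<omega>_eq_\<beta>:
  assumes q: "q \<in> points AQ" and u: "u \<in> T q"
  shows "\<omega> q u = tcomb (\<lambda>i. \<beta> q u $ i) E"
  using \<omega>_lie[OF q u] tangent_space_tcomb[OF AG E_tangent] unit_chart
proof (rule tangent_space_eqI)
  show "\<omega> q u unit_chart = tcomb (\<lambda>i. \<beta> q u $ i) E unit_chart"
    unfolding E_mat_mult[symmetric] \<beta>_def using matrix_inv_mult_vector[OF E_mat_invertible] by simp
qed

lemma \<beta>_zero_horizontal:
  assumes q: "q \<in> points AQ" and u: "u \<in> T q" and z: "\<beta> q u = 0"
  shows "u \<in> \<D> q"
  using \<omega>_eq_\<beta>[OF q u] u z by (simp add: horizontal_def tcomb_def)

text \<open>A local trivialisation identifies an open part of \<open>Q\<close> with an open part of the product of base and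
  group.\<close>
lemma dim_le:
  assumes q: "q \<in> points AQ"
  shows "CARD('n) \<le> CARD('m) + CARD('k)"
proof -
  have "\<pi> q \<in> points AB" using \<pi>_in_x[OF q] x_global by simp
  then obtain U \<tau> where U: "\<pi> q \<in> U"
      "diffeomorphism (restrict_atlas AQ {q \<in> points AQ. \<pi> q \<in> U}) (prod_atlas (restrict_atlas AB U) AG) \<tau>"
    using principal unfolding principal_bundle_def by meson
  have "DIM(real^'n) \<le> DIM((real^'m) \<times> (real^'k))"
  proof (rule diffeomorphism_dim_le[OF U(2)])
    show "inj_on (snd c) (fst c)" if "c \<in> restrict_atlas AQ {q \<in> points AQ. \<pi> q \<in> U}" for c
      using that diff_atlas_inj[OF AQ] inj_on_Int by (fastforce simp: restrict_atlas_def)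
    show "inj_on (snd d) (fst d)" if "d \<in> prod_atlas (restrict_atlas AB U) AG" for d
      using that diff_atlas_inj[OF AB] diff_atlas_inj[OF AG]
      by (fastforce simp: restrict_atlas_def prod_atlas_def intro!: map_prod_inj_on inj_on_Int)
    show "q \<in> points (restrict_atlas AQ {q \<in> points AQ. \<pi> q \<in> U})"
      using q U(1) by (auto simp: restrict_atlas_def points_def)
  qed
  then show ?thesis by simp
qed

lemma frame_comb:
  assumes q: "q \<in> points AQ"
  shows "\<alpha> q (tlin 1 (tcomb a (\<lambda>i. X i q)) 1 (tcomb b (\<lambda>i. E\<^sub>Q i q))) = (\<chi> i. a i)"
    and "\<beta> q (tlin 1 (tcomb a (\<lambda>i. X i q)) 1 (tcomb b (\<lambda>i. E\<^sub>Q i q))) = (\<chi> i. b i)"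
proof -
  have tX: "tcomb a (\<lambda>i. X i q) \<in> T q" by (rule tangent_space_tcomb[OF AQ X_tangent[OF q]])
  have tE: "tcomb b (\<lambda>i. E\<^sub>Q i q) \<in> T q" by (rule tangent_space_tcomb[OF AQ generator_tangent[OF q]])
  have ax: "(\<Sum>i\<in>UNIV. y i *\<^sub>R axis i 1) = (\<chi> i. y i)" for y :: "'j::finite \<Rightarrow> real"
    using vec_eq_sum_axis[of "\<chi> i. y i"] by simp
  show "\<alpha> q (tlin 1 (tcomb a (\<lambda>i. X i q)) 1 (tcomb b (\<lambda>i. E\<^sub>Q i q))) = (\<chi> i. a i)"
    using \<alpha>_tlin[OF q tX tE, of 1 1] tcomb_linear_image[OF AQ, where f="\<alpha> q" and y=a and V="\<lambda>i. X i q", OF \<alpha>_tlin[OF q] X_tangent[OF q]] tcomb_linear_image[OF AQ, where f="\<alpha> q" and y=b and V="\<lambda>i. E\<^sub>Q i q", OF \<alpha>_tlin[OF q] generator_tangent[OF q]]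
    by (simp add: \<alpha>_X[OF q] \<alpha>_generator[OF q] ax)
  show "\<beta> q (tlin 1 (tcomb a (\<lambda>i. X i q)) 1 (tcomb b (\<lambda>i. E\<^sub>Q i q))) = (\<chi> i. b i)"
    using \<beta>_tlin[OF q tX tE, of 1 1] tcomb_linear_image[OF AQ, where f="\<beta> q" and y=a and V="\<lambda>i. X i q", OF \<beta>_tlin[OF q] X_tangent[OF q]] tcomb_linear_image[OF AQ, where f="\<beta> q" and y=b and V="\<lambda>i. E\<^sub>Q i q", OF \<beta>_tlin[OF q] generator_tangent[OF q]]
    by (simp add: \<beta>_horizontal[OF X_horizontal[OF q]] \<beta>_generator[OF q] ax)
qed

text \<open>The linear map \<open>(\<alpha>, \<beta>)\<close> on a tangent space is onto, because it takes the vectors \<open>X\<^sub>a\<close> and \<open>(E\<^sub>i)\<^sub>Q\<close> to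
  the standard basis. The dimension of \<open>Q\<close> does not exceed that of the target, so it is also
  one-to-one.\<close>
lemma coframe_inj:
  assumes q: "q \<in> points AQ" and u: "u \<in> T q" "w \<in> T q" and eq: "\<alpha> q u = \<alpha> q w" "\<beta> q u = \<beta> q w"
  shows "u = w"
proof -
  obtain c where c: "c \<in> AQ" "q \<in> fst c" using q by (auto simp: points_def)
  let ?v = "\<lambda>y. coord_vec AQ c q y"
  define L where "L y = (\<alpha> q (?v y), \<beta> q (?v y))" for y
  have t: "?v y \<in> T q" for y by (rule coord_vec_in_tangent_space[OF AQ c])
  have vlin: "?v (r *\<^sub>R y + s *\<^sub>R z) = tlin r (?v y) s (?v z)" for r s y z
    by (rule tangent_space_eqI[OF t tangent_space_tlin[OF AQ t t] c])
      (simp add: coord_vec_chart[OF AQ c] tlin_def)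
  have lin: "linear L"
  proof (rule linearI)
    show "L (y + z) = L y + L z" for y z
      using vlin[of 1 y 1 z] \<alpha>_tlin[OF q t t, of 1 y 1 z] \<beta>_tlin[OF q t t, of 1 y 1 z] by (simp add: L_def)
    show "L (r *\<^sub>R y) = r *\<^sub>R L y" for r y
      using vlin[of r y 0 y] \<alpha>_tlin[OF q t t, of r y 0 y] \<beta>_tlin[OF q t t, of r y 0 y] by (simp add: L_def)
  qed
  have "surj L"
  proof (rule surjI)
    fix z :: "(real^'m) \<times> (real^'k)"
    let ?w = "tlin 1 (tcomb (\<lambda>i. fst z $ i) (\<lambda>i. X i q)) 1 (tcomb (\<lambda>i. snd z $ i) (\<lambda>i. E\<^sub>Q i q))"
    have "?w \<in> T q"
      by (intro tangent_space_tlin[OF AQ] tangent_space_tcomb[OF AQ] X_tangent[OF q] generator_tangent[OF q])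
    then have "?v (?w c) = ?w" by (rule coord_vec_of_tangent[OF _ c])
    then show "L (?w c) = z" using frame_comb[OF q] by (simp add: L_def)
  qed
  have "DIM((real^'m) \<times> (real^'k)) \<le> DIM(real^'n)"
    using dim_image_le[OF lin, of UNIV] \<open>surj L\<close> by simp
  then have "inj L"
    using linear_surjective_imp_injective[OF lin \<open>surj L\<close>] dim_le[OF q] by simp
  moreover have "L (u c) = L (w c)" unfolding L_def using coord_vec_of_tangent[OF _ c] u eq by simp
  ultimately have "u c = w c" by (simp add: inj_eq)
  then show ?thesis using tangent_space_eqI[OF u c] by simp
qed

lemma frame_expansion:
  assumes q: "q \<in> points AQ" and u: "u \<in> T q"
  shows "u = tlin 1 (tcomb (\<lambda>i. \<alpha> q u $ i) (\<lambda>i. X i q)) 1 (tcomb (\<lambda>i. \<beta> q u $ i) (\<lambda>i. E\<^sub>Q i q))"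
  by (rule coframe_inj[OF q u])
    (simp_all add: frame_comb[OF q] tangent_space_tlin[OF AQ] tangent_space_tcomb[OF AQ] X_tangent[OF q] generator_tangent[OF q])

lemma tcomb_X_tangent: "q \<in> points AQ \<Longrightarrow> tcomb z (\<lambda>a. X a q) \<in> T q"
  by (rule tangent_space_tcomb[OF AQ X_tangent])

lemma \<alpha>_tcomb_X:
  assumes q: "q \<in> points AQ"
  shows "\<alpha> q (tcomb z (\<lambda>a. X a q)) = (\<chi> a. z a)"
  using tcomb_linear_image[OF AQ, where f="\<alpha> q" and y=z and V="\<lambda>i. X i q", OF \<alpha>_tlin[OF q] X_tangent[OF q]]
    vec_eq_sum_axis[of "\<chi> i. z i"] by (simp add: \<alpha>_X[OF q])

lemma tcomb_X_horizontal:
  assumes q: "q \<in> points AQ"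
  shows "tcomb z (\<lambda>a. X a q) \<in> \<D> q"
proof (rule \<beta>_zero_horizontal[OF q tcomb_X_tangent[OF q]])
  show "\<beta> q (tcomb z (\<lambda>a. X a q)) = 0"
    using tcomb_linear_image[OF AQ, where f="\<beta> q" and y=z and V="\<lambda>i. X i q", OF \<beta>_tlin[OF q] X_tangent[OF q]]
    by (simp add: \<beta>_horizontal[OF X_horizontal[OF q]])
qed

lemma horizontal_expansion:
  assumes q: "q \<in> points AQ" and u: "u \<in> \<D> q"
  shows "u = tcomb (\<lambda>a. \<alpha> q u $ a) (\<lambda>a. X a q)"
proof -
  have t: "u \<in> T q" using u by (simp add: horizontal_def)
  show ?thesis
    by (rule coframe_inj[OF q t tcomb_X_tangent[OF q]])
      (simp_all add: \<alpha>_tcomb_X[OF q] \<beta>_horizontal[OF u] \<beta>_horizontal[OF tcomb_X_horizontal[OF q]])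
qed

lemma velocity_coeff_tcomb:
  assumes q: "q \<in> points AQ"
  shows "velocity_coeff X (q, tcomb z (\<lambda>a. X a q)) = z"
  unfolding velocity_coeff_def prod.case
proof (rule the_equality)
  fix y assume "tcomb z (\<lambda>a. X a q) = tcomb y (\<lambda>a. X a q)"
  then have "(\<chi> a. z a) = (\<chi> a. y a)" using \<alpha>_tcomb_X[OF q] by metis
  then show "y = z" by (simp add: vec_eq_iff fun_eq_iff)
qed simp

section \<open>Invariance of the horizontal frame\<close>

end

text \<open>Read \<open>\<Phi>(t, x)\<close> as a group element with coordinates \<open>t\<close> acting on \<open>x\<close>, \<open>t0\<close> as the identity and \<open>W\<close> as
  the generator with direction \<open>\<xi>\<close>. Differentiating the invariance of \<open>X\<close> in \<open>t\<close> produces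
  the mixed second derivative of \<open>\<Phi>\<close> in the directions \<open>\<xi>\<close> and \<open>X\<close>; by symmetry it is also the
  derivative of \<open>W\<close> along \<open>X\<close>. So the Lie bracket of \<open>W\<close> and \<open>X\<close> vanishes at \<open>x0\<close>, without using flows.\<close>
lemma equivariant_field_commutes:
  fixes \<Phi> :: "'k::euclidean_space \<times> 'n::euclidean_space \<Rightarrow> 'n" and X W :: "'n \<Rightarrow> 'n"
  assumes N: "open N" "(t0, x0) \<in> N" and \<Phi>: "Ck_on 2 \<Phi> N" "\<Phi> (t0, x0) = x0"
    and X: "X differentiable at x0"
    and inv: "\<And>t. (t, x0) \<in> N \<Longrightarrow> X (\<Phi> (t, x0)) = dderiv \<Phi> (t, x0) (0, X x0)"
    and W: "\<And>x. (t0, x) \<in> N \<Longrightarrow> W x = dderiv \<Phi> (t0, x) (\<xi>, 0)"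
  shows "W differentiable at x0" and "dderiv W x0 (X x0) = dderiv X x0 (W x0)"
proof -
  have d1: "(\<Phi> has_derivative dderiv \<Phi> z) (at z)" if "z \<in> N" for z
    using \<Phi> that by (auto simp: numeral_2_eq_2 intro: has_derivative_dderiv)
  have d2: "((\<lambda>z. dderiv \<Phi> z u) has_derivative dderiv (\<lambda>z. dderiv \<Phi> z u) z) (at z)" if "z \<in> N" for z u
    using \<Phi> that by (intro has_derivative_dderiv) (cases u, simp add: numeral_2_eq_2)
  have pt: "((\<lambda>t. (t, x0)) has_derivative (\<lambda>\<tau>. (\<tau>, 0))) (at t0)"
    by (intro has_derivative_Pair has_derivative_ident has_derivative_const)
  have px: "((\<lambda>x. (t0, x)) has_derivative (\<lambda>u. (0, u))) (at x0)"
    by (intro has_derivative_Pair has_derivative_ident has_derivative_const)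
  have opt: "open {t. (t, x0) \<in> N}"
    using continuous_open_preimage[of UNIV "\<lambda>t. (t, x0)" N] N
    by (simp add: vimage_def continuous_on_Pair)
  have opx: "open {x. (t0, x) \<in> N}"
    using continuous_open_preimage[of UNIV "\<lambda>x. (t0, x)" N] N
    by (simp add: vimage_def continuous_on_Pair)
  have "((\<lambda>x. dderiv \<Phi> (t0, x) (\<xi>, 0)) has_derivative
    (\<lambda>u. dderiv (\<lambda>z. dderiv \<Phi> z (\<xi>, 0)) (t0, x0) (0, u))) (at x0)"
    by (rule has_derivative_compose[OF px d2[OF N(2)]])
  then have W': "(W has_derivative (\<lambda>u. dderiv (\<lambda>z. dderiv \<Phi> z (\<xi>, 0)) (t0, x0) (0, u))) (at x0)"
    by (rule has_derivative_transform_within_open[OF _ opx]) (use N W in auto)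
  then show "W differentiable at x0" unfolding differentiable_def by blast
  have c1: "((\<lambda>t. \<Phi> (t, x0)) has_derivative (\<lambda>\<tau>. dderiv \<Phi> (t0, x0) (\<tau>, 0))) (at t0)"
    by (rule has_derivative_compose[OF pt d1[OF N(2)]])
  have c2: "(X has_derivative dderiv X x0) (at (\<Phi> (t0, x0)))"
    using has_derivative_dderiv[OF X] \<Phi>(2) by simp
  have "((\<lambda>t. X (\<Phi> (t, x0))) has_derivative (\<lambda>\<tau>. dderiv X x0 (dderiv \<Phi> (t0, x0) (\<tau>, 0)))) (at t0)"
    by (rule has_derivative_compose[OF c1 c2])
  then have "((\<lambda>t. dderiv \<Phi> (t, x0) (0, X x0)) has_derivative
      (\<lambda>\<tau>. dderiv X x0 (dderiv \<Phi> (t0, x0) (\<tau>, 0)))) (at t0)"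
    by (rule has_derivative_transform_within_open[OF _ opt]) (use N inv in auto)
  moreover have "((\<lambda>t. dderiv \<Phi> (t, x0) (0, X x0)) has_derivative
      (\<lambda>\<tau>. dderiv (\<lambda>z. dderiv \<Phi> z (0, X x0)) (t0, x0) (\<tau>, 0))) (at t0)"
    by (rule has_derivative_compose[OF pt d2[OF N(2)]])
  ultimately have "dderiv X x0 (dderiv \<Phi> (t0, x0) (\<xi>, 0)) = dderiv (\<lambda>z. dderiv \<Phi> z (0, X x0)) (t0, x0) (\<xi>, 0)"
    using has_derivative_unique by metis
  also have "\<dots> = dderiv (\<lambda>z. dderiv \<Phi> z (\<xi>, 0)) (t0, x0) (0, X x0)"
    by (rule symmetric_second_dderiv[OF N \<Phi>(1)])
  finally show "dderiv W x0 (X x0) = dderiv X x0 (W x0)"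
    using dderiv_eq[OF W'] W[OF N(2)] by simp
qed

context chaplygin_frame
begin

text \<open>Both sides are horizontal and have the same projection. Horizontality of the right-hand side needs
  that the adjoint action fixes zero, which follows from equivariance of \<open>\<omega>\<close> on the zero vector.\<close>
lemma X_equivariant:
  assumes s: "s \<in> carrier G" and q: "q \<in> points AQ"
  shows "X a (\<psi> s q) = differential AQ AQ (\<psi> s) q (X a q)"
proof (rule coframe_inj[OF act_points[OF s q] X_tangent[OF act_points[OF s q]]])
  note sm = smooth_map_translation[OF s]
  have d: "differential AQ AQ (\<psi> s) q u \<in> T (\<psi> s q)" if "u \<in> T q" for u
    by (rule differential_in_tangent_space[OF AQ AQ sm q that])
  show "differential AQ AQ (\<psi> s) q (X a q) \<in> T (\<psi> s q)" by (rule d[OF X_tangent[OF q]])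
  show "\<alpha> (\<psi> s q) (X a (\<psi> s q)) = \<alpha> (\<psi> s q) (differential AQ AQ (\<psi> s) q (X a q))"
    using \<alpha>_act[OF s q X_tangent[OF q]] \<alpha>_X[OF q] \<alpha>_X[OF act_points[OF s q]] by simp
  note Z = zero_in_tangent_space[OF AQ, of q]
  obtain c where c: "c \<in> AQ" "q \<in> fst c" using q by (auto simp: points_def)
  obtain c' where c': "c' \<in> AQ" "\<psi> s q \<in> fst c'" using act_points[OF s q] by (auto simp: points_def)
  have "differential AQ AQ (\<psi> s) q (\<lambda>_. 0) = (\<lambda>_. 0)"
    by (rule tangent_space_eqI[OF d[OF Z] zero_in_tangent_space[OF AQ] c'])
      (simp add: differential_chart[OF AQ AQ sm q Z c(1) c'(1) c(2) c'(2)]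
         linear_0[OF has_derivative_linear[OF smooth_map_has_derivative[OF sm c(1) c'(1) c(2) c'(2)]]])
  moreover have \<omega>0: "\<omega> p (\<lambda>_. 0) = (\<lambda>_. 0)" if "p \<in> points AQ" for p
    using \<omega>_tlin[OF that zero_in_tangent_space[OF AQ] zero_in_tangent_space[OF AQ], of 0 0] by (simp add: tlin_def)
  ultimately have "Ad G AG s (\<lambda>_. 0) = (\<lambda>_. 0)"
    using \<omega>_act[OF s q Z] \<omega>0[OF q] \<omega>0[OF act_points[OF s q]] by simp
  then have "\<omega> (\<psi> s q) (differential AQ AQ (\<psi> s) q (X a q)) = (\<lambda>_. 0)"
    using \<omega>_act[OF s q X_tangent[OF q]] X_horizontal[OF q, of a] by (simp add: horizontal_def)
  then show "\<beta> (\<psi> s q) (X a (\<psi> s q)) = \<beta> (\<psi> s q) (differential AQ AQ (\<psi> s) q (X a q))"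
    using \<beta>_horizontal[OF X_horizontal[OF act_points[OF s q]]] by (simp add: \<beta>_def)
qed

lemma metric_X_invariant:
  assumes s: "s \<in> carrier G" and q: "q \<in> points AQ"
  shows "g (\<psi> s q) (X a (\<psi> s q)) (X b (\<psi> s q)) = g q (X a q) (X b q)"
  using inv_metric X_tangent[OF q] s q unfolding X_equivariant[OF assms] invariant_metric_def by blast

definition X_coord :: "('q, real^'n) chart \<Rightarrow> 'm \<Rightarrow> real^'n \<Rightarrow> real^'n" where
  "X_coord c a y = X a (chart_inv c y) c"

definition E_coord :: "('q, real^'n) chart \<Rightarrow> 'k \<Rightarrow> real^'n \<Rightarrow> real^'n" where
  "E_coord c i y = E\<^sub>Q i (chart_inv c y) c"

text \<open>The matrix \<open>G\<^sub>a\<^sub>b\<close> of the metric that \<open>g\<close> induces on the horizontal vectors. It is constant on orbits and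
  hence comes from a metric on the base.\<close>
definition base_metric :: "'q \<Rightarrow> real^'m^'m" where
  "base_metric q = (\<chi> a b. g q (X a q) (X b q))"

lemma chart_inv_AQ: "c \<in> AQ \<Longrightarrow> q \<in> fst c \<Longrightarrow> chart_inv c (snd c q) = q"
  by (rule chart_inv_left[OF diff_atlas_inj[OF AQ]])

lemma smooth_X_coord: "c \<in> AQ \<Longrightarrow> smooth_on (chart_img c) (X_coord c a)"
  using X_sections[of a] unfolding sections_def vector_field_def X_coord_def by blast

lemma
  assumes c: "c \<in> AQ" "q \<in> fst c"
  shows E_coord_differentiable: "E_coord c i differentiable at (snd c q)"
    and E_coord_commutes: "dderiv (E_coord c i) (snd c q) (X_coord c a (snd c q)) = dderiv (X_coord c a) (snd c q) (E_coord c i (snd c q))"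
proof -
  let ?N = "act_dom unit_chart c c" and ?\<Phi> = "act_coord unit_chart c c" and ?t = "snd unit_chart \<one>\<^bsub>G\<^esub>" and ?y = "snd c q"
  have q: "q \<in> points AQ" by (rule in_points[OF c])
  have N: "open ?N" "(?t, ?y) \<in> ?N"
    using open_act_dom[OF unit_chart(1) c(1) c(1)] act_dom_iff[OF unit_chart(1) c(1) unit_chart(2) c(2)] act_one[OF q] c by simp_all
  have sm: "smooth_on ?N ?\<Phi>" by (rule smooth_act_coord[OF unit_chart(1) c(1) c(1)])
  have C2: "Ck_on 2 ?\<Phi> ?N" using sm unfolding smooth_on_def by blast
  have val: "?\<Phi> (?t, ?y) = ?y" using act_coord_apply[OF unit_chart(1) c(1) unit_chart(2) c(2)] act_one[OF q] by simp
  have hd: "(?\<Phi> has_derivative dderiv ?\<Phi> z) (at z)" if "z \<in> ?N" for z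
    by (intro has_derivative_dderiv smooth_on_differentiable[OF sm that])
  have Xd: "X_coord c a differentiable at ?y" for a
    by (rule smooth_on_differentiable[OF smooth_X_coord[OF c(1)]]) (use c in \<open>simp add: chart_img_def\<close>)
  have inv: "X_coord c a (?\<Phi> (t, ?y)) = dderiv ?\<Phi> (t, ?y) (0, X_coord c a ?y)" if t: "(t, ?y) \<in> ?N" for t a
  proof -
    obtain s q' where s: "s \<in> fst unit_chart" "q' \<in> fst c" "\<psi> s q' \<in> fst c" "t = snd unit_chart s" "?y = snd c q'"
      using t by (auto simp: act_dom_def)
    then have q': "q' = q" using chart_inv_AQ c by metis
    have sc: "\<psi> s q \<in> fst c" using s(3) unfolding q' .
    have sG: "s \<in> carrier G" using in_points[OF unit_chart(1) s(1)] AG_points by simp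
    have feq: "snd c \<circ> \<psi> s \<circ> chart_inv c = (\<lambda>y. ?\<Phi> (t, y))"
      using chart_inv_left[OF diff_atlas_inj[OF AG unit_chart(1)] s(1)] s(4) by (simp add: fun_eq_iff act_coord_def)
    have "((\<lambda>y. (t, y)) has_derivative (\<lambda>u. (0, u))) (at ?y)"
      by (intro has_derivative_Pair has_derivative_ident has_derivative_const)
    from has_derivative_compose[OF this hd[OF t]]
    have d: "((\<lambda>y. ?\<Phi> (t, y)) has_derivative (\<lambda>u. dderiv ?\<Phi> (t, ?y) (0, u))) (at ?y)" .
    have "?\<Phi> (t, ?y) = snd c (\<psi> s q)"
      using act_coord_apply[OF unit_chart(1) c(1) s(1) c(2)] s(4) by simp
    then have "X_coord c a (?\<Phi> (t, ?y)) = X a (\<psi> s q) c"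
      using chart_inv_AQ[OF c(1) sc] by (simp add: X_coord_def)
    also have "\<dots> = differential AQ AQ (\<psi> s) q (X a q) c"
      by (simp add: X_equivariant[OF sG q])
    also have "\<dots> = dderiv (snd c \<circ> \<psi> s \<circ> chart_inv c) ?y (X a q c)"
      by (rule differential_chart[OF AQ AQ smooth_map_translation[OF sG] q X_tangent[OF q] c(1) c(1) c(2) sc])
    also have "\<dots> = dderiv ?\<Phi> (t, ?y) (0, X_coord c a ?y)"
      unfolding feq dderiv_eq[OF d] using chart_inv_AQ[OF c] by (simp add: X_coord_def)
    finally show ?thesis .
  qed
  have W: "E_coord c i y = dderiv ?\<Phi> (?t, y) (E i unit_chart, 0)" if y: "(?t, y) \<in> ?N" for y
  proof -
    obtain q' where q': "q' \<in> fst c" "y = snd c q'" using y by (auto simp: act_dom_def)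
    have feq: "snd c \<circ> (\<lambda>s. \<psi> s q') \<circ> chart_inv unit_chart = (\<lambda>t. ?\<Phi> (t, y))"
      using chart_inv_AQ[OF c(1) q'(1)] q'(2) by (simp add: fun_eq_iff act_coord_def)
    have "((\<lambda>t. (t, y)) has_derivative (\<lambda>\<tau>. (\<tau>, 0))) (at ?t)"
      by (intro has_derivative_Pair has_derivative_ident has_derivative_const)
    from has_derivative_compose[OF this hd[OF y]]
    have d: "((\<lambda>t. ?\<Phi> (t, y)) has_derivative (\<lambda>\<tau>. dderiv ?\<Phi> (?t, y) (\<tau>, 0))) (at ?t)" .
    show ?thesis
      unfolding E_coord_def q'(2) chart_inv_AQ[OF c(1) q'(1)] generator_chart[OF q'(1) c(1) unit_chart]
      using feq dderiv_eq[OF d] q'(2) by simp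
  qed
  show "E_coord c i differentiable at ?y"
    by (rule equivariant_field_commutes(1)[OF N C2 val Xd inv W])
  show "dderiv (E_coord c i) ?y (X_coord c a ?y) = dderiv (X_coord c a) ?y (E_coord c i ?y)"
    by (rule equivariant_field_commutes(2)[OF N C2 val Xd inv W])
qed

lemma base_metric_chart:
  assumes c: "c \<in> AQ" and y: "y \<in> chart_img c"
  shows "base_metric (chart_inv c y) $ a $ b = X_coord c a y \<bullet> (metric_mat AQ g c y *v X_coord c b y)"
proof -
  obtain q where q: "q \<in> fst c" "y = snd c q" using chart_img_cases[OF y] .
  show ?thesis
    using riemannian_metric_in_chart[OF AQ metric c q(1) X_tangent X_tangent] in_points[OF c q(1)] chart_inv_AQ[OF c q(1)]
    by (simp add: q(2) base_metric_def X_coord_def)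
qed

lemma smooth_metric: "c \<in> AQ \<Longrightarrow> smooth_on (chart_img c) (metric_mat AQ g c)"
  using metric by (simp add: riemannian_metric_def)

lemma smooth_base_metric:
  assumes c: "c \<in> AQ"
  shows "smooth_on (chart_img c) (\<lambda>y. base_metric (chart_inv c y))"
proof -
  note op = open_chart_img[OF AQ c]
  have "smooth_on (chart_img c) (\<lambda>y. \<chi> a b. X_coord c a y \<bullet> (metric_mat AQ g c y *v X_coord c b y))"
    by (intro smooth_on_vec_lambda smooth_on_inner smooth_on_matrix_vector_mult op smooth_X_coord smooth_metric c)
  then show ?thesis
    by (rule smooth_on_cong[OF op]) (simp add: vec_eq_iff base_metric_chart[OF c])
qed

lemma base_metric_differentiable:
  assumes c: "c \<in> AQ" "q \<in> fst c"
  shows "(\<lambda>y. base_metric (chart_inv c y) $ a $ b) differentiable at (snd c q)"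
  by (rule smooth_on_differentiable[OF smooth_on_nth[OF _ smooth_on_nth[OF _ smooth_base_metric]]])
    (use c open_chart_img[OF AQ] in \<open>auto simp: chart_img_def\<close>)

text \<open>The matrix is constant along the orbit map through \<open>q\<close>, whose differential at the identity gives the
  generator.\<close>
lemma base_metric_invariant:
  assumes c: "c \<in> AQ" "q \<in> fst c"
  shows "dderiv (\<lambda>y. base_metric (chart_inv c y) $ a $ b) (snd c q) (E_coord c i (snd c q)) = 0"
proof -
  have q: "q \<in> points AQ" by (rule in_points[OF c])
  let ?f = "snd c \<circ> (\<lambda>s. \<psi> s q) \<circ> chart_inv unit_chart" and ?F = "\<lambda>y. base_metric (chart_inv c y) $ a $ b"
  let ?t = "snd unit_chart \<one>\<^bsub>G\<^esub>" and ?S = "snd unit_chart ` (fst unit_chart \<inter> (\<lambda>s. \<psi> s q) -` fst c)"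
  have one: "\<psi> \<one>\<^bsub>G\<^esub> q \<in> fst c" using act_one[OF q] c by simp
  have f: "(?f has_derivative dderiv ?f ?t) (at ?t)"
    using smooth_map_has_derivative[OF smooth_map_orbit[OF q] unit_chart(1) c(1) unit_chart(2)] one by simp
  have val: "?f ?t = snd c q"
    using chart_inv_left[OF diff_atlas_inj[OF AG unit_chart(1)] unit_chart(2)] act_one[OF q] by simp
  have F: "(?F has_derivative dderiv ?F (snd c q)) (at (?f ?t))"
    unfolding val by (intro has_derivative_dderiv base_metric_differentiable c)
  have "((\<lambda>t. ?F (?f t)) has_derivative (\<lambda>\<tau>. dderiv ?F (snd c q) (dderiv ?f ?t \<tau>))) (at ?t)"
    by (rule has_derivative_compose[OF f F])
  then have "((\<lambda>t. base_metric q $ a $ b) has_derivative (\<lambda>\<tau>. dderiv ?F (snd c q) (dderiv ?f ?t \<tau>))) (at ?t)"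
  proof (rule has_derivative_transform_within_open)
    show "open ?S" by (rule smooth_map_open[OF smooth_map_orbit[OF q] unit_chart(1) c(1)])
    show "?t \<in> ?S" using unit_chart(2) one by blast
    fix t assume "t \<in> ?S"
    then obtain s where s: "s \<in> fst unit_chart" "\<psi> s q \<in> fst c" "t = snd unit_chart s" by auto
    have "s \<in> carrier G" using in_points[OF unit_chart(1) s(1)] AG_points by simp
    then show "?F (?f t) = base_metric q $ a $ b"
      using chart_inv_left[OF diff_atlas_inj[OF AG unit_chart(1)] s(1)] chart_inv_AQ[OF c(1) s(2)] s(3) 
        metric_X_invariant q by (simp add: base_metric_def)
  qed
  then have "(\<lambda>\<tau>. dderiv ?F (snd c q) (dderiv ?f ?t \<tau>)) = (\<lambda>_. 0)"
    using has_derivative_unique has_derivative_const by blast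
  moreover have "E_coord c i (snd c q) = dderiv ?f ?t (E i unit_chart)"
    unfolding E_coord_def chart_inv_AQ[OF c] by (rule generator_chart[OF c(2,1) unit_chart])
  ultimately show ?thesis by metis
qed

section \<open>Derivatives on the constraint submanifold\<close>

abbreviation "TQ \<equiv> tangent_atlas AQ"
abbreviation "\<C> \<equiv> constraint_set AQ \<D>"

lemmas TQ = diff_atlas_tangent_atlas[OF AQ_manifold]

lemma lift_chart_TQ: "c \<in> AQ \<Longrightarrow> lift_chart AQ c \<in> TQ"
  by (simp add: tangent_atlas_def)

lemma tcomb_X_coords:
  assumes c: "c \<in> AQ" and y: "y \<in> chart_img c"
  shows "coord_vec AQ c (chart_inv c y) (\<Sum>a\<in>UNIV. z a *\<^sub>R X_coord c a y) = tcomb z (\<lambda>a. X a (chart_inv c y))"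
proof -
  obtain q where q: "q \<in> fst c" "y = snd c q" using chart_img_cases[OF y] .
  have "tcomb z (\<lambda>a. X a q) c = (\<Sum>a\<in>UNIV. z a *\<^sub>R X_coord c a y)"
    using chart_inv_AQ[OF c q(1)] by (simp add: tcomb_def X_coord_def q(2))
  then show ?thesis
    using coord_vec_of_tangent[OF tcomb_X_tangent c q(1), of z] in_points[OF c q(1)] chart_inv_AQ[OF c q(1)] q(2)
    by metis
qed

text \<open>The map \<open>P(y, z) = (y, \<Sum>\<^sub>a z\<^sub>a X\<^sub>a(y))\<close> parametrises the constraint submanifold, and the
  coordinates of \<open>w\<close> are those of its derivative along \<open>(u, \<zeta>)\<close>. Near the point, any local extension of \<open>f\<close>
  composed with \<open>P\<close> is \<open>f\<close> in terms of \<open>y\<close> and \<open>z\<close>, so the derivative does not depend on the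
  extension.\<close>
lemma deriv_at_extension:
  fixes f :: "'q \<times> ('q, real^'n) tvec \<Rightarrow> real"
  assumes c: "c \<in> AQ" "q \<in> fst c"
    and F: "local_extension TQ \<C> f (q, tcomb z (\<lambda>a. X a q)) F"
    and w: "w \<in> tangent_space TQ (q, tcomb z (\<lambda>a. X a q))"
    and wc: "w (lift_chart AQ c) = (u, \<Sum>a\<in>UNIV. z a *\<^sub>R dderiv (X_coord c a) (snd c q) u + \<zeta> a *\<^sub>R X_coord c a (snd c q))"
    and \<phi>: "((\<lambda>(y, z :: real^'m). f (chart_inv c y, tcomb (\<lambda>a. z $ a) (\<lambda>a. X a (chart_inv c y)))) has_derivative \<phi>')
      (at (snd c q, \<chi> a. z a))"
  shows "deriv_at TQ F (q, tcomb z (\<lambda>a. X a q)) w = \<phi>' (u, \<chi> a. \<zeta> a)"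
proof -
  let ?l = "lift_chart AQ c" and ?p = "(q, tcomb z (\<lambda>a. X a q))" and ?y = "snd c q"
  let ?\<phi> = "\<lambda>(y, z :: real^'m). f (chart_inv c y, tcomb (\<lambda>a. z $ a) (\<lambda>a. X a (chart_inv c y)))"
  define P where "P = (\<lambda>(y, z :: real^'m). (y, \<Sum>a\<in>UNIV. z $ a *\<^sub>R X_coord c a y))"
  define P' where "P' = (\<lambda>(dy, dz :: real^'m). (dy, \<Sum>a\<in>UNIV. z a *\<^sub>R dderiv (X_coord c a) ?y dy + dz $ a *\<^sub>R X_coord c a ?y))"
  have q: "q \<in> points AQ" by (rule in_points[OF c])
  have yc: "?y \<in> chart_img c" using c by (simp add: chart_img_def)
  have l: "?l \<in> TQ" by (rule lift_chart_TQ[OF c(1)])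
  have pl: "?p \<in> fst ?l" using c tcomb_X_tangent[OF q] by simp
  have lp: "snd ?l ?p = P (?y, \<chi> a. z a)"
    using chart_inv_AQ[OF c] by (simp add: P_def tcomb_def X_coord_def)
  have injl: "inj_on (snd ?l) (fst ?l)" by (rule diff_atlas_inj[OF TQ l])
  obtain U where U: "openin (manifold_top TQ) U" "?p \<in> U" "smooth_fun (restrict_atlas TQ U) F"
      "\<forall>z\<in>U \<inter> \<C>. F z = f z"
    using F unfolding local_extension_def by blast
  let ?S = "snd ?l ` (fst ?l \<inter> U)"
  have S: "open ?S" using U(1) l openin_manifold_top[OF diff_atlas_inj[OF TQ]] by blast
  have pS: "snd ?l ?p \<in> ?S" using pl U(2) by blast
  have "(fst ?l \<inter> U, snd ?l) \<in> restrict_atlas TQ U" using l by (auto simp: restrict_atlas_def)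
  then have smF: "smooth_on ?S (F \<circ> chart_inv (fst ?l \<inter> U, snd ?l))"
    using U(3) unfolding smooth_fun_def by (fastforce simp: chart_img_def)
  have "(F \<circ> chart_inv ?l) differentiable at (snd ?l ?p)"
  proof (rule differentiable_cong_open[OF S pS smooth_on_differentiable[OF smF pS]])
    fix y assume "y \<in> ?S"
    then obtain r where r: "r \<in> fst ?l \<inter> U" "y = snd ?l r" by blast
    have "chart_inv (fst ?l \<inter> U, snd ?l) (snd (fst ?l \<inter> U, snd ?l) r) = r"
      by (rule chart_inv_left) (use injl r in \<open>auto intro: inj_on_Int\<close>)
    moreover have "chart_inv ?l (snd ?l r) = r" by (rule chart_inv_left[OF injl]) (use r in simp)
    ultimately show "(F \<circ> chart_inv (fst ?l \<inter> U, snd ?l)) y = (F \<circ> chart_inv ?l) y"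
      using r by simp
  qed
  note Fd = this
  have 1: "deriv_at TQ F ?p w = dderiv (F \<circ> chart_inv ?l) (snd ?l ?p) (w ?l)"
    by (rule deriv_at_chart[OF TQ l pl w Fd])
  have P: "(P has_derivative P') (at (?y, \<chi> a. z a))"
  proof -
    have X': "((\<lambda>r. X_coord c a (fst r)) has_derivative (\<lambda>d. dderiv (X_coord c a) ?y (fst d))) (at (?y, \<chi> a. z a))" for a
      by (rule has_derivative_compose_fst[OF smooth_on_differentiable[OF smooth_X_coord[OF c(1)] yc]])
    have Z': "((\<lambda>r. snd r $ a) has_derivative (\<lambda>d. snd d $ a)) (at (?y, \<chi> a. z a))" for a
      by (rule bounded_linear_imp_has_derivative) (rule bounded_linear_compose[OF bounded_linear_vec_nth bounded_linear_snd])
    have "((\<lambda>r. (fst r, \<Sum>a\<in>UNIV. snd r $ a *\<^sub>R X_coord c a (fst r))) has_derivative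
       (\<lambda>d. (fst d, \<Sum>a\<in>UNIV. snd (?y, \<chi> a. z a) $ a *\<^sub>R dderiv (X_coord c a) ?y (fst d) + snd d $ a *\<^sub>R X_coord c a (fst (?y, \<chi> a. z a)))))
       (at (?y, \<chi> a. z a))"
      by (intro has_derivative_Pair has_derivative_sum has_derivative_scaleR X' Z'
          bounded_linear_imp_has_derivative[OF bounded_linear_fst])
    then show ?thesis by (simp add: P_def P'_def case_prod_beta' )
  qed
  have F': "((F \<circ> chart_inv ?l) has_derivative dderiv (F \<circ> chart_inv ?l) (snd ?l ?p)) (at (P (?y, \<chi> a. z a)))"
    unfolding lp[symmetric] by (rule has_derivative_dderiv[OF Fd])
  have comp: "((\<lambda>r. (F \<circ> chart_inv ?l) (P r)) has_derivative (\<lambda>d. dderiv (F \<circ> chart_inv ?l) (snd ?l ?p) (P' d))) (at (?y, \<chi> a. z a))"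
    by (rule has_derivative_compose[OF P F'])
  have eq: "(F \<circ> chart_inv ?l) (P r) = ?\<phi> r" if r: "fst r \<in> chart_img c" "P r \<in> ?S" for r
  proof -
    obtain y z' where yz: "r = (y, z')" by fastforce
    obtain q' where q': "q' \<in> fst c" "y = snd c q'" using chart_img_cases r(1) yz by (metis fst_conv)
    have q'p: "chart_inv c y \<in> points AQ" using q' chart_inv_AQ[OF c(1)] in_points[OF c(1)] by simp
    have eqr: "chart_inv ?l (P r) = (chart_inv c y, tcomb (\<lambda>a. z' $ a) (\<lambda>a. X a (chart_inv c y)))"
      using chart_inv_lift_chart[OF AQ c(1)] tcomb_X_coords[OF c(1)] r(1) by (simp add: P_def yz)
    have "chart_inv ?l (P r) \<in> U" using chart_inv_mem_iff[OF injl r(2)] by blast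
    moreover have "chart_inv ?l (P r) \<in> \<C>"
      unfolding eqr using tcomb_X_horizontal[OF q'p] q'p by (simp add: constraint_set_def)
    ultimately show ?thesis using U(4) eqr yz by simp
  qed
  have "isCont P (?y, \<chi> a. z a)" by (rule has_derivative_continuous[OF P])
  then have tend: "(P \<longlongrightarrow> P (?y, \<chi> a. z a)) (at (?y, \<chi> a. z a))" by (simp add: isCont_def)
  have "\<forall>\<^sub>F r in at (?y, \<chi> a. z a). P r \<in> ?S"
    using topological_tendstoD[OF tend S] pS lp by simp
  moreover have "\<forall>\<^sub>F r in at (?y, \<chi> a. z a). fst r \<in> chart_img c"
    using topological_tendstoD[OF tendsto_fst[OF tendsto_ident_at[of "(?y, \<chi> a. z a)" UNIV]] open_chart_img[OF AQ c(1)]] yc by simp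
  ultimately have "\<forall>\<^sub>F r in at (?y, \<chi> a. z a). (F \<circ> chart_inv ?l) (P r) = ?\<phi> r"
    by eventually_elim (use eq in blast)
  then have "(?\<phi> has_derivative (\<lambda>d. dderiv (F \<circ> chart_inv ?l) (snd ?l ?p) (P' d))) (at (?y, \<chi> a. z a))"
  proof (rule has_derivative_transform_eventually[OF comp])
    show "(F \<circ> chart_inv ?l) (P (?y, \<chi> a. z a)) = ?\<phi> (?y, \<chi> a. z a)"
      by (rule eq) (use yc pS lp in simp_all)
  qed simp
  then have "\<phi>' = (\<lambda>d. dderiv (F \<circ> chart_inv ?l) (snd ?l ?p) (P' d))"
    using \<phi> has_derivative_unique by blast
  moreover have "w ?l = P' (u, \<chi> a. \<zeta> a)" by (simp add: wc P'_def)
  ultimately show ?thesis using 1 by simp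
qed

text \<open>The existence of one local extension is essential: without it the derivative on the submanifold,
  a definite description, would have no meaning.\<close>
lemma deriv_on_constraint:
  fixes f :: "'q \<times> ('q, real^'n) tvec \<Rightarrow> real"
  assumes c: "c \<in> AQ" "q \<in> fst c"
    and F: "local_extension TQ \<C> f (q, tcomb z (\<lambda>a. X a q)) F"
    and w: "w \<in> tangent_space TQ (q, tcomb z (\<lambda>a. X a q))"
    and wc: "w (lift_chart AQ c) = (u, \<Sum>a\<in>UNIV. z a *\<^sub>R dderiv (X_coord c a) (snd c q) u + \<zeta> a *\<^sub>R X_coord c a (snd c q))"
    and \<phi>: "((\<lambda>(y, z :: real^'m). f (chart_inv c y, tcomb (\<lambda>a. z $ a) (\<lambda>a. X a (chart_inv c y)))) has_derivative \<phi>')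
      (at (snd c q, \<chi> a. z a))"
  shows "deriv_on TQ \<C> f (q, tcomb z (\<lambda>a. X a q)) w = \<phi>' (u, \<chi> a. \<zeta> a)"
  unfolding deriv_on_def
proof (rule the_equality)
  show "\<exists>F. local_extension TQ \<C> f (q, tcomb z (\<lambda>a. X a q)) F \<and>
    deriv_at TQ F (q, tcomb z (\<lambda>a. X a q)) w = \<phi>' (u, \<chi> a. \<zeta> a)"
    using F deriv_at_extension[OF c F w wc \<phi>] by blast
qed (use deriv_at_extension[OF c _ w wc \<phi>] in blast)

section \<open>The Lagrangian and its momenta\<close>

lemma lagrangian_chart:
  assumes c: "c \<in> AQ" and y: "y \<in> chart_img c"
  shows "lagrangian g (chart_inv (lift_chart AQ c) (y, u)) = u \<bullet> (metric_mat AQ g c y *v u) / 2"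
proof -
  obtain q where q: "q \<in> fst c" "y = snd c q" using chart_img_cases[OF y] .
  have t: "coord_vec AQ c q u \<in> T q" by (rule coord_vec_in_tangent_space[OF AQ c q(1)])
  have "lagrangian g (chart_inv (lift_chart AQ c) (y, u)) = g q (coord_vec AQ c q u) (coord_vec AQ c q u) / 2"
    using chart_inv_lift_chart[OF AQ c y] chart_inv_AQ[OF c q(1)] by (simp add: lagrangian_def q(2))
  then show ?thesis
    using riemannian_metric_in_chart[OF AQ metric c q(1) t t] coord_vec_chart[OF AQ c q(1)] by (simp add: q(2))
qed

lemma metric_sym: "q \<in> points AQ \<Longrightarrow> u \<in> T q \<Longrightarrow> w \<in> T q \<Longrightarrow> g q u w = g q w u"
  using metric unfolding riemannian_metric_def by blast

lemma metric_tlin: "q \<in> points AQ \<Longrightarrow> u \<in> T q \<Longrightarrow> w \<in> T q \<Longrightarrow> v \<in> T q \<Longrightarrow>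
  g q (tlin r u s w) v = r * g q u v + s * g q w v"
  using metric unfolding riemannian_metric_def by blast

lemma deriv_lagrangian:
  assumes c: "c \<in> AQ" "q \<in> fst c" and v: "v \<in> T q"
    and w: "w \<in> tangent_space TQ (q, v)" and wc: "w (lift_chart AQ c) = (a, b)"
  shows "deriv_at TQ (lagrangian g) (q, v) w =
    b \<bullet> (metric_mat AQ g c (snd c q) *v v c) + v c \<bullet> (dderiv (metric_mat AQ g c) (snd c q) a *v v c) / 2"
proof -
  let ?l = "lift_chart AQ c" and ?h = "metric_mat AQ g c" and ?y = "snd c q"
  let ?S = "chart_img c \<times> (UNIV :: (real^'n) set)"
  have y: "?y \<in> chart_img c" using c by (simp add: chart_img_def)
  have S: "open ?S" "(?y, v c) \<in> ?S" using open_chart_img[OF AQ c(1)] y by (auto intro: open_Times)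
  have hf: "((\<lambda>r. ?h (fst r)) has_derivative (\<lambda>d. dderiv ?h ?y (fst d))) (at (?y, v c))"
    by (rule has_derivative_compose_fst[OF metric_mat_differentiable[OF metric c]])
  have sn: "(snd has_derivative snd) (at (?y, v c))"
    by (rule bounded_linear_imp_has_derivative[OF bounded_linear_snd])
  have "((\<lambda>r. snd r \<bullet> (?h (fst r) *v snd r)) has_derivative
     (\<lambda>d. snd d \<bullet> (?h ?y *v v c) + v c \<bullet> (dderiv ?h ?y (fst d) *v v c) + v c \<bullet> (?h ?y *v snd d))) (at (?y, v c))"
    using has_derivative_quadratic[of "\<lambda>r. ?h (fst r)" "(?y, v c)" snd snd] hf sn
      dderiv_eq[OF hf] dderiv_eq[OF sn] unfolding differentiable_def by auto
  then have "((\<lambda>r. (1/2) * (snd r \<bullet> (?h (fst r) *v snd r))) has_derivative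
     (\<lambda>d. (1/2) * (snd d \<bullet> (?h ?y *v v c) + v c \<bullet> (dderiv ?h ?y (fst d) *v v c) + v c \<bullet> (?h ?y *v snd d)))) (at (?y, v c))"
    by (rule has_derivative_mult_right)
  then have hd: "((lagrangian g \<circ> chart_inv ?l) has_derivative
     (\<lambda>d. (1/2) * (snd d \<bullet> (?h ?y *v v c) + v c \<bullet> (dderiv ?h ?y (fst d) *v v c) + v c \<bullet> (?h ?y *v snd d)))) (at (?y, v c))"
    by (rule has_derivative_transform_within_open[OF _ S]) (auto simp: lagrangian_chart[OF c(1)])
  have "deriv_at TQ (lagrangian g) (q, v) w = dderiv (lagrangian g \<circ> chart_inv ?l) (snd ?l (q, v)) (w ?l)"
    by (rule deriv_at_chart[OF TQ lift_chart_TQ[OF c(1)] _ w])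
      (use c v hd in \<open>auto simp: differentiable_def\<close>)
  also have "\<dots> = (1/2) * (b \<bullet> (?h ?y *v v c) + v c \<bullet> (dderiv ?h ?y a *v v c) + v c \<bullet> (?h ?y *v b))"
    using dderiv_eq[OF hd] wc by simp
  also have "v c \<bullet> (?h ?y *v b) = b \<bullet> (?h ?y *v v c)" by (rule metric_mat_form_sym[OF AQ metric c(1) y])
  finally show ?thesis by (simp add: field_simps)
qed

lemma
  assumes q: "q \<in> points AQ" and v: "v \<in> T q"
  shows vertical_lift_tangent: "vertical_lift AQ Y (q, v) \<in> tangent_space TQ (q, v)"
    and vertical_lift_chart: "vertical_lift AQ Y (q, v) (lift_chart AQ (chart_at AQ q)) = (0, Y q (chart_at AQ q))"
    and complete_lift_tangent: "complete_lift AQ Y (q, v) \<in> tangent_space TQ (q, v)"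
    and complete_lift_chart: "complete_lift AQ Y (q, v) (lift_chart AQ (chart_at AQ q)) =
      (Y q (chart_at AQ q), dderiv (\<lambda>y. Y (chart_inv (chart_at AQ q) y) (chart_at AQ q)) (snd (chart_at AQ q) q) (v (chart_at AQ q)))"
proof -
  have c: "lift_chart AQ (chart_at AQ q) \<in> TQ" "(q, v) \<in> fst (lift_chart AQ (chart_at AQ q))"
    using chart_at[OF q] v lift_chart_TQ by auto
  show "vertical_lift AQ Y (q, v) \<in> tangent_space TQ (q, v)" "complete_lift AQ Y (q, v) \<in> tangent_space TQ (q, v)"
    "vertical_lift AQ Y (q, v) (lift_chart AQ (chart_at AQ q)) = (0, Y q (chart_at AQ q))"
    "complete_lift AQ Y (q, v) (lift_chart AQ (chart_at AQ q)) =
      (Y q (chart_at AQ q), dderiv (\<lambda>y. Y (chart_inv (chart_at AQ q) y) (chart_at AQ q)) (snd (chart_at AQ q) q) (v (chart_at AQ q)))"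
    using coord_vec_in_tangent_space[OF TQ c] coord_vec_chart[OF TQ c]
    by (simp_all add: vertical_lift_def complete_lift_def Let_def)
qed

text \<open>Along the vertical lift of \<open>Y\<close> only the velocity varies, with direction \<open>Y\<close>; the result is the momentum
  \<open>g(v, Y)\<close>.\<close>
lemma deriv_lagrangian_vertical:
  assumes q: "q \<in> points AQ" and v: "v \<in> T q" and Y: "Y q \<in> T q"
  shows "deriv_at TQ (lagrangian g) (q, v) (vertical_lift AQ Y (q, v)) = g q v (Y q)"
proof -
  let ?c = "chart_at AQ q"
  have c: "?c \<in> AQ" "q \<in> fst ?c" using chart_at[OF q] by auto
  have 0: "dderiv (metric_mat AQ g ?c) (snd ?c q) 0 = 0"
    by (rule linear_0[OF dderiv_linear[OF metric_mat_differentiable[OF metric c]]])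
  have "deriv_at TQ (lagrangian g) (q, v) (vertical_lift AQ Y (q, v)) = Y q ?c \<bullet> (metric_mat AQ g ?c (snd ?c q) *v v ?c)"
    using deriv_lagrangian[OF c v vertical_lift_tangent[OF q v] vertical_lift_chart[OF q v], of Y] by (simp add: 0)
  also have "\<dots> = g q (Y q) v"
    using riemannian_metric_in_chart[OF AQ metric c Y v] by simp
  finally show ?thesis using metric_sym[OF q Y v] by simp
qed

text \<open>The momentum \<open>g(v, Y)\<close> is a smooth function on the whole tangent bundle, so it serves as a global
  extension of the function that occurs in the nonholonomic equations.\<close>
lemma momentum_extension:
  assumes Y: "vector_field AQ Y" and p: "p \<in> \<C>"
  shows "local_extension TQ \<C> (\<lambda>z. deriv_at TQ (lagrangian g) z (vertical_lift AQ Y z)) p (\<lambda>(q, u). g q u (Y q))"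
  unfolding local_extension_def
proof (intro exI[of _ "points TQ"] conjI ballI)
  have YT: "Y q \<in> T q" if "q \<in> points AQ" for q using Y that by (simp add: vector_field_def)
  show "openin (manifold_top TQ) (points TQ)" by (rule openin_points[OF TQ])
  show "p \<in> points TQ"
  proof -
    obtain q v where pq: "p = (q, v)" "q \<in> points AQ" "v \<in> T q"
      using p by (auto simp: constraint_set_def horizontal_def)
    then show ?thesis
      using in_points[OF lift_chart_TQ, of "chart_at AQ q" p] chart_at[OF pq(2)] by simp
  qed
  show "smooth_fun (restrict_atlas TQ (points TQ)) (\<lambda>(q, u). g q u (Y q))"
    unfolding restrict_atlas_points smooth_fun_def tangent_atlas_def
  proof (intro ballI)
    fix l assume "l \<in> lift_chart AQ ` AQ"
    then obtain c where c: "c \<in> AQ" and l: "l = lift_chart AQ c" by blast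
    let ?S = "chart_img c \<times> (UNIV :: (real^'n) set)"
    note op = open_chart_img[OF AQ c]
    have S: "open ?S" using op by (intro open_Times) auto
    have smY: "smooth_on (chart_img c) (\<lambda>y. Y (chart_inv c y) c)"
      using Y c by (simp add: vector_field_def)
    have "smooth_on (chart_img c) (\<lambda>y. metric_mat AQ g c y *v Y (chart_inv c y) c)"
      by (rule smooth_on_matrix_vector_mult[OF op smooth_metric[OF c] smY])
    then have "smooth_on ?S (\<lambda>r. snd r \<bullet> (metric_mat AQ g c (fst r) *v Y (chart_inv c (fst r)) c))"
      by (intro smooth_on_inner S smooth_on_bounded_linear[OF S bounded_linear_snd smooth_on_ident]
          smooth_on_compose_fst[OF S, of "chart_img c" "\<lambda>y. metric_mat AQ g c y *v Y (chart_inv c y) c"]) auto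
    then show "smooth_on (chart_img l) ((\<lambda>(q, u). g q u (Y q)) \<circ> chart_inv l)"
      unfolding l chart_img_lift_chart[OF AQ c]
    proof (rule smooth_on_cong[OF S])
      fix r assume "r \<in> ?S"
      then obtain y u where r: "r = (y, u)" "y \<in> chart_img c" by auto
      obtain q where q: "q \<in> fst c" "y = snd c q" using chart_img_cases[OF r(2)] .
      have qp: "q \<in> points AQ" by (rule in_points[OF c q(1)])
      have t: "coord_vec AQ c q u \<in> T q" by (rule coord_vec_in_tangent_space[OF AQ c q(1)])
      show "snd r \<bullet> (metric_mat AQ g c (fst r) *v Y (chart_inv c (fst r)) c)
         = ((\<lambda>(q, u). g q u (Y q)) \<circ> chart_inv (lift_chart AQ c)) r"
        using chart_inv_lift_chart[OF AQ c r(2), of u] chart_inv_AQ[OF c q(1)] riemannian_metric_in_chart[OF AQ metric c q(1) t YT[OF qp]]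
          coord_vec_chart[OF AQ c q(1)] r(1) by (simp add: q(2))
    qed
  qed
  fix z assume "z \<in> points TQ \<inter> \<C>"
  then obtain q v where z: "z = (q, v)" "q \<in> points AQ" "v \<in> T q"
    by (auto simp: constraint_set_def horizontal_def)
  then show "(\<lambda>(q, u). g q u (Y q)) z = deriv_at TQ (lagrangian g) z (vertical_lift AQ Y z)"
    using deriv_lagrangian_vertical[of q v Y, OF z(2,3) YT[OF z(2)]] by simp
qed

section \<open>The extended metric\<close>

lemma \<alpha>_zero: "q \<in> points AQ \<Longrightarrow> \<alpha> q (\<lambda>_. 0) = 0"
  using \<alpha>_tlin[OF _ zero_in_tangent_space[OF AQ] zero_in_tangent_space[OF AQ], of q 0 0] by (simp add: tlin_def)

lemma metric_tcomb_X:
  assumes q: "q \<in> points AQ" and w: "w \<in> T q"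
  shows "g q (tcomb z (\<lambda>a. X a q)) w = (\<Sum>a\<in>UNIV. z a * g q (X a q) w)"
  using tcomb_linear_image[OF AQ, where f="\<lambda>u. g q u w" and y=z and V="\<lambda>i. X i q" and q=q]
    metric_tlin[OF q _ _ w] X_tangent[OF q] by simp

lemma base_metric_sym: "q \<in> points AQ \<Longrightarrow> base_metric q $ a $ b = base_metric q $ b $ a"
  using metric_sym X_tangent by (simp add: base_metric_def)

lemma base_metric_positive:
  assumes q: "q \<in> points AQ" and z: "z \<noteq> 0"
  shows "z \<bullet> (base_metric q *v z) > 0"
proof -
  let ?u = "tcomb (\<lambda>a. z $ a) (\<lambda>a. X a q)"
  have u: "?u \<in> T q" by (rule tcomb_X_tangent[OF q])
  have "?u \<noteq> (\<lambda>_. 0)" using \<alpha>_tcomb_X[OF q, of "\<lambda>a. z $ a"] \<alpha>_zero[OF q] z by auto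
  then have "g q ?u ?u > 0" using metric u q unfolding riemannian_metric_def by blast
  also have "g q ?u ?u = (\<Sum>a\<in>UNIV. z $ a * g q ?u (X a q))"
    using metric_tcomb_X[OF q u] metric_sym[OF q u X_tangent[OF q]] by simp
  also have "\<dots> = (\<Sum>a\<in>UNIV. \<Sum>b\<in>UNIV. base_metric q $ a $ b * z $ a * z $ b)"
    using metric_tcomb_X[OF q X_tangent[OF q]] metric_sym[OF q X_tangent[OF q] X_tangent[OF q]]
    by (simp add: base_metric_def sum_distrib_left mult_ac)
  finally show ?thesis by (simp add: mat_form_expand)
qed

lemma base_metric_invertible:
  assumes q: "q \<in> points AQ"
  shows "invertible (base_metric q)"
  unfolding invertible_left_inverse matrix_left_invertible_ker
  using base_metric_positive[OF q] by force

text \<open>The horizontal components of a vector whose \<open>g\<close>-products with the \<open>X\<^sub>a\<close> are \<open>\<mu>\<^sub>a\<^sub>k\<close>.\<close>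
definition mixed_shift :: "('m \<Rightarrow> 'k \<Rightarrow> 'q \<Rightarrow> real) \<Rightarrow> 'q \<Rightarrow> 'k \<Rightarrow> real^'m" where
  "mixed_shift \<mu> q k = matrix_inv (base_metric q) *v (\<chi> a. \<mu> a k q)"

text \<open>The forms that complete the square: a metric with mixed components \<open>\<mu>\<close> is \<open>G\<^sub>a\<^sub>b \<theta>\<^sup>a \<theta>\<^sup>b\<close> plus a form in
  \<open>\<beta>\<close> alone.\<close>
definition \<theta> :: "('m \<Rightarrow> 'k \<Rightarrow> 'q \<Rightarrow> real) \<Rightarrow> 'q \<Rightarrow> ('q, real^'n) tvec \<Rightarrow> real^'m" where
  "\<theta> \<mu> q u = \<alpha> q u + (\<Sum>k\<in>UNIV. \<beta> q u $ k *\<^sub>R mixed_shift \<mu> q k)"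

definition extended_metric :: "('m \<Rightarrow> 'k \<Rightarrow> 'q \<Rightarrow> real) \<Rightarrow> ('q, real^'n) metric" where
  "extended_metric \<mu> q u w = \<theta> \<mu> q u \<bullet> (base_metric q *v \<theta> \<mu> q w) + \<beta> q u \<bullet> \<beta> q w"

lemma \<theta>_tlin:
  assumes "q \<in> points AQ" "u \<in> T q" "w \<in> T q"
  shows "\<theta> \<mu> q (tlin r u s w) = r *\<^sub>R \<theta> \<mu> q u + s *\<^sub>R \<theta> \<mu> q w"
  unfolding \<theta>_def \<alpha>_tlin[OF assms] \<beta>_tlin[OF assms]
  by (simp add: scaleR_add_left scaleR_add_right sum.distrib scaleR_sum_right)

lemma \<theta>_X: "q \<in> points AQ \<Longrightarrow> \<theta> \<mu> q (X a q) = axis a 1"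
  by (simp add: \<theta>_def \<alpha>_X \<beta>_horizontal[OF X_horizontal])

lemma \<theta>_generator: "q \<in> points AQ \<Longrightarrow> \<theta> \<mu> q (E\<^sub>Q i q) = mixed_shift \<mu> q i"
  by (simp add: \<theta>_def \<alpha>_generator \<beta>_generator axis_def if_distrib[of "\<lambda>r. r *\<^sub>R _"] cong: if_cong)

lemma extended_metric_X_X: "q \<in> points AQ \<Longrightarrow> extended_metric \<mu> q (X a q) (X b q) = base_metric q $ a $ b"
  by (simp add: extended_metric_def \<theta>_X \<beta>_horizontal[OF X_horizontal] axis_inner_mult)

lemma extended_metric_X_generator: "q \<in> points AQ \<Longrightarrow> extended_metric \<mu> q (X a q) (E\<^sub>Q i q) = \<mu> a i q"
  by (simp add: extended_metric_def \<theta>_X \<theta>_generator \<beta>_horizontal[OF X_horizontal] mixed_shift_def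
      matrix_inv_mult_vector[OF base_metric_invertible] inner_axis')

lemma base_metric_form_sym:
  assumes "q \<in> points AQ"
  shows "z \<bullet> (base_metric q *v w) = w \<bullet> (base_metric q *v z)"
  unfolding mat_form_expand by (subst sum.swap) (simp add: base_metric_sym[OF assms, of _ _] mult_ac)

lemma smooth_\<alpha>:
  assumes c: "c \<in> AQ"
  shows "smooth_on (chart_img c) (\<lambda>y. \<alpha> (chart_inv c y) (coord_vec AQ c (chart_inv c y) u))"
proof -
  have eq: "snd c ` (fst c \<inter> \<pi> -` fst x) = chart_img c"
    using \<pi>_in_x in_points[OF c] by (auto simp: chart_img_def)
  have "smooth_on (chart_img c) (snd x \<circ> \<pi> \<circ> chart_inv c)"
    using smooth_map_smooth_on[OF smooth_\<pi> c x_chart] unfolding eq .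
  then have "smooth_on (chart_img c) (\<lambda>y. dderiv (snd x \<circ> \<pi> \<circ> chart_inv c) y u)"
    by (rule smooth_on_dderiv)
  then show ?thesis
  proof (rule smooth_on_cong[OF open_chart_img[OF AQ c]])
    fix y assume y: "y \<in> chart_img c"
    obtain q where q: "q \<in> fst c" "y = snd c q" using chart_img_cases[OF y] .
    show "dderiv (snd x \<circ> \<pi> \<circ> chart_inv c) y u = \<alpha> (chart_inv c y) (coord_vec AQ c (chart_inv c y) u)"
      using \<alpha>_chart[OF c q(1) coord_vec_in_tangent_space[OF AQ c q(1)]] coord_vec_chart[OF AQ c q(1)] chart_inv_AQ[OF c q(1)]
      by (simp add: q(2))
  qed
qed

lemma smooth_\<beta>:
  assumes c: "c \<in> AQ"
  shows "smooth_on (chart_img c) (\<lambda>y. \<beta> (chart_inv c y) (coord_vec AQ c (chart_inv c y) u))"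
proof -
  have "smooth_on (chart_img c) (\<lambda>y. \<omega> (chart_inv c y) (coord_vec AQ c (chart_inv c y) u) unit_chart)"
    using connection c unit_chart unfolding principal_connection_def by blast
  then show ?thesis
    unfolding \<beta>_def by (rule smooth_on_linear[OF open_chart_img[OF AQ c] matrix_vector_mul_linear])
qed

text \<open>Positivity: if \<open>\<beta>\<close> does not vanish on \<open>u\<close>, the second summand is positive; otherwise \<open>\<theta> = \<alpha>\<close> on \<open>u\<close>, and
  \<open>\<alpha>\<close> does not vanish because \<open>(\<alpha>, \<beta>)\<close> is one-to-one. Smoothness of \<open>\<theta>\<close> rests on the
  smooth dependence of solutions of linear systems on the matrix.\<close>
lemma riemannian_extended_metric:
  assumes \<mu>: "\<forall>a i. smooth_fun AQ (\<mu> a i)"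
  shows "riemannian_metric AQ (extended_metric \<mu>)"
  unfolding riemannian_metric_def
proof (intro conjI ballI impI allI)
  fix q u w assume q: "q \<in> points AQ" and u: "u \<in> T q" and w: "w \<in> T q"
  show "extended_metric \<mu> q u w = extended_metric \<mu> q w u"
    unfolding extended_metric_def using base_metric_form_sym[OF q] inner_commute by metis
  show "extended_metric \<mu> q u u > 0" if nz: "u \<noteq> (\<lambda>_. 0)"
  proof (cases "\<beta> q u = 0")
    case True
    have b0: "\<beta> q (\<lambda>_. 0) = 0"
      using \<beta>_tlin[OF q zero_in_tangent_space[OF AQ] zero_in_tangent_space[OF AQ], of 0 0] by (simp add: tlin_def)
    have "\<alpha> q u \<noteq> 0"
      using coframe_inj[OF q u zero_in_tangent_space[OF AQ]] nz True b0 \<alpha>_zero[OF q] by auto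
    then show ?thesis using base_metric_positive[OF q] True by (simp add: extended_metric_def \<theta>_def)
  next
    case False
    have "\<theta> \<mu> q u \<bullet> (base_metric q *v \<theta> \<mu> q u) \<ge> 0"
      using base_metric_positive[OF q, of "\<theta> \<mu> q u"] by (cases "\<theta> \<mu> q u = 0") auto
    then show ?thesis using False by (simp add: extended_metric_def add_nonneg_pos)
  qed
  fix v r s assume v: "v \<in> T q"
  show "extended_metric \<mu> q (tlin r u s w) v = r * extended_metric \<mu> q u v + s * extended_metric \<mu> q w v"
    unfolding extended_metric_def \<theta>_tlin[OF q u w] \<beta>_tlin[OF q u w]
    by (simp add: inner_add_left algebra_simps)
next
  fix c assume c: "c \<in> AQ"
  note op = open_chart_img[OF AQ c]
  have sm_\<mu>: "smooth_on (chart_img c) (\<lambda>y. \<mu> a k (chart_inv c y))" for a k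
    using \<mu> c by (simp add: smooth_fun_def comp_def)
  have inv: "invertible (base_metric (chart_inv c y))" if "y \<in> chart_img c" for y
  proof -
    obtain q where "q \<in> fst c" "y = snd c q" using chart_img_cases[OF \<open>y \<in> chart_img c\<close>] .
    then show ?thesis using base_metric_invertible[OF in_points[OF c]] chart_inv_AQ[OF c] by simp
  qed
  have sm_S: "smooth_on (chart_img c) (\<lambda>y. mixed_shift \<mu> (chart_inv c y) k)" for k
    unfolding mixed_shift_def
    by (intro smooth_on_matrix_inv_mult op smooth_base_metric[OF c] smooth_on_vec_lambda sm_\<mu> inv)
  have sm_\<theta>: "smooth_on (chart_img c) (\<lambda>y. \<theta> \<mu> (chart_inv c y) (coord_vec AQ c (chart_inv c y) u))" for u
    unfolding \<theta>_def
    by (intro smooth_on_add smooth_on_sum smooth_on_scaleR smooth_on_nth op smooth_\<alpha>[OF c] smooth_\<beta>[OF c] sm_S)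
  have "smooth_on (chart_img c) (\<lambda>y. \<chi> i j. extended_metric \<mu> (chart_inv c y)
     (coord_vec AQ c (chart_inv c y) (axis i 1)) (coord_vec AQ c (chart_inv c y) (axis j 1)))"
    unfolding extended_metric_def
    by (intro smooth_on_vec_lambda smooth_on_add smooth_on_inner smooth_on_matrix_vector_mult
       op sm_\<theta> smooth_\<beta>[OF c] smooth_base_metric[OF c])
  then show "smooth_on (chart_img c) (metric_mat AQ (extended_metric \<mu>) c)"
    by (simp add: metric_mat_def[abs_def] Let_def)
qed

end

section \<open>Comparison of the equations of motion\<close>

locale chaplygin_integrals = chaplygin_frame G AG AQ AB \<psi> g \<omega> x X E
  for G :: "('g, 'z) monoid_scheme"
    and AG :: "('g, real^'k::finite) atlas"
    and AQ :: "('q, real^'n::finite) atlas"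
    and AB :: "('q set, real^'m::finite) atlas"
    and \<psi> :: "'g \<Rightarrow> 'q \<Rightarrow> 'q"
    and g :: "('q, real^'n) metric"
    and \<omega> :: "'q \<Rightarrow> ('q, real^'n) tvec \<Rightarrow> ('g, real^'k) tvec"
    and x :: "('q set, real^'m) chart"
    and X :: "'m \<Rightarrow> 'q \<Rightarrow> ('q, real^'n) tvec"
    and E :: "'k \<Rightarrow> ('g, real^'k) tvec" +
  fixes B :: "'k \<Rightarrow> 'm \<Rightarrow> 'm \<Rightarrow> 'q \<Rightarrow> real"
    and \<Gamma> :: "'q \<times> ('q, real^'n) tvec \<Rightarrow> ('q, real^'n) ttvec"
    and \<mu> :: "'m \<Rightarrow> 'k \<Rightarrow> 'q \<Rightarrow> real"
  assumes bracket: "\<forall>q\<in>points AQ. \<forall>a b.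
           lie_bracket AQ (X a) (X b) q = tcomb (\<lambda>j. B j a b q) (\<lambda>j. inf_generator G AG AQ \<psi> (E j) q)"
    and nonholonomic: "nonholonomic_field AQ (lagrangian g) (horizontal AQ \<omega>) X \<Gamma>"
    and smooth_\<mu>: "\<forall>a i. smooth_fun AQ (\<mu> a i)"
    and integral: "\<forall>i. first_integral AQ (horizontal AQ \<omega>) \<Gamma>
           (\<lambda>p. \<Sum>a\<in>UNIV. \<mu> a i (fst p) * velocity_coeff X p a)"
    and compat: "\<forall>p\<in>constraint_set AQ (horizontal AQ \<omega>). \<forall>c.
           (\<Sum>k\<in>UNIV. \<Sum>a\<in>UNIV. (\<Sum>a\<in>UNIV. \<mu> a k (fst p) * velocity_coeff X p a) * B k a c (fst p) * velocity_coeff X p a) =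
           (\<Sum>a\<in>UNIV. \<Sum>b\<in>UNIV. \<Sum>k\<in>UNIV.
              g (fst p) (X b (fst p)) (inf_generator G AG AQ \<psi> (E k) (fst p)) * B k a c (fst p) * velocity_coeff X p b * velocity_coeff X p a)"
begin

lemma \<mu>_differentiable:
  assumes c: "c \<in> AQ" "q \<in> fst c"
  shows "(\<lambda>y. \<mu> a i (chart_inv c y)) differentiable at (snd c q)"
  by (rule smooth_on_differentiable[of "chart_img c"])
    (use smooth_\<mu> c in \<open>auto simp: smooth_fun_def comp_def chart_img_def\<close>)

lemma X_coord_differentiable:
  assumes c: "c \<in> AQ" "q \<in> fst c"
  shows "X_coord c a differentiable at (snd c q)"
  by (rule smooth_on_differentiable[OF smooth_X_coord[OF c(1)]]) (use c in \<open>simp add: chart_img_def\<close>)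

lemma X_coord_at: "c \<in> AQ \<Longrightarrow> q \<in> fst c \<Longrightarrow> X_coord c a (snd c q) = X a q c"
  and E_coord_at: "c \<in> AQ \<Longrightarrow> q \<in> fst c \<Longrightarrow> E_coord c i (snd c q) = E\<^sub>Q i q c"
  by (simp_all add: X_coord_def E_coord_def chart_inv_AQ)

text \<open>Here \<open>\<zeta>\<close> are the unknown coefficients \<open>f\<^sup>a\<close> of the vertical lifts in \<open>\<Gamma>\<close>. The first family of
  equations is the nonholonomic equation for the section \<open>X\<^sub>b\<close>, whose momentum is \<open>v\<^sup>a G\<^sub>a\<^sub>b\<close>; the second
  is the conservation of \<open>\<mu>\<^sub>i = \<mu>\<^sub>a\<^sub>i v\<^sup>a\<close>. Both functions are linear in the velocities.\<close>
lemma nonholonomic_in_chart: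
  assumes q: "q \<in> points AQ" and v: "v = tcomb z (\<lambda>a. X a q)"
    and c: "c = chart_at AQ q" and y: "y = snd c q"
  obtains \<zeta> where
    "\<Gamma> (q, v) = coord_vec TQ (lift_chart AQ c) (q, v)
       (v c, \<Sum>a\<in>UNIV. z a *\<^sub>R dderiv (X_coord c a) y (v c) + \<zeta> a *\<^sub>R X_coord c a y)"
    "\<forall>b. (\<Sum>a\<in>UNIV. z a * dderiv (\<lambda>y. base_metric (chart_inv c y) $ a $ b) y (v c) + \<zeta> a * base_metric q $ a $ b) =
      dderiv (X_coord c b) y (v c) \<bullet> (metric_mat AQ g c y *v v c)
        + v c \<bullet> (dderiv (metric_mat AQ g c) y (X_coord c b y) *v v c) / 2"
    "\<forall>i. (\<Sum>a\<in>UNIV. z a * dderiv (\<lambda>y. \<mu> a i (chart_inv c y)) y (v c) + \<zeta> a * \<mu> a i q) = 0"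
proof -
  let ?l = "lift_chart AQ c" and ?p = "(q, v)"
  have cA: "c \<in> AQ" "q \<in> fst c" using chart_at[OF q] by (simp_all add: c)
  have yc: "y \<in> chart_img c" using cA by (simp add: chart_img_def y)
  have vD: "v \<in> \<D> q" unfolding v by (rule tcomb_X_horizontal[OF q])
  have vT: "v \<in> T q" using vD by (simp add: horizontal_def)
  have pC: "?p \<in> \<C>" using q vD by (simp add: constraint_set_def)
  have vel: "velocity_coeff X ?p = z" unfolding v by (rule velocity_coeff_tcomb[OF q])
  have l: "?l \<in> TQ" "?p \<in> fst ?l" using lift_chart_TQ[OF cA(1)] cA vT by auto
  obtain f where f: "\<Gamma> ?p = tlin 1 (tcomb (velocity_coeff X ?p) (\<lambda>a. complete_lift AQ (X a) ?p))
                            1 (tcomb (f ?p) (\<lambda>a. vertical_lift AQ (X a) ?p))"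
    and NH: "\<And>Y. Y \<in> sections AQ \<D> \<Longrightarrow>
        deriv_on TQ \<C> (\<lambda>z. deriv_at TQ (lagrangian g) z (vertical_lift AQ Y z)) ?p (\<Gamma> ?p)
        = deriv_at TQ (lagrangian g) ?p (complete_lift AQ Y ?p)"
    using nonholonomic pC unfolding nonholonomic_field_def Let_def by force
  define \<zeta> where "\<zeta> = f ?p"
  let ?F = "\<Sum>a\<in>UNIV. z a *\<^sub>R dderiv (X_coord c a) y (v c) + \<zeta> a *\<^sub>R X_coord c a y"
  have \<Gamma>T: "\<Gamma> ?p \<in> tangent_space TQ ?p"
    unfolding f by (intro tangent_space_tlin[OF TQ] tangent_space_tcomb[OF TQ]
        complete_lift_tangent[OF q vT] vertical_lift_tangent[OF q vT])
  have X_coord_eta: "(\<lambda>y. X a (chart_inv c y) c) = X_coord c a" for a by (simp add: X_coord_def fun_eq_iff)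
  have \<Gamma>c: "\<Gamma> ?p ?l = (v c, ?F)"
  proof -
    have "\<Gamma> ?p ?l = (\<Sum>a\<in>UNIV. z a *\<^sub>R (X a q c, dderiv (X_coord c a) y (v c))) + (\<Sum>a\<in>UNIV. \<zeta> a *\<^sub>R (0, X a q c))"
      using complete_lift_chart[OF q vT] vertical_lift_chart[OF q vT]
      by (simp add: f vel tlin_def tcomb_def \<zeta>_def c[symmetric] X_coord_eta y del: scaleR_Pair)
    also have "\<dots> = ((\<Sum>a\<in>UNIV. z a *\<^sub>R X a q c), ?F)"
      by (simp add: prod_eq_iff fst_sum snd_sum sum.distrib X_coord_at[OF cA] y)
    finally show ?thesis by (simp add: v tcomb_def)
  qed
  have 1: "\<Gamma> ?p = coord_vec TQ ?l ?p (v c, ?F)"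
    using coord_vec_of_tangent[OF \<Gamma>T l] \<Gamma>c by simp
  have zz: "(\<lambda>a. (\<chi> a. z a) $ a) = z" by simp
  have chart_point: "chart_inv c y' \<in> points AQ" if "y' \<in> chart_img c" for y'
    using that chart_inv_AQ[OF cA(1)] in_points[OF cA(1)] by (auto simp: chart_img_def)
  have op: "open (chart_img c)" by (rule open_chart_img[OF AQ cA(1)])
  have 2: "(\<Sum>a\<in>UNIV. z a * dderiv (\<lambda>y. base_metric (chart_inv c y) $ a $ b) y (v c) + \<zeta> a * base_metric q $ a $ b) =
      dderiv (X_coord c b) y (v c) \<bullet> (metric_mat AQ g c y *v v c)
        + v c \<bullet> (dderiv (metric_mat AQ g c) y (X_coord c b y) *v v c) / 2" for b
  proof -
    let ?P = "\<lambda>z. deriv_at TQ (lagrangian g) z (vertical_lift AQ (X b) z)"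
    have vf: "vector_field AQ (X b)" using X_sections[of b] by (simp add: sections_def)
    have "((\<lambda>(y, z :: real^'m). ?P (chart_inv c y, tcomb (\<lambda>a. z $ a) (\<lambda>a. X a (chart_inv c y)))) has_derivative
      (\<lambda>(dy, dz :: real^'m). \<Sum>a\<in>UNIV. z a * dderiv (\<lambda>y. base_metric (chart_inv c y) $ a $ b) y dy + dz $ a * base_metric (chart_inv c y) $ a $ b))
      (at (y, \<chi> a. z a))"
    proof (rule has_derivative_linear_combination[OF _ op yc])
      show "(\<lambda>y. base_metric (chart_inv c y) $ a $ b) differentiable at y" for a
        unfolding y by (rule base_metric_differentiable[OF cA])
      fix y' and z' :: "real^'m" assume y': "y' \<in> chart_img c"
      note p' = chart_point[OF y']
      show "(\<lambda>(y, z :: real^'m). ?P (chart_inv c y, tcomb (\<lambda>a. z $ a) (\<lambda>a. X a (chart_inv c y)))) (y', z')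
        = (\<Sum>a\<in>UNIV. z' $ a * base_metric (chart_inv c y') $ a $ b)"
        using deriv_lagrangian_vertical[of "chart_inv c y'" "tcomb (\<lambda>a. z' $ a) (\<lambda>a. X a (chart_inv c y'))" "X b", OF p' tcomb_X_tangent[OF p'] X_tangent[OF p']]
          metric_tcomb_X[OF p' X_tangent[OF p']] by (simp add: base_metric_def)
    qed
    from deriv_on_constraint[OF cA momentum_extension[OF vf pC, unfolded v] \<Gamma>T[unfolded v] \<Gamma>c[unfolded v y] this[unfolded y]]
    have "deriv_on TQ \<C> ?P ?p (\<Gamma> ?p) = (\<Sum>a\<in>UNIV. z a * dderiv (\<lambda>y. base_metric (chart_inv c y) $ a $ b) y (v c) + \<zeta> a * base_metric q $ a $ b)"
      by (simp add: v y chart_inv_AQ[OF cA])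
    moreover have "deriv_at TQ (lagrangian g) ?p (complete_lift AQ (X b) ?p)
      = dderiv (X_coord c b) y (v c) \<bullet> (metric_mat AQ g c y *v v c)
        + v c \<bullet> (dderiv (metric_mat AQ g c) y (X_coord c b y) *v v c) / 2"
      using deriv_lagrangian[OF cA vT complete_lift_tangent[OF q vT] complete_lift_chart[OF q vT, folded c]]
      by (simp add: X_coord_eta y X_coord_at[OF cA])
    ultimately show ?thesis using NH[OF X_sections[of b]] by simp
  qed
  have 3: "(\<Sum>a\<in>UNIV. z a * dderiv (\<lambda>y. \<mu> a i (chart_inv c y)) y (v c) + \<zeta> a * \<mu> a i q) = 0" for i
  proof -
    let ?M = "\<lambda>p. \<Sum>a\<in>UNIV. \<mu> a i (fst p) * velocity_coeff X p a"
    have fi: "first_integral AQ \<D> \<Gamma> ?M" using integral by blast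
    have z0: "deriv_on TQ \<C> ?M ?p (\<Gamma> ?p) = 0"
      using fi pC unfolding first_integral_def Let_def by blast
    have "smooth_fun_on TQ \<C> ?M"
      using fi unfolding first_integral_def Let_def by blast
    then obtain F where F: "local_extension TQ \<C> ?M ?p F"
      using pC unfolding smooth_fun_on_def by blast
    have "((\<lambda>(y, z :: real^'m). ?M (chart_inv c y, tcomb (\<lambda>a. z $ a) (\<lambda>a. X a (chart_inv c y)))) has_derivative
      (\<lambda>(dy, dz :: real^'m). \<Sum>a\<in>UNIV. z a * dderiv (\<lambda>y. \<mu> a i (chart_inv c y)) y dy + dz $ a * \<mu> a i (chart_inv c y)))
      (at (y, \<chi> a. z a))"
    proof (rule has_derivative_linear_combination[OF _ op yc])
      show "(\<lambda>y. \<mu> a i (chart_inv c y)) differentiable at y" for a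
        unfolding y by (rule \<mu>_differentiable[OF cA])
      fix y' and z' :: "real^'m" assume y': "y' \<in> chart_img c"
      show "(\<lambda>(y, z :: real^'m). ?M (chart_inv c y, tcomb (\<lambda>a. z $ a) (\<lambda>a. X a (chart_inv c y)))) (y', z')
        = (\<Sum>a\<in>UNIV. z' $ a * \<mu> a i (chart_inv c y'))"
        by (simp add: velocity_coeff_tcomb[OF chart_point[OF y']] mult.commute)
    qed
    from deriv_on_constraint[OF cA F[unfolded v] \<Gamma>T[unfolded v] \<Gamma>c[unfolded v y] this[unfolded y]]
    have "deriv_on TQ \<C> ?M ?p (\<Gamma> ?p) = (\<Sum>a\<in>UNIV. z a * dderiv (\<lambda>y. \<mu> a i (chart_inv c y)) y (v c) + \<zeta> a * \<mu> a i q)"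
      by (simp add: v y chart_inv_AQ[OF cA])
    then show ?thesis using z0 by simp
  qed
  show ?thesis by (rule that[OF 1]) (use 2 3 in blast)+
qed

abbreviation "\<gamma> \<equiv> extended_metric \<mu>"

lemma riemannian_\<gamma>: "riemannian_metric AQ \<gamma>"
  by (rule riemannian_extended_metric[OF smooth_\<mu>])

text \<open>The comparison of \<open>g\<close> with the extended metric. The field \<open>Y\<close> extends \<open>v\<close> with constant components in
  the frame, and \<open>Q = G\<^sub>a\<^sub>b v\<^sup>a v\<^sup>b\<close> is its length squared in both metrics.\<close>
lemma euler_lagrange_extended_metric:
  assumes q: "q \<in> points AQ" and v: "v = tcomb z (\<lambda>a. X a q)"
    and c: "c = chart_at AQ q" and y: "y = snd c q"
    and F: "F = (\<Sum>a\<in>UNIV. z a *\<^sub>R dderiv (X_coord c a) y (v c) + \<zeta> a *\<^sub>R X_coord c a y)"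
    and nh: "\<And>b. (\<Sum>a\<in>UNIV. z a * dderiv (\<lambda>y. base_metric (chart_inv c y) $ a $ b) y (v c) + \<zeta> a * base_metric q $ a $ b) =
      dderiv (X_coord c b) y (v c) \<bullet> (metric_mat AQ g c y *v v c)
        + v c \<bullet> (dderiv (metric_mat AQ g c) y (X_coord c b y) *v v c) / 2"
    and fi: "\<And>i. (\<Sum>a\<in>UNIV. z a * dderiv (\<lambda>y. \<mu> a i (chart_inv c y)) y (v c) + \<zeta> a * \<mu> a i q) = 0"
  shows "euler_lagrange (metric_mat AQ \<gamma> c) y (v c) F w = 0"
proof -
  let ?h = "metric_mat AQ g c" and ?k = "metric_mat AQ \<gamma> c"
  define Y where "Y y' = (\<Sum>a\<in>UNIV. z a *\<^sub>R X_coord c a y')" for y'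
  have cA: "c \<in> AQ" "q \<in> fst c" using chart_at[OF q] by (simp_all add: c)
  have yc: "y \<in> chart_img c" using cA by (simp add: chart_img_def y)
  note op = open_chart_img[OF AQ cA(1)]
  have inv: "chart_inv c y = q" unfolding y by (rule chart_inv_AQ[OF cA])
  have vD: "v \<in> \<D> q" unfolding v by (rule tcomb_X_horizontal[OF q])
  have vT: "v \<in> T q" using vD by (simp add: horizontal_def)
  have pC: "(q, v) \<in> \<C>" using q vD by (simp add: constraint_set_def)
  have vel: "velocity_coeff X (q, v) = z" unfolding v by (rule velocity_coeff_tcomb[OF q])
  have Yv: "Y y = v c" using inv by (simp add: Y_def v tcomb_def X_coord_def)
  have dX: "(X_coord c a has_derivative dderiv (X_coord c a) y) (at y)" for a
    unfolding y by (intro has_derivative_dderiv X_coord_differentiable cA)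
  have linX: "linear (dderiv (X_coord c a) y)" for a by (rule has_derivative_linear[OF dX])
  have Y': "(Y has_derivative (\<lambda>d. \<Sum>a\<in>UNIV. z a *\<^sub>R dderiv (X_coord c a) y d)) (at y)"
    unfolding Y_def by (intro has_derivative_sum has_derivative_scaleR_right dX)
  note dY = dderiv_eq[OF Y']
  have Yd: "Y differentiable at y" using Y' unfolding differentiable_def by blast
  have hd: "?h differentiable at y" unfolding y by (rule metric_mat_differentiable[OF metric cA])
  have kd: "?k differentiable at y" unfolding y by (rule metric_mat_differentiable[OF riemannian_\<gamma> cA])
  note hsym = metric_mat_form_sym[OF AQ metric cA(1) yc]
  note ksym = metric_mat_form_sym[OF AQ riemannian_\<gamma> cA(1) yc]
  have pt: "chart_inv c y' \<in> points AQ \<and> chart_inv c y' \<in> fst c \<and> snd c (chart_inv c y') = y'" if "y' \<in> chart_img c" for y'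
    using that chart_inv_AQ[OF cA(1)] in_points[OF cA(1)] by (auto simp: chart_img_def)
  have kXX: "X_coord c a y' \<bullet> (?k y' *v X_coord c b y') = base_metric (chart_inv c y') $ a $ b" if "y' \<in> chart_img c" for a b y'
    using riemannian_metric_in_chart[OF AQ riemannian_\<gamma> cA(1) _ X_tangent X_tangent, of "chart_inv c y'" a b]
      extended_metric_X_X pt[OF that] by (simp add: X_coord_def)
  have kXE: "X_coord c a y' \<bullet> (?k y' *v E_coord c i y') = \<mu> a i (chart_inv c y')" if "y' \<in> chart_img c" for a i y'
    using riemannian_metric_in_chart[OF AQ riemannian_\<gamma> cA(1) _ X_tangent generator_tangent, of "chart_inv c y'" a i]
      extended_metric_X_generator pt[OF that] by (simp add: X_coord_def E_coord_def)
  have FY: "(F - dderiv Y y (v c)) \<bullet> (?k y *v w) = (\<Sum>a\<in>UNIV. \<zeta> a * (X_coord c a y \<bullet> (?k y *v w)))" for w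
    by (simp add: F dY sum.distrib inner_sum_left)
  define Q where "Q y' = (\<Sum>a\<in>UNIV. \<Sum>b\<in>UNIV. z a * (z b * base_metric (chart_inv c y') $ a $ b))" for y'
  have Gd: "((\<lambda>y. base_metric (chart_inv c y) $ a $ b) has_derivative dderiv (\<lambda>y. base_metric (chart_inv c y) $ a $ b) y) (at y)" for a b
    unfolding y by (intro has_derivative_dderiv base_metric_differentiable cA)
  have Q': "(Q has_derivative (\<lambda>d. \<Sum>a\<in>UNIV. \<Sum>b\<in>UNIV. z a * (z b * dderiv (\<lambda>y. base_metric (chart_inv c y) $ a $ b) y d))) (at y)"
    unfolding Q_def by (intro has_derivative_sum has_derivative_mult_right Gd)
  have Qd: "Q differentiable at y" using Q' unfolding differentiable_def by blast
  have form_sum: "Y y' \<bullet> (A *v Y y') = (\<Sum>a\<in>UNIV. \<Sum>b\<in>UNIV. z a * (z b * (X_coord c a y' \<bullet> (A *v X_coord c b y'))))"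
    for A :: "real^'n^'n" and y'
    unfolding Y_def
    by (simp add: inner_sum_left inner_sum_right linear_sum[OF matrix_vector_mul_linear] matrix_vector_mult_scaleR sum_distrib_left mult_ac,
        subst sum.swap, simp add: mult_ac)
  have hYY: "dderiv (\<lambda>y. Y y \<bullet> (?h y *v Y y)) y d = dderiv Q y d" for d
    by (rule dderiv_cong[OF op yc Qd, symmetric]) (simp add: form_sum Q_def base_metric_chart[OF cA(1)])
  have kYY: "dderiv (\<lambda>y. Y y \<bullet> (?k y *v Y y)) y d = dderiv Q y d" for d
    by (rule dderiv_cong[OF op yc Qd, symmetric]) (simp add: form_sum Q_def kXX)
  \<comment> \<open>Horizontal test vectors: the nonholonomic equations leave only the bracket \<open>D = [X\<^sub>b, Y]\<close>, paired with
    \<open>v\<close> by the difference of the two metrics.\<close>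
  have EL_X: "euler_lagrange ?k y (v c) F (X_coord c b y) = 0" for b
  proof -
    define D where "D = dderiv Y y (X_coord c b y) - dderiv (X_coord c b) y (v c)"
    have Xbd: "X_coord c b differentiable at y" using dX unfolding differentiable_def by blast
    have kYX': "((\<lambda>y. \<Sum>a\<in>UNIV. z a * base_metric (chart_inv c y) $ a $ b) has_derivative
       (\<lambda>d. \<Sum>a\<in>UNIV. z a * dderiv (\<lambda>y. base_metric (chart_inv c y) $ a $ b) y d)) (at y)"
      by (intro has_derivative_sum has_derivative_mult_right Gd)
    then have "((\<lambda>y. Y y \<bullet> (?k y *v X_coord c b y)) has_derivative
       (\<lambda>d. \<Sum>a\<in>UNIV. z a * dderiv (\<lambda>y. base_metric (chart_inv c y) $ a $ b) y d)) (at y)"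
      by (rule has_derivative_transform_within_open[OF _ op yc]) (simp add: Y_def inner_sum_left kXX)
    note kYX = dderiv_eq[OF this]
    have "dderiv Q y (X_coord c b y) = 2 * (dderiv Y y (X_coord c b y) \<bullet> (?h y *v v c)) + v c \<bullet> (dderiv ?h y (X_coord c b y) *v v c)"
      using dderiv_eq[OF has_derivative_quadratic[OF hd Yd Yd], of "X_coord c b y"] hYY[of "X_coord c b y"]
        hsym[of "v c" "dderiv Y y (X_coord c b y)"] by (simp add: Yv)
    moreover have "euler_lagrange ?k y (v c) F (X_coord c b y) = (\<Sum>a\<in>UNIV. \<zeta> a * base_metric q $ a $ b)
       + (\<Sum>a\<in>UNIV. z a * dderiv (\<lambda>y. base_metric (chart_inv c y) $ a $ b) y (v c)) - dderiv Q y (X_coord c b y) / 2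
       + v c \<bullet> (?k y *v D)"
      using euler_lagrange_along_fields[OF kd Yd Xbd ksym, of F]
      unfolding Yv FY kYX kYY kXX[OF yc] D_def inv .
    ultimately have "euler_lagrange ?k y (v c) F (X_coord c b y) = v c \<bullet> (?k y *v D) - D \<bullet> (?h y *v v c)"
      using nh[of b] unfolding D_def inner_diff_left sum.distrib by linarith
    then have 1: "euler_lagrange ?k y (v c) F (X_coord c b y) = v c \<bullet> (?k y *v D) - v c \<bullet> (?h y *v D)"
      using hsym[of D "v c"] by simp
    \<comment> \<open>The structure functions enter with the bracket \<open>[X\<^sub>a, X\<^sub>b]\<close>, hence the sign in \<open>D\<close> below.\<close>
    have br: "dderiv (X_coord c b) y (X_coord c a y) - dderiv (X_coord c a) y (X_coord c b y) = (\<Sum>k\<in>UNIV. B k a b q *\<^sub>R E_coord c k y)" for a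
    proof -
      have eta: "(\<lambda>y. X a (chart_inv c y) c) = X_coord c a" for a by (simp add: X_coord_def fun_eq_iff)
      have "lie_bracket AQ (X a) (X b) q c = dderiv (X_coord c b) y (X_coord c a y) - dderiv (X_coord c a) y (X_coord c b y)"
        using coord_vec_chart[OF AQ cA] by (simp add: lie_bracket_def Let_def c[symmetric] eta y X_coord_at[OF cA])
      then show ?thesis
        using bracket q by (simp add: tcomb_def E_coord_at[OF cA] y)
    qed
    have D: "D = - (\<Sum>a\<in>UNIV. z a *\<^sub>R (\<Sum>k\<in>UNIV. B k a b q *\<^sub>R E_coord c k y))"
    proof -
      have "dderiv (X_coord c b) y (v c) = (\<Sum>a\<in>UNIV. z a *\<^sub>R dderiv (X_coord c b) y (X_coord c a y))"
        unfolding Yv[symmetric] Y_def by (simp add: linear_sum[OF linX] linear_cmul[OF linX])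
      then have "D = - (\<Sum>a\<in>UNIV. z a *\<^sub>R (dderiv (X_coord c b) y (X_coord c a y) - dderiv (X_coord c a) y (X_coord c b y)))"
        by (simp add: D_def dY scaleR_diff_right sum_subtractf)
      then show ?thesis by (simp only: br)
    qed
    have vD_form: "v c \<bullet> (A *v D) = - (\<Sum>a\<in>UNIV. \<Sum>k\<in>UNIV. z a * (B k a b q * (v c \<bullet> (A *v E_coord c k y))))" for A :: "real^'n^'n"
      unfolding D
      by (simp add: inner_sum_right linear_neg[OF matrix_vector_mul_linear] linear_sum[OF matrix_vector_mul_linear]
          matrix_vector_mult_scaleR sum_distrib_left mult_ac)
    have kE: "v c \<bullet> (?k y *v E_coord c k y) = (\<Sum>a\<in>UNIV. \<mu> a k q * z a)" for k
      unfolding Yv[symmetric] Y_def by (simp add: inner_sum_left kXE[OF yc] inv mult.commute)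
    have hE: "v c \<bullet> (?h y *v E_coord c k y) = (\<Sum>a\<in>UNIV. z a * g q (X a q) (E\<^sub>Q k q))" for k
    proof -
      have "g q v (E\<^sub>Q k q) = v c \<bullet> (?h y *v E_coord c k y)"
        using riemannian_metric_in_chart[OF AQ metric cA vT generator_tangent[OF q]] by (simp add: y E_coord_at[OF cA])
      then show ?thesis using metric_tcomb_X[OF q generator_tangent[OF q], of z k] by (simp add: v)
    qed
    have cp: "(\<Sum>k\<in>UNIV. \<Sum>a\<in>UNIV. (\<Sum>a\<in>UNIV. \<mu> a k q * z a) * B k a b q * z a)
       = (\<Sum>a\<in>UNIV. \<Sum>b'\<in>UNIV. \<Sum>k\<in>UNIV. g q (X b' q) (E\<^sub>Q k q) * B k a b q * z b' * z a)"
      using bspec[OF compat pC] by (simp add: vel)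
    have l: "v c \<bullet> (?k y *v D) = - (\<Sum>k\<in>UNIV. \<Sum>a\<in>UNIV. (\<Sum>a\<in>UNIV. \<mu> a k q * z a) * B k a b q * z a)"
      unfolding vD_form kE by (subst sum.swap) (simp add: mult_ac)
    have r: "v c \<bullet> (?h y *v D) = - (\<Sum>a\<in>UNIV. \<Sum>b'\<in>UNIV. \<Sum>k\<in>UNIV. g q (X b' q) (E\<^sub>Q k q) * B k a b q * z b' * z a)"
      unfolding vD_form hE sum_distrib_left
      by (subst (2) sum.swap) (simp add: mult_ac)
    show ?thesis unfolding 1 l r cp by simp
  qed
  \<comment> \<open>Vertical test vectors: invariance removes the bracket and the derivative of \<open>Q\<close>, and the
    conservation law is what is left.\<close>
  have EL_E: "euler_lagrange ?k y (v c) F (E_coord c i y) = 0" for i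
  proof -
    have Ed: "E_coord c i differentiable at y" unfolding y by (rule E_coord_differentiable[OF cA])
    have "((\<lambda>y. \<Sum>a\<in>UNIV. z a * \<mu> a i (chart_inv c y)) has_derivative
       (\<lambda>d. \<Sum>a\<in>UNIV. z a * dderiv (\<lambda>y. \<mu> a i (chart_inv c y)) y d)) (at y)"
      unfolding y by (intro has_derivative_sum has_derivative_mult_right has_derivative_dderiv \<mu>_differentiable cA)
    then have "((\<lambda>y. Y y \<bullet> (?k y *v E_coord c i y)) has_derivative
       (\<lambda>d. \<Sum>a\<in>UNIV. z a * dderiv (\<lambda>y. \<mu> a i (chart_inv c y)) y d)) (at y)"
      by (rule has_derivative_transform_within_open[OF _ op yc]) (simp add: Y_def inner_sum_left kXE)
    note kYE = dderiv_eq[OF this]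
    have QE: "dderiv Q y (E_coord c i y) = 0"
      unfolding dderiv_eq[OF Q'] using base_metric_invariant[OF cA] by (simp add: y)
    have "dderiv (E_coord c i) y (v c) = (\<Sum>a\<in>UNIV. z a *\<^sub>R dderiv (E_coord c i) y (X_coord c a y))"
      unfolding Yv[symmetric] Y_def
      using dderiv_linear[OF Ed] by (simp add: linear_sum linear_cmul)
    also have "\<dots> = dderiv Y y (E_coord c i y)"
      unfolding dY using E_coord_commutes[OF cA] by (simp add: y)
    finally have comm: "dderiv Y y (E_coord c i y) - dderiv (E_coord c i) y (v c) = 0" by simp
    show ?thesis
      using euler_lagrange_along_fields[OF kd Yd Ed ksym, of F] fi[of i]
      unfolding Yv FY kYE kYY kXE[OF yc] comm inv QE by (simp add: sum.distrib)
  qed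
  have lin: "linear (euler_lagrange ?k y (v c) F)" by (rule euler_lagrange_linear[OF kd])
  let ?w = "coord_vec AQ c q w"
  have "w = ?w c" using coord_vec_chart[OF AQ cA] by simp
  also have "?w c = (\<Sum>a\<in>UNIV. \<alpha> q ?w $ a *\<^sub>R X_coord c a y) + (\<Sum>i\<in>UNIV. \<beta> q ?w $ i *\<^sub>R E_coord c i y)"
    using fun_cong[OF frame_expansion[OF q coord_vec_in_tangent_space[OF AQ cA, of w]], of c]
    by (simp add: tlin_def tcomb_def y X_coord_at[OF cA] E_coord_at[OF cA])
  finally have w: "w = (\<Sum>a\<in>UNIV. \<alpha> q ?w $ a *\<^sub>R X_coord c a y) + (\<Sum>i\<in>UNIV. \<beta> q ?w $ i *\<^sub>R E_coord c i y)" .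
  show ?thesis
    by (subst w) (simp add: linear_add[OF lin] linear_sum[OF lin] linear_cmul[OF lin] EL_X EL_E)
qed

theorem geodesic_extension_extended_metric: "geodesic_extension AQ \<D> \<Gamma> \<gamma>"
  unfolding geodesic_extension_def
proof (intro conjI ballI riemannian_\<gamma>)
  fix p assume "p \<in> \<C>"
  then obtain q v where p: "p = (q, v)" "q \<in> points AQ" "v \<in> \<D> q"
    by (auto simp: constraint_set_def)
  define z where "z a = \<alpha> q v $ a" for a
  define c where "c = chart_at AQ q"
  define y where "y = snd c q"
  have cA: "c \<in> AQ" "q \<in> fst c" using chart_at[OF p(2)] by (simp_all add: c_def)
  have v: "v = tcomb z (\<lambda>a. X a q)"
    using horizontal_expansion[OF p(2,3)] by (simp add: z_def[abs_def])
  obtain \<zeta> where \<Gamma>: "\<Gamma> (q, v) = coord_vec TQ (lift_chart AQ c) (q, v)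
       (v c, \<Sum>a\<in>UNIV. z a *\<^sub>R dderiv (X_coord c a) y (v c) + \<zeta> a *\<^sub>R X_coord c a y)"
    and nh: "\<forall>b. (\<Sum>a\<in>UNIV. z a * dderiv (\<lambda>y. base_metric (chart_inv c y) $ a $ b) y (v c) + \<zeta> a * base_metric q $ a $ b) =
      dderiv (X_coord c b) y (v c) \<bullet> (metric_mat AQ g c y *v v c)
        + v c \<bullet> (dderiv (metric_mat AQ g c) y (X_coord c b y) *v v c) / 2"
    and fi: "\<forall>i. (\<Sum>a\<in>UNIV. z a * dderiv (\<lambda>y. \<mu> a i (chart_inv c y)) y (v c) + \<zeta> a * \<mu> a i q) = 0"
    by (rule nonholonomic_in_chart[OF p(2) v c_def y_def])
  let ?F = "\<Sum>a\<in>UNIV. z a *\<^sub>R dderiv (X_coord c a) y (v c) + \<zeta> a *\<^sub>R X_coord c a y"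
  have el: "euler_lagrange (metric_mat AQ \<gamma> c) y (v c) ?F w = 0" for w
    by (rule euler_lagrange_extended_metric[OF p(2) v c_def y_def refl nh[rule_format] fi[rule_format]])
  have "?F = - (\<chi> k. \<Sum>i\<in>UNIV. \<Sum>j\<in>UNIV. christoffel AQ \<gamma> c y k i j * v c $ i * v c $ j)"
  proof (rule vec_eq_iff[THEN iffD2], rule allI)
    fix k
    have "?F $ k = - (\<Sum>i\<in>UNIV. \<Sum>j\<in>UNIV. (1 / 2 * (\<Sum>l\<in>UNIV. matrix_inv (metric_mat AQ \<gamma> c y) $ k $ l *
    (dderiv (\<lambda>y. metric_mat AQ \<gamma> c y $ j $ l) y (axis i 1) + dderiv (\<lambda>y. metric_mat AQ \<gamma> c y $ i $ l) y (axis j 1)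
     - dderiv (\<lambda>y. metric_mat AQ \<gamma> c y $ i $ j) y (axis l 1)))) * v c $ i * v c $ j)"
    proof (rule spray_of_euler_lagrange[OF _ _ open_chart_img[OF AQ cA(1)] _ _ el])
      show "metric_mat AQ \<gamma> c differentiable at y"
        unfolding y_def by (rule metric_mat_differentiable[OF riemannian_\<gamma> cA])
      show "invertible (metric_mat AQ \<gamma> c y)"
        unfolding y_def by (rule metric_mat_invertible[OF AQ riemannian_\<gamma> cA])
      show "y \<in> chart_img c" using cA by (simp add: chart_img_def y_def)
    qed (rule metric_mat_symmetric[OF AQ riemannian_\<gamma> cA(1)])
    then show "?F $ k = (- (\<chi> k. \<Sum>i\<in>UNIV. \<Sum>j\<in>UNIV. christoffel AQ \<gamma> c y k i j * v c $ i * v c $ j)) $ k"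
      by (simp add: christoffel_def Let_def)
  qed
  then show "geodesic_spray AQ \<gamma> p = \<Gamma> p"
    unfolding p(1) \<Gamma> by (simp add: geodesic_spray_def Let_def c_def[symmetric] y_def[symmetric])
qed

end

theorem proposition11:
  fixes G :: "('g, 'z) monoid_scheme"
    and AG :: "('g, real^'k::finite) atlas"
    and AQ :: "('q, real^'n::finite) atlas"
    and AB :: "('q set, real^'m::finite) atlas"
    and \<psi> :: "'g \<Rightarrow> 'q \<Rightarrow> 'q"
    and g :: "('q, real^'n) metric"
    and \<omega> :: "'q \<Rightarrow> ('q, real^'n) tvec \<Rightarrow> ('g, real^'k) tvec"
    and x :: "('q set, real^'m) chart"
    and X :: "'m \<Rightarrow> 'q \<Rightarrow> ('q, real^'n) tvec"
    and E :: "'k \<Rightarrow> ('g, real^'k) tvec"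
    and B :: "'k \<Rightarrow> 'm \<Rightarrow> 'm \<Rightarrow> 'q \<Rightarrow> real"
    and \<Gamma> :: "'q \<times> ('q, real^'n) tvec \<Rightarrow> ('q, real^'n) ttvec"
    and \<mu> :: "'m \<Rightarrow> 'k \<Rightarrow> 'q \<Rightarrow> real"
  defines "E\<^sub>Q \<equiv> \<lambda>i. inf_generator G AG AQ \<psi> (E i)"
    and "\<D> \<equiv> horizontal AQ \<omega>"
    and "v \<equiv> velocity_coeff X"
    and "M \<equiv> \<lambda>i p. \<Sum>a\<in>UNIV. \<mu> a i (fst p) * velocity_coeff X p a"
  assumes "chaplygin_system G AG AQ AB \<psi> g \<omega>"
    and "x \<in> AB" and "fst x = points AB"
    and "\<forall>a. horizontal_lift G AQ AB \<psi> \<omega> (\<lambda>b. coord_vec AB x b (axis a 1)) (X a)"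
    and "lie_algebra_basis G AG E"
    and "\<forall>q\<in>points AQ. \<forall>a b.
           lie_bracket AQ (X a) (X b) q = tcomb (\<lambda>j. B j a b q) (\<lambda>j. E\<^sub>Q j q)"
    and "nonholonomic_field AQ (lagrangian g) \<D> X \<Gamma>"
    and "\<forall>a i. smooth_fun AQ (\<mu> a i)"
    and "\<forall>i. first_integral AQ \<D> \<Gamma> (M i)"
    and "\<forall>p\<in>constraint_set AQ \<D>. \<forall>c.
           (\<Sum>k\<in>UNIV. \<Sum>a\<in>UNIV. M k p * B k a c (fst p) * v p a) =
           (\<Sum>a\<in>UNIV. \<Sum>b\<in>UNIV. \<Sum>k\<in>UNIV.
              g (fst p) (X b (fst p)) (E\<^sub>Q k (fst p)) * B k a c (fst p) * v p b * v p a)"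
  shows "\<exists>\<gamma>. geodesic_extension AQ \<D> \<Gamma> \<gamma>"
proof -
  interpret chaplygin_integrals G AG AQ AB \<psi> g \<omega> x X E B \<Gamma> \<mu>
    using assms(5-) unfolding E\<^sub>Q_def \<D>_def v_def M_def by unfold_locales
  show ?thesis using geodesic_extension_extended_metric unfolding \<D>_def by blast
qed

end
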